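(* Let $F \subset \mathbb{R}$ be a self-conformal set containing at least two points such that $s = \dim_{\mathrm{H}}(F) < 1$. Then the following five conditions are equivalent: (1) $F$ satisfies the weak separation condition; (2) $\mathcal{H}^s(F)>0$; (3) $F$ is Ahlfors $s$-regular; (4) $\dim_{\mathrm{A}}(F) = s$; (5) $F$ satisfies the identity limit criterion.
   Context: Self-conformal sets in $\mathbb{R}$: a map on an open set $\Omega\subset\mathbb{R}$ is conformal if it is $C^1$ with non-vanishing derivative and there exist $\alpha,c>0$ with $|\varphi'(x) - \varphi'(y)| \le c|x-y|^\alpha$ for all $x,y \in \Omega$. A finite family $\{\varphi_i\}_{i=1}^N$, $N \ge 2$, is a conformal iterated function system if each $\varphi_i$ is an injective conformal mapping on a common non-empty bounded open convex set (interval) $\Omega \subset \mathbb{R}$ such that $\overline{\varphi_i(\Omega)} \subset \Omega$ and $\|\varphi_i'\| := \sup_{x \in \Omega}|\varphi_i'(x)| < 1$. The associated self-conformal set is the unique non-empty compact set $F \subset \Omega$ with $F = \bigcup_{i=1}^N \varphi_i(F)$. A self-conformal set always comes with a fixed conformal iterated function system defining it. Words: $\Sigma_*$ is the set of all finite words (including the empty word $\varnothing$) over $\{1,\dots,N\}$. For $\mathtt{i}=i_1\cdots i_n$, $\varphi_{\mathtt{i}} = \varphi_{i_1}\circ\cdots\circ\varphi_{i_n}$, with $\varphi_\varnothing$ the identity, and $\|\varphi_{\mathtt{i}}'\| = \sup_{x\in\Omega}|\varphi_{\mathtt{i}}'(x)|$. For non-empty $\mathtt{i}$, $\mathtt{i}^-$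 is the word obtained by deleting the last letter of $\mathtt{i}$. $B(x,r)$ is the closed ball. Weak separation condition: $\sup \{\#\Phi(x,r) : x \in F \text{ and } r>0 \} < \infty$, where $\Phi(x,r) = \{ \varphi_{\mathtt{i}}|_F : \operatorname{diam}(\varphi_{\mathtt{i}}(F)) \le r < \operatorname{diam}(\varphi_{\mathtt{i}^-}(F)) \text{ and } \varphi_{\mathtt{i}}(F) \cap B(x,r) \ne \emptyset \}$, a set of maps (so coinciding restrictions are counted once), $\mathtt{i}$ ranging over non-empty finite words. Identity limit criterion: $\inf\{ \|\varphi_{\mathtt{i}}'\|^{-1} \sup_{x \in F}|\varphi_{\mathtt{i}}(x)-\varphi_{\mathtt{j}}(x)| : \mathtt{i},\mathtt{j} \in \Sigma_* \text{ such that } \varphi_{\mathtt{i}}|_F \ne \varphi_{\mathtt{j}}|_F \} > 0$. $\mathcal{H}^s$ is the $s$-dimensional Hausdorff measure and $\dim_{\mathrm{H}}$ the Hausdorff dimension. A set $A$ is Ahlfors $s$-regular if there exist a Radon measure $\mu$ supported on $A$ and a constant $C \ge 1$ such that $C^{-1}r^s \le \mu(B(x,r)) \le Cr^s$ for all $x \in A$ and $0<r<\operatorname{diam}(A)$. The Assouad dimension $\dim_{\mathrm{A}}(A)$ is the infimum of all $t$ for which there exists a constant $C \ge 1$ such that each set $A \cap B(x,R)$ can be covered by at most $C(R/r)^t$ balls of radius $r$ centred in $A$, for all $0<r<R$. *)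

theory Defs
  imports "HOL-Analysis.Analysis"
begin

section \<open>Conformal iterated function systems on the line\<close>

text \<open>Maps are total functions on the reals; only their values on \<open>\<Omega>\<close> matter.\<close>

definition conformal_on :: "(real \<Rightarrow> real) \<Rightarrow> real set \<Rightarrow> bool" where
  "conformal_on f \<Omega> \<longleftrightarrow>
     open \<Omega> \<and> f C1_differentiable_on \<Omega> \<and> (\<forall>x\<in>\<Omega>. deriv f x \<noteq> 0) \<and>
     (\<exists>\<alpha>>0. \<exists>c>0. \<forall>x\<in>\<Omega>. \<forall>y\<in>\<Omega>. \<bar>deriv f x - deriv f y\<bar> \<le> c * \<bar>x - y\<bar> powr \<alpha>)"

text \<open>
  For a conformal map on a bounded set \<open>\<Omega>\<close>, and for compositions of such maps, the derivative
  is bounded on \<open>\<Omega>\<close> by the Hoelder condition, so the real supremum is the genuine one.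
\<close>

definition deriv_norm :: "real set \<Rightarrow> (real \<Rightarrow> real) \<Rightarrow> real" where
  "deriv_norm \<Omega> f = (SUP x\<in>\<Omega>. \<bar>deriv f x\<bar>)"

definition conformal_ifs :: "nat \<Rightarrow> (nat \<Rightarrow> real \<Rightarrow> real) \<Rightarrow> real set \<Rightarrow> bool" where
  "conformal_ifs N \<phi> \<Omega> \<longleftrightarrow>
     N \<ge> 2 \<and> \<Omega> \<noteq> {} \<and> bounded \<Omega> \<and> open \<Omega> \<and> convex \<Omega> \<and>
     (\<forall>i\<in>{1..N}. conformal_on (\<phi> i) \<Omega> \<and> inj_on (\<phi> i) \<Omega> \<and>
        closure (\<phi> i ` \<Omega>) \<subseteq> \<Omega> \<and> deriv_norm \<Omega> (\<phi> i) < 1)"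

definition self_conformal_set ::
    "nat \<Rightarrow> (nat \<Rightarrow> real \<Rightarrow> real) \<Rightarrow> real set \<Rightarrow> real set \<Rightarrow> bool" where
  "self_conformal_set N \<phi> \<Omega> F \<longleftrightarrow>
     conformal_ifs N \<phi> \<Omega> \<and> F \<noteq> {} \<and> compact F \<and> F \<subseteq> \<Omega> \<and> F = (\<Union>i\<in>{1..N}. \<phi> i ` F)"

abbreviation words :: "nat \<Rightarrow> nat list set" where
  "words N \<equiv> lists {1..N}"

fun word_map :: "(nat \<Rightarrow> real \<Rightarrow> real) \<Rightarrow> nat list \<Rightarrow> real \<Rightarrow> real" where
  "word_map \<phi> [] = id"
| "word_map \<phi> (i # w) = \<phi> i \<circ> word_map \<phi> w"

section \<open>Separation conditions\<close>

definition scale_maps ::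
    "nat \<Rightarrow> (nat \<Rightarrow> real \<Rightarrow> real) \<Rightarrow> real set \<Rightarrow> real \<Rightarrow> real \<Rightarrow> (real \<Rightarrow> real) set" where
  "scale_maps N \<phi> F x r =
     {restrict (word_map \<phi> w) F | w. w \<in> words N \<and> w \<noteq> [] \<and>
        diameter (word_map \<phi> w ` F) \<le> r \<and> r < diameter (word_map \<phi> (butlast w) ` F) \<and>
        word_map \<phi> w ` F \<inter> cball x r \<noteq> {}}"

definition weak_separation :: "nat \<Rightarrow> (nat \<Rightarrow> real \<Rightarrow> real) \<Rightarrow> real set \<Rightarrow> bool" where
  "weak_separation N \<phi> F \<longleftrightarrow>
     (\<exists>M::nat. \<forall>x\<in>F. \<forall>r>0. finite (scale_maps N \<phi> F x r) \<and> card (scale_maps N \<phi> F x r) \<le> M)"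

text \<open>The infimum is taken in the extended reals, so that it is infinite over the empty set.\<close>

definition identity_limit_criterion ::
    "nat \<Rightarrow> (nat \<Rightarrow> real \<Rightarrow> real) \<Rightarrow> real set \<Rightarrow> real set \<Rightarrow> bool" where
  "identity_limit_criterion N \<phi> \<Omega> F \<longleftrightarrow>
     0 < (INF (v, w) \<in> {(v, w). v \<in> words N \<and> w \<in> words N \<and>
                          restrict (word_map \<phi> v) F \<noteq> restrict (word_map \<phi> w) F}.
            ereal (inverse (deriv_norm \<Omega> (word_map \<phi> v)) *
                   (SUP x\<in>F. \<bar>word_map \<phi> v x - word_map \<phi> w x\<bar>)))"

section \<open>Hausdorff measure, Hausdorff dimension, Ahlfors regularity, Assouad dimension\<close>

text \<open>
  The \<open>s\<close>-th power of the diameter, with the usual conventions: the empty set contributes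
  \<open>0\<close>, and a non-empty set contributes \<open>1\<close> for \<open>s = 0\<close> (whereas \<^term>\<open>0 powr 0 = (0::real)\<close>).
\<close>

definition diam_powr :: "real \<Rightarrow> 'a::metric_space set \<Rightarrow> ennreal" where
  "diam_powr s U = (if U = {} then 0 else if s = 0 then 1 else ennreal (diameter U powr s))"

text \<open>
  Covers are sequences of sets; finite covers are padded by empty sets. Boundedness is required
  explicitly because \<^const>\<open>diameter\<close> is unspecified on unbounded sets.
\<close>

definition hausdorff_premeasure :: "real \<Rightarrow> real \<Rightarrow> 'a::metric_space set \<Rightarrow> ennreal" where
  "hausdorff_premeasure s \<delta> A =
     (INF U \<in> {U :: nat \<Rightarrow> 'a set. A \<subseteq> (\<Union>n. U n) \<and> (\<forall>n. bounded (U n) \<and> diameter (U n) \<le> \<delta>)}.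
        \<Sum>n. diam_powr s (U n))"

definition hausdorff_measure :: "real \<Rightarrow> 'a::metric_space set \<Rightarrow> ennreal" where
  "hausdorff_measure s A = (SUP \<delta>\<in>{0<..}. hausdorff_premeasure s \<delta> A)"

definition hausdorff_dim :: "'a::metric_space set \<Rightarrow> ereal" where
  "hausdorff_dim A = (INF s \<in> {s. 0 \<le> s \<and> hausdorff_measure s A = 0}. ereal s)"

definition radon_measure :: "'a::topological_space measure \<Rightarrow> bool" where
  "radon_measure \<mu> \<longleftrightarrow>
     sets \<mu> = sets borel \<and>
     (\<forall>K. compact K \<longrightarrow> emeasure \<mu> K < \<infinity>) \<and>
     (\<forall>V. open V \<longrightarrow> emeasure \<mu> V = (SUP K \<in> {K. compact K \<and> K \<subseteq> V}. emeasure \<mu> K)) \<and>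
     (\<forall>B\<in>sets borel. emeasure \<mu> B = (INF V \<in> {V. open V \<and> B \<subseteq> V}. emeasure \<mu> V))"

text \<open>For unbounded \<open>A\<close> the diameter is infinite, so there is no upper bound on the radius.\<close>

definition ahlfors_regular :: "real \<Rightarrow> 'a::metric_space set \<Rightarrow> bool" where
  "ahlfors_regular s A \<longleftrightarrow>
     (\<exists>\<mu>. radon_measure \<mu> \<and> (AE x in \<mu>. x \<in> A) \<and>
       (\<exists>C\<ge>1. \<forall>x\<in>A. \<forall>r>0. (bounded A \<longrightarrow> r < diameter A) \<longrightarrow>
          ennreal (inverse C * r powr s) \<le> emeasure \<mu> (cball x r) \<and>
          emeasure \<mu> (cball x r) \<le> ennreal (C * r powr s)))"

definition assouad_dim :: "'a::metric_space set \<Rightarrow> ereal" where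
  "assouad_dim A =
     (INF t \<in> {t. \<exists>C\<ge>1. \<forall>x\<in>A. \<forall>r R. 0 < r \<and> r < R \<longrightarrow>
                 (\<exists>S. S \<subseteq> A \<and> finite S \<and> real (card S) \<le> C * (R / r) powr t \<and>
                      A \<inter> cball x R \<subseteq> (\<Union>y\<in>S. cball y r))}.
        ereal t)"

end

theory Submission
  imports Defs "HOL-Probability.Probability"
begin

text \<open>
  The implications are proved in the cycle: positive measure, \<open>dim\<^sub>A F = s\<close>, identity limit criterion,
  weak separation, Ahlfors regularity, positive measure. Since \<open>dim\<^sub>H F = s\<close>, disjoint cylinders
  \<open>\<phi>\<^sub>w(F)\<close> always satisfy \<open>\<Sum> \<parallel>\<phi>\<^sub>w'\<parallel>\<^sup>s \<le> C\<close>, and cylinders covering \<open>F\<close> always satisfy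
  \<open>\<Sum> \<parallel>\<phi>\<^sub>w'\<parallel>\<^sup>s \<ge> 1\<close>.

  If some ball contains far more disjoint cylinders than the \<open>s\<close>-dimensional count allows, then
  tiling \<open>F\<close> by its copies yields arbitrarily cheap covers; so positive measure bounds the Assouad
  dimension. If the identity limit criterion fails, pairs of nearly equal maps can be composed to
  produce arbitrarily long, almost equally spaced chains of points in \<open>F\<close>, whence
  \<open>dim\<^sub>A F \<ge> 1 > s\<close>. The criterion gives weak separation by quantising maps on a finite net. Under
  weak separation the two bounds above hold locally, so finite nets carry the correct
  number of points at all scales, and a weak limit of their uniform distributions is an Ahlfors regular
  measure. The mass distribution principle closes the cycle.
\<close>

section \<open>Finite covers and Hausdorff measure\<close>

text \<open>Cylinders may overlap, so Hausdorff measure is not additive over them. Everything is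
  therefore phrased through finite sums of \<open>L w powr s\<close> and costs of finite covers;
  positive measure enters only as a positive lower bound for such costs. The two bounds on the sums
  come from moving the exponent: an excessive sum over disjoint cylinders, weighted by
  \<open>c\<close>, would still exceed 1 at some \<open>t > s\<close> and keep the
  \<open>t\<close>-measure positive, while a deficient sum over a covering would stay below 1 at
  some \<open>t < s\<close> and iterate to measure zero. The other obstacle is that \<open>L\<close>
  is multiplicative only up to constants, so no argument may lose a factor per iteration: the lower
  bound for costs inducts on the number of covering sets with one fixed gap, and chains of points
  are controlled together with all their prefixes. Difference quotients replace derivatives because
  the later arguments compare maps at points of \<open>F\<close> only.\<close>

definition cover_cost :: "real \<Rightarrow> 'a::metric_space set set \<Rightarrow> real" where
  "cover_cost t \<U> = (\<Sum>U\<in>\<U>. diameter U powr t)"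

definition finite_cover :: "'a::metric_space set \<Rightarrow> 'a set set \<Rightarrow> bool" where
  "finite_cover A \<U> \<longleftrightarrow> finite \<U> \<and> A \<subseteq> \<Union>\<U> \<and> (\<forall>U\<in>\<U>. bounded U)"

lemma cover_cost_nonneg: "0 \<le> cover_cost t \<U>"
  by (simp add: cover_cost_def sum_nonneg)

lemma cover_cost_image_le:
  "finite I \<Longrightarrow> cover_cost t (g ` I) \<le> (\<Sum>i\<in>I. diameter (g i) powr t)"
  unfolding cover_cost_def
  by (rule order_trans[OF sum_image_le[where g="\<lambda>U. diameter U powr t"]]) (auto simp: comp_def)

lemma cover_cost_Un_le:
  assumes "finite \<U>" "finite \<V>"
  shows "cover_cost t (\<U> \<union> \<V>) \<le> cover_cost t \<U> + cover_cost t \<V>"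
proof -
  have "cover_cost t (\<U> \<union> \<V>) + cover_cost t (\<U> \<inter> \<V>) = cover_cost t \<U> + cover_cost t \<V>"
    unfolding cover_cost_def by (rule sum.union_inter[OF assms])
  then show ?thesis using cover_cost_nonneg[of t "\<U> \<inter> \<V>"] by linarith
qed

lemma diameter_le_dist:
  fixes S :: "'a::metric_space set"
  assumes "0 \<le> d" "\<And>x y. x \<in> S \<Longrightarrow> y \<in> S \<Longrightarrow> dist x y \<le> d"
  shows "diameter S \<le> d"
proof (cases "S = {}")
  case False
  then show ?thesis using assms by (auto simp: diameter_def intro!: cSUP_least)
qed (use assms in simp)

lemma bounded_nbhd:
  fixes S :: "'a::metric_space set"
  assumes "bounded S"
  shows "bounded (\<Union>y\<in>S. ball y e)"
proof -
  obtain a r where "\<forall>y\<in>S. dist a y \<le> r"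
    using assms unfolding bounded_def by blast
  then have "dist a z \<le> r + e" if "z \<in> (\<Union>y\<in>S. ball y e)" for z
  proof -
    from that obtain y where "y \<in> S" "dist y z < e"
      by auto
    then show ?thesis using \<open>\<forall>y\<in>S. dist a y \<le> r\<close> dist_triangle[of a z y] by fastforce
  qed
  then show ?thesis unfolding bounded_def by blast
qed

lemma diameter_nbhd_le:
  fixes S :: "'a::metric_space set"
  assumes "bounded S" "0 \<le> e"
  shows "diameter (\<Union>y\<in>S. ball y e) \<le> diameter S + 2 * e"
proof (rule diameter_le_dist)
  show "0 \<le> diameter S + 2 * e" using assms diameter_ge_0[of S] by simp
next
  fix u v assume "u \<in> (\<Union>y\<in>S. ball y e)" "v \<in> (\<Union>y\<in>S. ball y e)"
  then obtain y z where yz: "y \<in> S" "z \<in> S" "dist y u < e" "dist z v < e"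
    by auto
  then have "dist y z \<le> diameter S" using diameter_bounded_bound assms by blast
  moreover have "dist u v \<le> dist u y + (dist y z + dist z v)"
    using dist_triangle[of u v y] dist_triangle[of y v z] by linarith
  ultimately show "dist u v \<le> diameter S + 2 * e" using yz by (simp add: dist_commute)
qed

text \<open>No bound on the mesh has to be supplied: each set of a cover of cost below
  \<open>\<delta> powr t\<close> has diameter at most \<open>\<delta>\<close>, so cheap covers are
  automatically fine.\<close>

lemma hausdorff_measure_eq_0I:
  fixes A :: "'a::metric_space set"
  assumes t: "0 < t"
    and cov: "\<And>\<epsilon>. 0 < \<epsilon> \<Longrightarrow> \<exists>\<U>. finite_cover A \<U> \<and> cover_cost t \<U> < \<epsilon>"
  shows "hausdorff_measure t A = 0"
proof -
  have "hausdorff_premeasure t \<delta> A \<le> ennreal \<epsilon>" if "0 < \<delta>" "0 < \<epsilon>" for \<delta> \<epsilon> :: real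
  proof -
    define \<eta> where "\<eta> = min \<epsilon> (\<delta> powr t)"
    have "0 < \<eta>" using that by (simp add: \<eta>_def)
    then obtain \<U> where U: "finite_cover A \<U>" "cover_cost t \<U> < \<eta>"
      using cov by blast
    then have fin: "finite \<U>" and sub: "A \<subseteq> \<Union>\<U>" and bdd: "\<And>U. U \<in> \<U> \<Longrightarrow> bounded U"
      by (auto simp: finite_cover_def)
    obtain f :: "nat \<Rightarrow> 'a set" where f: "bij_betw f {..<card \<U>} \<U>"
      using ex_bij_betw_nat_finite[OF fin] by (auto simp: atLeast0LessThan)
    define V where "V n = (if n < card \<U> then f n else {})" for n
    have V_in: "V n \<in> \<U>" if "n < card \<U>" for n
      using that f by (auto simp: V_def bij_betw_def)
    have small: "diameter U \<le> \<delta>" if "U \<in> \<U>" for U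
    proof -
      have "diameter U powr t \<le> cover_cost t \<U>"
        unfolding cover_cost_def using fin that by (intro member_le_sum) auto
      also have "\<dots> < \<delta> powr t" using U by (simp add: \<eta>_def)
      finally show ?thesis using t \<open>0 < \<delta>\<close> powr_mono2[of t \<delta> "diameter U"] by linarith
    qed
    have "A \<subseteq> (\<Union>n. V n)"
    proof
      fix x assume "x \<in> A"
      then obtain U where "U \<in> \<U>" "x \<in> U"
        using sub by blast
      moreover from \<open>U \<in> \<U>\<close> obtain n where "n < card \<U>" "f n = U"
        using f unfolding bij_betw_def by (metis imageE lessThan_iff)
      ultimately have "x \<in> V n" by (simp add: V_def)
      then show "x \<in> (\<Union>n. V n)" by blast
    qed
    moreover have "bounded (V n) \<and> diameter (V n) \<le> \<delta>" for n
      using V_in[of n] bdd small \<open>0 < \<delta>\<close> by (cases "n < card \<U>") (auto simp: V_def)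
    ultimately have "hausdorff_premeasure t \<delta> A \<le> (\<Sum>n. diam_powr t (V n))"
      unfolding hausdorff_premeasure_def by (intro INF_lower) auto
    also have "\<dots> = (\<Sum>n<card \<U>. diam_powr t (V n))"
      by (rule suminf_finite) (auto simp: V_def diam_powr_def)
    also have "\<dots> \<le> (\<Sum>n<card \<U>. ennreal (diameter (f n) powr t))"
      using t by (intro sum_mono) (auto simp: V_def diam_powr_def)
    also have "\<dots> = ennreal (\<Sum>n<card \<U>. diameter (f n) powr t)" by (rule sum_ennreal) auto
    also have "(\<Sum>n<card \<U>. diameter (f n) powr t) = cover_cost t \<U>"
      unfolding cover_cost_def by (rule sum.reindex_bij_betw[OF f])
    also have "ennreal (cover_cost t \<U>) \<le> ennreal \<epsilon>"
      using U by (intro ennreal_leI) (simp add: \<eta>_def)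
    finally show ?thesis .
  qed
  then have "hausdorff_premeasure t \<delta> A \<le> 0" if "0 < \<delta>" for \<delta>
    using that by (rule_tac ennreal_le_epsilon) simp
  then have "hausdorff_measure t A \<le> 0" unfolding hausdorff_measure_def by (intro SUP_least) simp
  then show ?thesis by simp
qed

text \<open>Compactness turns a countable cover into a finite one once its sets are made open.
  Fattening the \<open>n\<close>-th set by a small radius adds less than the \<open>n\<close>-th
  term of a geometric budget to its cost.\<close>

lemma hausdorff_measure_eq_0_obtain_cover:
  fixes A :: "'a::metric_space set"
  assumes t: "0 < t" and "compact A" and zero: "hausdorff_measure t A = 0" and "0 < \<epsilon>"
  obtains \<U> where "finite_cover A \<U>" "cover_cost t \<U> < \<epsilon>"
proof -
  have "hausdorff_premeasure t 1 A \<le> hausdorff_measure t A"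
    unfolding hausdorff_measure_def by (rule SUP_upper) auto
  then have "hausdorff_premeasure t 1 A < ennreal (\<epsilon> / 2)"
    using zero \<open>0 < \<epsilon>\<close> by (simp add: ennreal_zero_less_divide)
  then obtain U :: "nat \<Rightarrow> 'a set" where sub: "A \<subseteq> (\<Union>n. U n)"
    and bdd: "\<And>n. bounded (U n)" and cost: "(\<Sum>n. diam_powr t (U n)) < ennreal (\<epsilon> / 2)"
    unfolding hausdorff_premeasure_def INF_less_iff by auto
  have "\<exists>e>0. (diameter (U n) + 2 * e) powr t < diameter (U n) powr t + \<epsilon> / 2 * (1/2) ^ Suc n" for n
  proof -
    \<comment> \<open>The diameter may be zero; there continuity of \<open>powr\<close> needs
      \<open>t > 0\<close> and a nonnegative base, hence the one-sided limit.\<close>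
    have "((\<lambda>e. (diameter (U n) + 2 * e) powr t) \<longlongrightarrow> (diameter (U n) + 2 * 0) powr t) (at_right 0)"
    proof (rule tendsto_powr')
      show "((\<lambda>e. diameter (U n) + 2 * e) \<longlongrightarrow> diameter (U n) + 2 * 0) (at_right 0)"
        by (intro tendsto_intros)
      show "diameter (U n) + 2 * 0 \<noteq> 0 \<or> 0 < t \<and> (\<forall>\<^sub>F x in at_right 0. 0 \<le> diameter (U n) + 2 * x)"
        using t diameter_ge_0[OF bdd[of n]]
        by (auto intro!: eventually_mono[OF eventually_at_right_less])
    qed (rule tendsto_const)
    then have "eventually (\<lambda>e. (diameter (U n) + 2 * e) powr t <
        diameter (U n) powr t + \<epsilon> / 2 * (1/2) ^ Suc n) (at_right 0)"
      using \<open>0 < \<epsilon>\<close> by (intro order_tendstoD(2)) auto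
    then have "eventually (\<lambda>e. 0 < e \<and> (diameter (U n) + 2 * e) powr t <
        diameter (U n) powr t + \<epsilon> / 2 * (1/2) ^ Suc n) (at_right 0)"
      by (intro eventually_conj) (auto simp: eventually_at_right_less)
    then show ?thesis using eventually_happens trivial_limit_at_right_real by blast
  qed
  then obtain e where e: "\<And>n. 0 < e n"
    "\<And>n. (diameter (U n) + 2 * e n) powr t < diameter (U n) powr t + \<epsilon> / 2 * (1/2) ^ Suc n"
    by metis
  define V where "V n = (\<Union>y\<in>U n. ball y (e n))" for n
  have "U n \<subseteq> V n" for n
    using e by (force simp: V_def)
  then have "(\<Union>n. U n) \<subseteq> (\<Union>n. V n)" by (intro UN_mono) auto
  then have "A \<subseteq> (\<Union>n\<in>UNIV. V n)" using sub by (rule order_trans[rotated])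
  moreover have "open (V n)" for n
    by (auto simp: V_def)
  ultimately obtain I where I: "finite I" "A \<subseteq> (\<Union>n\<in>I. V n)"
    using compactE_image[OF \<open>compact A\<close>, of UNIV V] by auto
  define I' where "I' = {n\<in>I. U n \<noteq> {}}"
  have V_emp: "V n = {}" if "U n = {}" for n
    using that by (simp add: V_def)
  have I': "finite I'" "A \<subseteq> (\<Union>n\<in>I'. V n)" using I V_emp by (auto simp: I'_def) blast+
  have bddV: "bounded (V n)" for n
    unfolding V_def by (rule bounded_nbhd[OF bdd])
  have "finite_cover A (V ` I')" using I' bddV by (auto simp: finite_cover_def)
  moreover have "cover_cost t (V ` I') < \<epsilon>"
  proof -
    have "ennreal (\<Sum>n\<in>I'. diameter (U n) powr t) = (\<Sum>n\<in>I'. ennreal (diameter (U n) powr t))"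
      by (rule sum_ennreal[symmetric]) auto
    also have "\<dots> = (\<Sum>n\<in>I'. diam_powr t (U n))"
      using t by (intro sum.cong) (auto simp: diam_powr_def I'_def)
    also have "\<dots> \<le> (\<Sum>n. diam_powr t (U n))" using I' by (intro sum_le_suminf) auto
    also have "\<dots> < ennreal (\<epsilon> / 2)" by (rule cost)
    finally have 1: "(\<Sum>n\<in>I'. diameter (U n) powr t) < \<epsilon> / 2"
      using \<open>0 < \<epsilon>\<close> by (simp add: ennreal_less_iff sum_nonneg)
    have "(\<Sum>n\<in>I'. (1/2::real) ^ Suc n) \<le> (\<Sum>n. (1/2) ^ Suc n)"
      using I' power_half_series by (intro sum_le_suminf) (auto simp: sums_iff)
    then have 2: "(\<Sum>n\<in>I'. (1/2::real) ^ Suc n) \<le> 1" using power_half_series by (simp add: sums_iff)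
    have "cover_cost t (V ` I') \<le> (\<Sum>n\<in>I'. diameter (V n) powr t)"
      unfolding cover_cost_def using I' by (intro sum_image_le[where g="\<lambda>U. diameter U powr t", simplified comp_def]) auto
    also have "\<dots> \<le> (\<Sum>n\<in>I'. (diameter (U n) + 2 * e n) powr t)"
    proof (intro sum_mono powr_mono2)
      fix n
      show "0 \<le> diameter (V n)" by (rule diameter_ge_0[OF bddV])
      show "diameter (V n) \<le> diameter (U n) + 2 * e n"
        unfolding V_def by (rule diameter_nbhd_le[OF bdd less_imp_le[OF e(1)]])
    qed (use t in simp)
    also have "\<dots> \<le> (\<Sum>n\<in>I'. diameter (U n) powr t + \<epsilon> / 2 * (1/2) ^ Suc n)"
      using e(2) by (intro sum_mono less_imp_le)
    also have "\<dots> = (\<Sum>n\<in>I'. diameter (U n) powr t) + \<epsilon> / 2 * (\<Sum>n\<in>I'. (1/2) ^ Suc n)"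
      by (simp add: sum.distrib sum_distrib_left)
    also have "\<dots> < \<epsilon> / 2 + \<epsilon> / 2 * 1"
      using 1 2 \<open>0 < \<epsilon>\<close> by (intro add_less_le_mono mult_left_mono) auto
    finally show ?thesis by simp
  qed
  ultimately show thesis by (rule that)
qed

text \<open>Cutting the mesh at 1 makes powers of the diameters decrease in the exponent, so the
  comparison holds cover by cover.\<close>

lemma hausdorff_measure_eq_0_mono:
  fixes A :: "'a::metric_space set"
  assumes "0 \<le> s" "s < t" "hausdorff_measure s A = 0"
  shows "hausdorff_measure t A = 0"
proof -
  have "hausdorff_premeasure t \<delta> A \<le> hausdorff_premeasure s (min \<delta> 1) A" for \<delta>
    unfolding hausdorff_premeasure_def
  proof (rule INF_mono)
    fix U :: "nat \<Rightarrow> 'a set"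
    assume U: "U \<in> {U. A \<subseteq> (\<Union>n. U n) \<and> (\<forall>n. bounded (U n) \<and> diameter (U n) \<le> min \<delta> 1)}"
    have "diam_powr t (U n) \<le> diam_powr s (U n)" for n
    proof -
      have d: "0 \<le> diameter (U n)" "diameter (U n) \<le> 1" using U diameter_ge_0[of "U n"] by auto
      then have "diameter (U n) powr t \<le> diameter (U n) powr s"
        using assms by (intro powr_mono') auto
      moreover have "diameter (U n) powr t \<le> 1" using d assms by (simp add: powr_le1)
      ultimately show ?thesis using assms by (auto simp: diam_powr_def intro: ennreal_leI)
    qed
    then have "(\<Sum>n. diam_powr t (U n)) \<le> (\<Sum>n. diam_powr s (U n))" by (intro suminf_le) auto
    then show "\<exists>V\<in>{U. A \<subseteq> (\<Union>n. U n) \<and> (\<forall>n. bounded (U n) \<and> diameter (U n) \<le> \<delta>)}.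
        (\<Sum>n. diam_powr t (V n)) \<le> (\<Sum>n. diam_powr s (U n))"
      using U by (intro bexI[of _ U]) auto
  qed
  moreover have "hausdorff_premeasure s (min \<delta> 1) A \<le> hausdorff_measure s A" if "0 < \<delta>" for \<delta>
    unfolding hausdorff_measure_def using that by (intro SUP_upper) auto
  ultimately have "hausdorff_premeasure t \<delta> A \<le> 0" if "0 < \<delta>" for \<delta>
    using assms(3) that by (metis order_trans)
  then have "hausdorff_measure t A \<le> 0" unfolding hausdorff_measure_def by (intro SUP_least) simp
  then show ?thesis by simp
qed

lemma hausdorff_measure_eq_0_above_dim:
  fixes A :: "'a::metric_space set"
  assumes "hausdorff_dim A = ereal s" "s < t"
  shows "hausdorff_measure t A = 0"
proof -
  have "hausdorff_dim A < ereal t" using assms by simp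
  then obtain u where "0 \<le> u" "hausdorff_measure u A = 0" "u < t"
    unfolding hausdorff_dim_def INF_less_iff by auto
  then show ?thesis using hausdorff_measure_eq_0_mono by blast
qed

lemma hausdorff_measure_neq_0_below_dim:
  fixes A :: "'a::metric_space set"
  assumes "hausdorff_dim A = ereal s" "0 \<le> t" "t < s"
  shows "hausdorff_measure t A \<noteq> 0"
proof
  assume "hausdorff_measure t A = 0"
  then have "hausdorff_dim A \<le> ereal t"
    unfolding hausdorff_dim_def using assms by (intro INF_lower) auto
  then show False
    using assms by simp
qed

section \<open>Separated sets\<close>

definition separated_set :: "real \<Rightarrow> 'a::metric_space set \<Rightarrow> bool" where
  "separated_set r S \<longleftrightarrow> (\<forall>x\<in>S. \<forall>y\<in>S. x \<noteq> y \<longrightarrow> r < dist x y)"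

lemma separated_set_subset: "separated_set r S \<Longrightarrow> T \<subseteq> S \<Longrightarrow> separated_set r T"
  by (auto simp: separated_set_def)

lemma card_separated_le:
  assumes "separated_set r S" "finite \<U>" "S \<subseteq> \<Union>\<U>"
    and "\<And>U x y. U \<in> \<U> \<Longrightarrow> x \<in> U \<Longrightarrow> y \<in> U \<Longrightarrow> dist x y \<le> r"
  shows "finite S" "card S \<le> card \<U>"
proof -
  have "\<forall>x\<in>S. \<exists>U. U \<in> \<U> \<and> x \<in> U" using assms(3) by auto
  then obtain u where u: "\<And>x. x \<in> S \<Longrightarrow> u x \<in> \<U> \<and> x \<in> u x"
    by metis
  have "inj_on u S"
  proof (rule inj_onI)
    fix x y assume "x \<in> S" "y \<in> S" "u x = u y"
    then have "dist x y \<le> r" using u[of x] u[of y] assms(4)[of "u x" x y] by auto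
    then show "x = y" using assms(1) \<open>x \<in> S\<close> \<open>y \<in> S\<close> by (force simp: separated_set_def)
  qed
  moreover have "u ` S \<subseteq> \<U>" using u by auto
  ultimately show "finite S" "card S \<le> card \<U>"
    using assms(2) by (auto intro: inj_on_finite card_inj_on_le)
qed

text \<open>Total boundedness caps the size of a separated subset; one of largest cardinality cannot
  be enlarged, so it is a net.\<close>

lemma ex_maximal_separated_set:
  fixes A :: "'a::heine_borel set"
  assumes "bounded A" "0 < r"
  obtains S where "S \<subseteq> A" "finite S" "separated_set r S" "A \<subseteq> (\<Union>y\<in>S. cball y r)"
proof -
  have "compact (closure A)" using assms by (simp add: compact_closure)
  then obtain k where k: "finite k" "closure A \<subseteq> (\<Union>x\<in>k. ball x (r / 2))"
    using assms compact_eq_totally_bounded[of "closure A"] by (metis half_gt_zero)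
  have bound: "finite S \<and> card S \<le> card ((\<lambda>x. ball x (r/2)) ` k)" if "separated_set r S" "S \<subseteq> A" for S
  proof -
    have "dist x y \<le> r" if "U \<in> (\<lambda>x. ball x (r/2)) ` k" "x \<in> U" "y \<in> U" for U x y
      using that dist_triangle_half_r[of _ x r y] by (force simp: less_imp_le)
    then show ?thesis
      using card_separated_le[OF that(1), of "(\<lambda>x. ball x (r/2)) ` k"] k that(2) closure_subset[of A]
      by (meson finite_imageI order_trans)
  qed
  define P where "P m \<longleftrightarrow> (\<exists>S. separated_set r S \<and> S \<subseteq> A \<and> card S = m)" for m
  have "P 0" unfolding P_def by (intro exI[of _ "{}"]) (auto simp: separated_set_def)
  moreover have "\<forall>m. P m \<longrightarrow> m \<le> card ((\<lambda>x. ball x (r/2)) ` k)" using bound by (auto simp: P_def)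
  ultimately obtain m where m: "P m" "\<And>m'. P m' \<Longrightarrow> m' \<le> m"
    using GreatestI_nat[of P] Greatest_le_nat[of P] by blast
  then obtain S where S: "separated_set r S" "S \<subseteq> A" "card S = m"
    by (auto simp: P_def)
  have "finite S" using bound S by blast
  have "x \<in> (\<Union>y\<in>S. cball y r)" if "x \<in> A" for x
  proof (rule ccontr)
    assume *: "\<not> ?thesis"
    then have "separated_set r (insert x S)"
      using S(1) by (auto simp: separated_set_def dist_commute not_le)
    then have "P (card (insert x S))" unfolding P_def using S(2) that by blast
    moreover have "x \<notin> S" using * assms(2) by force
    ultimately show False
      using m(2)[of "card (insert x S)"] \<open>finite S\<close> S(3) by simp
  qed
  then show thesis using that[of S] S \<open>finite S\<close> by blast
qed

section \<open>Quasi-conformal iterated function systems\<close>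

lemma word_map_append: "word_map \<phi> (u @ v) = word_map \<phi> u \<circ> word_map \<phi> v"
  by (induction u) auto

text \<open>
  Only the following consequences of conformality are used: bounded distortion (\<open>lower\<close>,
  \<open>upper\<close>), and Hoelder continuity of the derivative, phrased in terms of difference quotients
  between points of \<open>F\<close> so that the ambient interval disappears.
\<close>

locale quasi_conformal_ifs =
  fixes N :: nat and \<phi> :: "nat \<Rightarrow> real \<Rightarrow> real" and F :: "real set"
    and L :: "nat list \<Rightarrow> real" and c \<kappa> \<alpha> H :: real
  assumes compact_F: "compact F"
    and two_points: "\<exists>x\<in>F. \<exists>y\<in>F. x \<noteq> y"
    and invariant: "F = (\<Union>i\<in>{1..N}. \<phi> i ` F)"
    and c_pos: "0 < c" and c_le: "c \<le> 1"
    and \<kappa>_pos: "0 < \<kappa>" and \<kappa>_less: "\<kappa> < 1"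
    and \<alpha>_pos: "0 < \<alpha>" and H_pos: "0 < H"
    and L_Nil: "L [] = 1"
    and L_pos: "w \<in> words N \<Longrightarrow> 0 < L w"
    and L_le: "w \<in> words N \<Longrightarrow> L w \<le> \<kappa> ^ length w"
    and lower: "w \<in> words N \<Longrightarrow> x \<in> F \<Longrightarrow> y \<in> F \<Longrightarrow>
      c * L w * \<bar>x - y\<bar> \<le> \<bar>word_map \<phi> w x - word_map \<phi> w y\<bar>"
    and upper: "w \<in> words N \<Longrightarrow> x \<in> F \<Longrightarrow> y \<in> F \<Longrightarrow>
      \<bar>word_map \<phi> w x - word_map \<phi> w y\<bar> \<le> L w * \<bar>x - y\<bar>"
    and holder: "w \<in> words N \<Longrightarrow> x \<in> F \<Longrightarrow> y \<in> F \<Longrightarrow> x' \<in> F \<Longrightarrow> y' \<in> F \<Longrightarrow> x \<noteq> y \<Longrightarrow> x' \<noteq> y' \<Longrightarrow>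
      {x, y, x', y'} \<subseteq> cball z d \<Longrightarrow>
      \<bar>(word_map \<phi> w x - word_map \<phi> w y) / (x - y) - (word_map \<phi> w x' - word_map \<phi> w y') / (x' - y')\<bar>
        \<le> H * L w * (2 * d) powr \<alpha>"
    and monotone: "w \<in> words N \<Longrightarrow> \<exists>\<sigma>\<in>{1,-1}. \<forall>x\<in>F. \<forall>y\<in>F. x < y \<longrightarrow>
      0 < \<sigma> * (word_map \<phi> w y - word_map \<phi> w x)"
begin

abbreviation "f \<equiv> word_map \<phi>"

abbreviation "D \<equiv> diameter F"

lemma F_nonempty: "F \<noteq> {}"
  using two_points by auto

lemma bounded_F: "bounded F"
  using compact_F by (rule compact_imp_bounded)

lemma dist_le_D: "x \<in> F \<Longrightarrow> y \<in> F \<Longrightarrow> \<bar>x - y\<bar> \<le> D"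
  using diameter_bounded_bound[OF bounded_F] by (simp add: dist_real_def)

lemma D_pos: "0 < D"
  using two_points dist_le_D by fastforce

lemma obtain_diametral:
  obtains x y where "x \<in> F" "y \<in> F" "\<bar>x - y\<bar> = D"
  using diameter_compact_attained[OF compact_F F_nonempty] by (auto simp: dist_real_def)

lemma N_pos: "{1..N} \<noteq> {}"
  using invariant F_nonempty by auto

lemma f_append_image: "f (u @ v) ` A = f u ` f v ` A"
  by (simp add: word_map_append image_comp)

lemma f_image_subset: "w \<in> words N \<Longrightarrow> f w ` F \<subseteq> F"
proof (induction w)
  case (Cons i w)
  then have "\<phi> i ` (f w ` F) \<subseteq> \<phi> i ` F" by auto
  also have "\<dots> \<subseteq> F" using Cons.prems by (subst (2) invariant) auto
  finally show ?case by (auto simp: image_comp)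
qed simp

lemma f_in_F: "w \<in> words N \<Longrightarrow> x \<in> F \<Longrightarrow> f w x \<in> F"
  using f_image_subset by blast

lemma inj_on_f: "w \<in> words N \<Longrightarrow> inj_on (f w) F"
proof (rule inj_onI)
  fix x y assume w: "w \<in> words N" "x \<in> F" "y \<in> F" "f w x = f w y"
  then have "c * L w * \<bar>x - y\<bar> \<le> 0" using lower[of w x y] by simp
  then show "x = y" using c_pos L_pos[OF w(1)] by (simp add: mult_le_0_iff)
qed

lemma continuous_on_f: "w \<in> words N \<Longrightarrow> continuous_on F (f w)"
proof (rule lipschitz_on_continuous_on)
  assume "w \<in> words N"
  then show "(L w)-lipschitz_on F (f w)"
    using upper L_pos[of w] by (intro lipschitz_onI) (auto simp: dist_real_def)
qed

lemma compact_f_image: "w \<in> words N \<Longrightarrow> A \<subseteq> F \<Longrightarrow> compact A \<Longrightarrow> compact (f w ` A)"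
  using continuous_on_f continuous_on_subset by (blast intro: compact_continuous_image)

lemma bounded_f_image: "w \<in> words N \<Longrightarrow> bounded (f w ` F)"
  using compact_f_image compact_F compact_imp_bounded by blast

lemma diameter_f_image_le:
  assumes "w \<in> words N" "A \<subseteq> F"
  shows "diameter (f w ` A) \<le> L w * diameter A"
proof (rule diameter_le_dist)
  have bdd: "bounded A" using assms bounded_F bounded_subset by blast
  show "0 \<le> L w * diameter A" using L_pos[OF assms(1)] diameter_ge_0[OF bdd] by simp
  fix x y assume "x \<in> f w ` A" "y \<in> f w ` A"
  then obtain a b where ab: "a \<in> A" "b \<in> A" "x = f w a" "y = f w b"
    by auto
  then have "dist x y \<le> L w * dist a b" using upper assms by (auto simp: dist_real_def)
  also have "\<dots> \<le> L w * diameter A"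
    using L_pos[OF assms(1)] diameter_bounded_bound[OF bdd] ab by simp
  finally show "dist x y \<le> L w * diameter A" .
qed

lemma diameter_f_image_ge:
  assumes "w \<in> words N"
  shows "c * L w * D \<le> diameter (f w ` F)"
proof -
  obtain x y where xy: "x \<in> F" "y \<in> F" "\<bar>x - y\<bar> = D"
    by (rule obtain_diametral)
  then have "c * L w * D \<le> dist (f w x) (f w y)" using lower assms by (metis dist_real_def)
  also have "\<dots> \<le> diameter (f w ` F)"
    using xy bounded_f_image[OF assms] by (intro diameter_bounded_bound) auto
  finally show ?thesis .
qed

text \<open>Both sides are tested on a diametral pair of \<open>F\<close>: two lower bounds against
  one upper bound cost \<open>c\<^sup>2\<close>. The converse estimate \<open>L_append_le\<close>
  uses the bounds the other way round and costs a single \<open>c\<close>.\<close>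

lemma L_append_ge:
  assumes "u \<in> words N" "v \<in> words N"
  shows "c\<^sup>2 * L u * L v \<le> L (u @ v)"
proof -
  obtain x y where xy: "x \<in> F" "y \<in> F" "\<bar>x - y\<bar> = D"
    by (rule obtain_diametral)
  have "c * L u * (c * L v * D) \<le> c * L u * \<bar>f v x - f v y\<bar>"
    using lower[OF assms(2) xy(1,2)] xy(3) c_pos L_pos[OF assms(1)] by (intro mult_left_mono) auto
  also have "\<dots> \<le> \<bar>f u (f v x) - f u (f v y)\<bar>" using lower f_in_F assms xy by blast
  also have "\<dots> \<le> L (u @ v) * D" using upper[of "u @ v" x y] assms xy by (simp add: word_map_append)
  finally show ?thesis using D_pos by (simp add: power2_eq_square mult_ac)
qed

lemma L_append_le:
  assumes "u \<in> words N" "v \<in> words N"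
  shows "c * L (u @ v) \<le> L u * L v"
proof -
  obtain x y where xy: "x \<in> F" "y \<in> F" "\<bar>x - y\<bar> = D"
    by (rule obtain_diametral)
  have "c * L (u @ v) * D \<le> \<bar>f u (f v x) - f u (f v y)\<bar>"
    using lower[of "u @ v" x y] assms xy by (simp add: word_map_append)
  also have "\<dots> \<le> L u * \<bar>f v x - f v y\<bar>" using upper f_in_F assms xy by blast
  also have "\<dots> \<le> L u * (L v * D)"
    using upper[OF assms(2) xy(1,2)] xy(3) L_pos[OF assms(1)] by (intro mult_left_mono) auto
  finally show ?thesis using D_pos by (simp add: mult_ac)
qed

lemma L_le_1: "w \<in> words N \<Longrightarrow> L w \<le> 1"
  using L_le[of w] power_le_one[of \<kappa> "length w"] \<kappa>_pos \<kappa>_less by linarith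

text \<open>A lower bound for the factor by which \<open>L\<close> changes when one letter is
  appended; the square of \<open>c\<close> is the loss in \<open>L_append_ge\<close>.\<close>

definition step_ratio :: real where
  "step_ratio = c\<^sup>2 * Min (L ` (\<lambda>i. [i]) ` {1..N})"

lemma step_ratio_pos: "0 < step_ratio"
proof -
  have "Min (L ` (\<lambda>i. [i]) ` {1..N}) \<in> L ` (\<lambda>i. [i]) ` {1..N}" using N_pos by (intro Min_in) auto
  then have "0 < Min (L ` (\<lambda>i. [i]) ` {1..N})" using L_pos by auto
  then show ?thesis using c_pos by (simp add: step_ratio_def)
qed

lemma L_snoc_ge:
  assumes "w \<in> words N" "i \<in> {1..N}"
  shows "step_ratio * L w \<le> L (w @ [i])"
proof -
  have "Min (L ` (\<lambda>i. [i]) ` {1..N}) \<le> L [i]" using assms by (intro Min_le) auto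
  then have "step_ratio * L w \<le> c\<^sup>2 * L w * L [i]"
    using L_pos[OF assms(1)] c_pos by (simp add: step_ratio_def mult_ac)
  also have "\<dots> \<le> L (w @ [i])" using assms by (intro L_append_ge) auto
  finally show ?thesis .
qed

lemma F_eq_words_of_length: "x \<in> F \<Longrightarrow> \<exists>w\<in>words N. length w = n \<and> x \<in> f w ` F"
proof (induction n arbitrary: x)
  case 0
  then show ?case by (intro bexI[of _ "[]"]) auto
next
  case (Suc n)
  then have "x \<in> (\<Union>i\<in>{1..N}. \<phi> i ` F)" using invariant by simp
  then obtain i y where iy: "i \<in> {1..N}" "y \<in> F" "x = \<phi> i y"
    by blast
  then obtain w where "w \<in> words N" "length w = n" "y \<in> f w ` F"
    using Suc.IH by blast
  then show ?case using iy by (intro bexI[of _ "i # w"]) auto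
qed

lemma small_words: "0 < e \<Longrightarrow> \<exists>n. \<forall>w\<in>words N. n \<le> length w \<longrightarrow> L w < e"
proof -
  assume "0 < e"
  then obtain n where n: "\<kappa> ^ n < e"
    using real_arch_pow_inv \<kappa>_less by blast
  have "L w < e" if "w \<in> words N" "n \<le> length w" for w
    using L_le[OF that(1)] power_decreasing[OF that(2), of \<kappa>] \<kappa>_pos \<kappa>_less n by linarith
  then show ?thesis by blast
qed

lemma ex_cylinder:
  assumes "x \<in> F" "0 < r" "r < D"
  obtains w where "w \<in> words N" "w \<noteq> []" "x \<in> f w ` F" "diameter (f w ` F) \<le> r"
    "r < diameter (f (butlast w) ` F)"
proof -
  obtain n where n: "\<And>w. w \<in> words N \<Longrightarrow> n \<le> length w \<Longrightarrow> L w < r / D"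
    using small_words[of "r / D"] assms D_pos by auto
  obtain v where v: "v \<in> words N" "length v = n" "x \<in> f v ` F"
    using F_eq_words_of_length[OF assms(1)] by blast
  have sub: "take k v \<in> words N" "drop k v \<in> words N" for k
    using v(1) by (auto dest: in_set_takeD in_set_dropD)
  have mem: "x \<in> f (take k v) ` F" for k
  proof -
    have "f v ` F = f (take k v) ` f (drop k v) ` F" by (metis append_take_drop_id f_append_image)
    then show ?thesis using v(3) f_image_subset[OF sub(2)] by (metis image_mono subsetD)
  qed
  define P where "P k \<longleftrightarrow> diameter (f (take k v) ` F) \<le> r" for k
  have "P n"
    using n[OF v(1)] diameter_f_image_le[OF v(1) order_refl] D_pos v(2)
    by (simp add: P_def pos_less_divide_eq)
  \<comment> \<open>The first prefix of a long coding word of \<open>x\<close> whose cylinder has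
    diameter at most \<open>r\<close>. It is nonempty because \<open>r < D\<close> excludes length
    0, so its parent exists and is too large.\<close>
  define k where "k = (LEAST k. P k)"
  have "P k" "k \<le> n" "\<And>j. j < k \<Longrightarrow> \<not> P j"
    using LeastI[of P n] Least_le[of P n] not_less_Least[of _ P] \<open>P n\<close> unfolding k_def by blast+
  moreover have "\<not> P 0" using assms by (simp add: P_def)
  moreover from calculation have "0 < k"
    by (metis gr0I)
  ultimately have k: "0 < k" "k \<le> n" "P k" "\<not> P (k - 1)" by simp_all
  have "butlast (take k v) = take (k - 1) v" using k v(2) by (simp add: butlast_take)
  moreover have "take k v \<noteq> []" using k v(2) by auto
  ultimately show thesis using that[OF sub(1)[of k] _ mem[of k]] k by (simp add: P_def not_le)
qed

text \<open>The stopping rule makes \<open>L w\<close> comparable with the scale \<open>r\<close>: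
  the parent cylinder exceeds \<open>r\<close>, and one letter costs at most
  \<open>step_ratio\<close>.\<close>

lemma cylinder_L_bounds:
  assumes "w \<in> words N" "w \<noteq> []" "diameter (f w ` F) \<le> r" "r < diameter (f (butlast w) ` F)"
  shows "step_ratio / D * r \<le> L w" "L w \<le> r / (c * D)"
proof -
  have bl: "butlast w \<in> words N" "last w \<in> {1..N}" using assms(1,2) by (auto dest: in_set_butlastD)
  have "r \<le> L (butlast w) * D" using diameter_f_image_le[OF bl(1) order_refl] assms(4) by linarith
  then have "step_ratio / D * r \<le> step_ratio * L (butlast w)"
    using D_pos step_ratio_pos by (simp add: field_simps)
  also have "\<dots> \<le> L (butlast w @ [last w])" using bl by (rule L_snoc_ge)
  finally show "step_ratio / D * r \<le> L w" using assms(2) by simp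
  show "L w \<le> r / (c * D)"
    using diameter_f_image_ge[OF assms(1)] assms(3) c_pos D_pos by (simp add: field_simps)
qed

section \<open>Packings and coverings by cylinders\<close>

text \<open>
  A finite cover by sets shorter than the gaps between the cylinders splits into covers of the
  individual cylinders; one of these, pulled back to \<open>F\<close>, is cheaper relative to the gap and
  has fewer members, so a cheap cover cannot exist.
\<close>

lemma finite_cover_cost_ge:
  assumes I: "finite I" "\<And>i. i \<in> I \<Longrightarrow> \<omega> i \<in> words N" "disjoint_family_on (\<lambda>i. f (\<omega> i) ` F) I"
    and two: "i0 \<in> I" "i1 \<in> I" "i0 \<noteq> i1"
    and t: "0 < t" and sum1: "1 \<le> (\<Sum>i\<in>I. (c * L (\<omega> i)) powr t)"
  shows "\<exists>\<eta>>0. \<forall>\<U>. finite_cover F \<U> \<longrightarrow> \<eta> \<le> cover_cost t \<U>"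
proof -
  \<comment> \<open>A common gap exists because disjoint compact cylinders have positive distance
    and there are finitely many pairs.\<close>
  have "eventually (\<lambda>d. \<forall>i\<in>I. \<forall>j\<in>I. i \<noteq> j \<longrightarrow> (\<forall>x\<in>f (\<omega> i) ` F. \<forall>y\<in>f (\<omega> j) ` F. d \<le> dist x y)) (at_right 0)"
  proof (intro eventually_ball_finite[OF I(1)] ballI)
    fix i j assume ij: "i \<in> I" "j \<in> I"
    show "eventually (\<lambda>d. i \<noteq> j \<longrightarrow> (\<forall>x\<in>f (\<omega> i) ` F. \<forall>y\<in>f (\<omega> j) ` F. d \<le> dist x y)) (at_right 0)"
    proof (cases "i = j")
      case False
      then have "f (\<omega> i) ` F \<inter> f (\<omega> j) ` F = {}"
        using I(3) ij by (auto simp: disjoint_family_on_def)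
      then obtain \<delta> where \<delta>: "0 < \<delta>" "\<And>x y. x \<in> f (\<omega> i) ` F \<Longrightarrow> y \<in> f (\<omega> j) ` F \<Longrightarrow> \<delta> \<le> dist x y"
        using separate_compact_closed[of "f (\<omega> i) ` F" "f (\<omega> j) ` F"] I(2) ij compact_f_image[OF _ order_refl compact_F]
          compact_imp_closed by metis
      have "eventually (\<lambda>d. d < \<delta>) (at_right 0)"
        using \<delta>(1) by (rule order_tendstoD(2)[OF tendsto_ident_at])
      then show ?thesis by eventually_elim (use \<delta>(2) in force)
    qed auto
  qed
  then have "eventually (\<lambda>d. 0 < d \<and> (\<forall>i\<in>I. \<forall>j\<in>I. i \<noteq> j \<longrightarrow> (\<forall>x\<in>f (\<omega> i) ` F. \<forall>y\<in>f (\<omega> j) ` F. d \<le> dist x y)))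
      (at_right 0)"
    by (intro eventually_conj) (auto simp: eventually_at_right_less)
  from eventually_happens'[OF trivial_limit_at_right_real this] obtain d where "0 < d"
    and gap: "\<forall>i\<in>I. \<forall>j\<in>I. i \<noteq> j \<longrightarrow> (\<forall>x\<in>f (\<omega> i) ` F. \<forall>y\<in>f (\<omega> j) ` F. d \<le> dist x y)"
    by (elim exE conjE)
  have d: "d \<le> dist x y" if "i \<in> I" "j \<in> I" "i \<noteq> j" "x \<in> f (\<omega> i) ` F" "y \<in> f (\<omega> j) ` F" for i j x y
    using gap that by blast
  have "d powr t \<le> cover_cost t \<U>" if "finite_cover F \<U>" for \<U>
    using that
  proof (induction "card \<U>" arbitrary: \<U> rule: less_induct)
    case less
    then have fin: "finite \<U>" and sub: "F \<subseteq> \<Union>\<U>" and bdd: "\<And>U. U \<in> \<U> \<Longrightarrow> bounded U"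
      by (auto simp: finite_cover_def)
    show ?case
    proof (rule ccontr)
      assume "\<not> ?case"
      then have cheap: "cover_cost t \<U> < d powr t" by simp
      define \<V> where "\<V> i = {U \<in> \<U>. U \<inter> f (\<omega> i) ` F \<noteq> {}}" for i
      have \<V>_sub: "\<V> i \<subseteq> \<U>" and \<V>_fin: "finite (\<V> i)" for i
        using fin by (auto simp: \<V>_def)
      have short: "diameter U < d" if "U \<in> \<U>" for U
      proof -
        have "diameter U powr t \<le> cover_cost t \<U>"
          unfolding cover_cost_def using fin that by (intro member_le_sum) auto
        then have "diameter U powr t < d powr t" using cheap by simp
        then show ?thesis using t \<open>0 < d\<close> powr_mono2[of t d "diameter U"] by linarith
      qed
      have disj: "\<V> i \<inter> \<V> j = {}" if "i \<in> I" "j \<in> I" "i \<noteq> j" for i j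
      proof (rule ccontr)
        assume "\<V> i \<inter> \<V> j \<noteq> {}"
        then obtain U x y where "U \<in> \<U>" "x \<in> U" "y \<in> U" "x \<in> f (\<omega> i) ` F" "y \<in> f (\<omega> j) ` F"
          by (auto simp: \<V>_def)
        then show False
          using d[OF that] short[of U] diameter_bounded_bound[OF bdd[of U], of x y] by fastforce
      qed
      have ne: "\<V> i \<noteq> {}" if "i \<in> I" for i
      proof -
        obtain x where "x \<in> F"
          using F_nonempty by auto
        then have "f (\<omega> i) x \<in> \<Union>\<U>" using f_in_F I(2) that sub by blast
        then show ?thesis using \<open>x \<in> F\<close> by (auto simp: \<V>_def)
      qed
      have "(\<Sum>i\<in>I. cover_cost t (\<V> i)) = cover_cost t (\<Union>i\<in>I. \<V> i)"
        unfolding cover_cost_def using I(1) \<V>_fin disj by (subst sum.UNION_disjoint) auto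
      also have "\<dots> \<le> cover_cost t \<U>"
        unfolding cover_cost_def using fin \<V>_sub by (intro sum_mono2) auto
      also have "\<dots> < d powr t * 1" using cheap by simp
      also have "\<dots> \<le> d powr t * (\<Sum>i\<in>I. (c * L (\<omega> i)) powr t)" by (intro mult_left_mono sum1) auto
      finally have "(\<Sum>i\<in>I. cover_cost t (\<V> i)) < (\<Sum>i\<in>I. d powr t * (c * L (\<omega> i)) powr t)"
        by (simp add: sum_distrib_left)
      \<comment> \<open>The shares \<open>d powr t * (c * L (\<omega> i)) powr t\<close> add up to
        at least \<open>d powr t\<close>, which exceeds the cost of \<open>\<U>\<close>; so some
        piece is cheaper than its share.\<close>
      then obtain i where i: "i \<in> I" "cover_cost t (\<V> i) < d powr t * (c * L (\<omega> i)) powr t"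
        using sum_mono[of I "\<lambda>i. d powr t * (c * L (\<omega> i)) powr t" "\<lambda>i. cover_cost t (\<V> i)"]
        by (meson linorder_not_le)
      have wi: "\<omega> i \<in> words N" and cL: "0 < c * L (\<omega> i)" using I(2) i(1) L_pos c_pos by auto
      \<comment> \<open>Pulling back by \<open>f (\<omega> i)\<close> stretches diameters by at most
        \<open>1 / (c * L (\<omega> i))\<close>, exactly the factor in the share, so the new cover
        again costs less than \<open>d powr t\<close>.\<close>
      define \<W> where "\<W> = (\<lambda>U. {x\<in>F. f (\<omega> i) x \<in> U}) ` \<V> i"
      have cov: "finite_cover F \<W>"
        unfolding finite_cover_def
      proof (intro conjI ballI subsetI)
        fix x assume "x \<in> F"
        then obtain U where "U \<in> \<U>" "f (\<omega> i) x \<in> U"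
          using f_in_F[OF wi] sub by blast
        then show "x \<in> \<Union>\<W>" using \<open>x \<in> F\<close> by (auto simp: \<W>_def \<V>_def)
      next
        fix U assume "U \<in> \<W>"
        then show "bounded U" by (auto simp: \<W>_def intro: bounded_subset[OF bounded_F])
      qed (use \<V>_fin in \<open>auto simp: \<W>_def\<close>)
      \<comment> \<open>A second cylinder keeps at least one set of \<open>\<U>\<close> out of
        \<open>\<V> i\<close>, which makes the induction descend.\<close>
      obtain j where j: "j \<in> I" "j \<noteq> i"
        using two by blast
      have "\<V> i \<subset> \<U>" using \<V>_sub[of i] \<V>_sub[of j] ne[OF j(1)] disj[OF i(1) j(1)] j(2) by blast
      then have "card \<W> < card \<U>"
        unfolding \<W>_def using fin \<V>_fin by (meson card_image_le order_le_less_trans psubset_card_mono)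
      then have "d powr t \<le> cover_cost t \<W>" using less.hyps cov by blast
      also have "\<dots> \<le> (\<Sum>U\<in>\<V> i. diameter {x\<in>F. f (\<omega> i) x \<in> U} powr t)"
        unfolding cover_cost_def \<W>_def using \<V>_fin
        by (intro sum_image_le[where g="\<lambda>U. diameter U powr t", simplified comp_def]) auto
      also have "\<dots> \<le> (\<Sum>U\<in>\<V> i. (diameter U / (c * L (\<omega> i))) powr t)"
      proof (intro sum_mono powr_mono2)
        fix U assume "U \<in> \<V> i"
        then have bU: "bounded U" using bdd by (auto simp: \<V>_def)
        show "diameter {x\<in>F. f (\<omega> i) x \<in> U} \<le> diameter U / (c * L (\<omega> i))"
        proof (rule diameter_le_dist)
          show "0 \<le> diameter U / (c * L (\<omega> i))" using diameter_ge_0[OF bU] cL by simp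
          fix x y assume "x \<in> {x\<in>F. f (\<omega> i) x \<in> U}" "y \<in> {x\<in>F. f (\<omega> i) x \<in> U}"
          then have "c * L (\<omega> i) * dist x y \<le> diameter U"
            using lower[OF wi, of x y] diameter_bounded_bound[OF bU, of "f (\<omega> i) x" "f (\<omega> i) y"]
            by (simp add: dist_real_def)
          then show "dist x y \<le> diameter U / (c * L (\<omega> i))"
            using cL by (simp add: pos_le_divide_eq mult.commute)
        qed
        show "0 \<le> diameter {x\<in>F. f (\<omega> i) x \<in> U}"
          by (rule diameter_ge_0) (auto intro: bounded_subset[OF bounded_F])
      qed (use t in simp)
      also have "\<dots> = cover_cost t (\<V> i) / (c * L (\<omega> i)) powr t"
      proof -
        have "(diameter U / (c * L (\<omega> i))) powr t = diameter U powr t / (c * L (\<omega> i)) powr t"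
          for U :: "real set"
          by (rule powr_divide)
        then show ?thesis by (simp only: cover_cost_def sum_divide_distrib)
      qed
      also have "\<dots> < d powr t"
        by (subst pos_divide_less_eq) (use i(2) cL in \<open>auto simp: mult.commute\<close>)
      finally show False
        by simp
    qed
  qed
  moreover have "0 < d powr t" using \<open>0 < d\<close> by simp
  ultimately show ?thesis by blast
qed

lemma hausdorff_measure_neq_0I:
  assumes "finite I" "\<And>i. i \<in> I \<Longrightarrow> \<omega> i \<in> words N" "disjoint_family_on (\<lambda>i. f (\<omega> i) ` F) I"
    and "i0 \<in> I" "i1 \<in> I" "i0 \<noteq> i1"
    and "0 < t" "1 \<le> (\<Sum>i\<in>I. (c * L (\<omega> i)) powr t)"
  shows "hausdorff_measure t F \<noteq> 0"
proof
  assume zero: "hausdorff_measure t F = 0"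
  have "\<exists>\<eta>>0. \<forall>\<U>. finite_cover F \<U> \<longrightarrow> \<eta> \<le> cover_cost t \<U>"
    by (rule finite_cover_cost_ge[of I \<omega> i0 i1]) (use assms in blast)+
  then obtain \<eta> where \<eta>: "0 < \<eta>" "\<forall>\<U>. finite_cover F \<U> \<longrightarrow> \<eta> \<le> cover_cost t \<U>"
    by (elim exE conjE)
  obtain \<U> where "finite_cover F \<U>" "cover_cost t \<U> < \<eta>"
    by (rule hausdorff_measure_eq_0_obtain_cover[OF assms(7) compact_F zero \<eta>(1)])
  then show False
    using \<eta>(2) by (meson linorder_not_le)
qed

end

section \<open>Sums over cylinders at the critical exponent\<close>

locale quasi_conformal_ifs_dim = quasi_conformal_ifs +
  fixes s :: real
  assumes dim: "hausdorff_dim F = ereal s"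
begin

text \<open>Two disjoint cylinders suffice: the sum of their \<open>(c * L w) powr t\<close> tends
  to 2 as \<open>t\<close> tends to 0, so it exceeds 1 for some \<open>t > 0\<close> and the
  \<open>t\<close>-measure does not vanish.\<close>

lemma dim_pos: "0 < s"
proof -
  obtain a b where ab: "a \<in> F" "b \<in> F" "\<bar>a - b\<bar> = D"
    by (rule obtain_diametral)
  have D3: "0 < D / 3" "D / 3 < D" using D_pos by auto
  obtain v where v: "v \<in> words N" "a \<in> f v ` F" "diameter (f v ` F) \<le> D / 3"
    using ex_cylinder[OF ab(1) D3] by metis
  obtain w where w: "w \<in> words N" "b \<in> f w ` F" "diameter (f w ` F) \<le> D / 3"
    using ex_cylinder[OF ab(2) D3] by metis
  have disj: "f v ` F \<inter> f w ` F = {}"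
  proof (rule ccontr)
    assume "f v ` F \<inter> f w ` F \<noteq> {}"
    then obtain x where x: "x \<in> f v ` F" "x \<in> f w ` F"
      by auto
    have "dist a x \<le> D / 3" "dist b x \<le> D / 3"
      using diameter_bounded_bound[OF bounded_f_image[OF v(1)] v(2) x(1)] v(3)
        diameter_bounded_bound[OF bounded_f_image[OF w(1)] w(2) x(2)] w(3) by auto
    then show False
      using ab(3) D_pos dist_triangle3[of a b x] by (simp add: dist_real_def abs_minus_commute)
  qed
  then have "v \<noteq> w" using v(2) by blast
  have cL: "0 < c * L v" "0 < c * L w" using c_pos L_pos v w by auto
  then have "((\<lambda>t. (c * L v) powr t + (c * L w) powr t) \<longlongrightarrow> (c * L v) powr 0 + (c * L w) powr 0) (at_right 0)"
    by (intro tendsto_intros) auto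
  then have "eventually (\<lambda>t. 1 < (c * L v) powr t + (c * L w) powr t) (at_right 0)"
    using cL by (intro order_tendstoD(1)) auto
  then have "eventually (\<lambda>t. 0 < t \<and> 1 < (c * L v) powr t + (c * L w) powr t) (at_right 0)"
    by (intro eventually_conj) (auto simp: eventually_at_right_less)
  from eventually_happens'[OF trivial_limit_at_right_real this] obtain t where t: "0 < t" "1 < (c * L v) powr t + (c * L w) powr t"
    by blast
  have "hausdorff_measure t F \<noteq> 0" by (rule hausdorff_measure_neq_0I[of "{v, w}" id v w])
      (use v w disj t \<open>v \<noteq> w\<close> in \<open>auto simp: disjoint_family_on_def\<close>)
  then have "\<not> s < t" using hausdorff_measure_eq_0_above_dim[OF dim] by blast
  then show ?thesis using t(1) by simp
qed

text \<open>If the sum of \<open>(c * L (\<omega> i)) powr s\<close> exceeded 1, it would still do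
  so at some \<open>t > s\<close> by continuity, and \<open>hausdorff_measure_neq_0I\<close> would
  contradict the dimension. The constant only undoes the weight \<open>c\<close>.\<close>

lemma packing:
  assumes I: "finite I" "\<And>i. i \<in> I \<Longrightarrow> \<omega> i \<in> words N" "disjoint_family_on (\<lambda>i. f (\<omega> i) ` F) I"
  shows "(\<Sum>i\<in>I. L (\<omega> i) powr s) \<le> (1 / c) powr s"
proof -
  have cL: "0 < c * L (\<omega> i)" "c * L (\<omega> i) \<le> 1" if "i \<in> I" for i
    using c_pos c_le L_pos[OF I(2)[OF that]] L_le_1[OF I(2)[OF that]] by (auto intro: mult_le_one)
  have "(\<Sum>i\<in>I. (c * L (\<omega> i)) powr s) \<le> 1"
  proof (rule ccontr)
    assume "\<not> ?thesis"
    then have big: "1 < (\<Sum>i\<in>I. (c * L (\<omega> i)) powr s)" by simp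
    have "((\<lambda>t. \<Sum>i\<in>I. (c * L (\<omega> i)) powr t) \<longlongrightarrow> (\<Sum>i\<in>I. (c * L (\<omega> i)) powr s)) (at_right s)"
      using cL(1) by (intro tendsto_intros) force
    then have "eventually (\<lambda>t. 1 < (\<Sum>i\<in>I. (c * L (\<omega> i)) powr t)) (at_right s)"
      using big by (rule order_tendstoD(1))
    then have "eventually (\<lambda>t. s < t \<and> 1 < (\<Sum>i\<in>I. (c * L (\<omega> i)) powr t)) (at_right s)"
      by (intro eventually_conj) (auto simp: eventually_at_right_less)
    from eventually_happens'[OF trivial_limit_at_right_real this] obtain t where t: "s < t" "1 < (\<Sum>i\<in>I. (c * L (\<omega> i)) powr t)"
      by blast
    \<comment> \<open>The lower bound for costs needs two distinct indices; a single term is at most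
      1 and cannot account for the excess.\<close>
    have "\<not> (\<exists>i. I \<subseteq> {i})"
    proof
      assume "\<exists>i. I \<subseteq> {i}"
      then obtain i where "I \<subseteq> {i}"
        by blast
      then have "(\<Sum>i\<in>I. (c * L (\<omega> i)) powr s) \<le> 1"
        using cL dim_pos by (cases "i \<in> I") (auto simp: subset_singleton_iff powr_le1 less_imp_le)
      then show False
        using big by simp
    qed
    then obtain i0 i1 where "i0 \<in> I" "i1 \<in> I" "i0 \<noteq> i1"
      by blast
    then have "hausdorff_measure t F \<noteq> 0"
      using t dim_pos I by (intro hausdorff_measure_neq_0I[of I \<omega> i0 i1]) auto
    then show False
      using hausdorff_measure_eq_0_above_dim[OF dim t(1)] by simp
  qed
  moreover have "(\<Sum>i\<in>I. (c * L (\<omega> i)) powr s) = c powr s * (\<Sum>i\<in>I. L (\<omega> i) powr s)"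
    using cL L_pos I(2) c_pos by (simp add: sum_distrib_left powr_mult less_imp_le)
  ultimately show ?thesis using c_pos by (simp add: powr_divide field_simps)
qed

text \<open>A sum below 1 stays below 1 at some \<open>t < s\<close>. Substituting the covering into
  itself \<open>n\<close> times multiplies the cost by the \<open>n\<close>-th power of that sum, so
  the \<open>t\<close>-measure would vanish below the dimension. Only the upper distortion bound
  enters, hence no constant appears.\<close>

lemma covering:
  assumes W: "finite W" "W \<subseteq> words N" "F \<subseteq> (\<Union>w\<in>W. f w ` F)"
  shows "1 \<le> (\<Sum>w\<in>W. L w powr s)"
proof (rule ccontr)
  assume "\<not> ?thesis"
  then have small: "(\<Sum>w\<in>W. L w powr s) < 1" by simp
  have Lp: "0 < L w" if "w \<in> W" for w
    using that W(2) L_pos by blast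
  have "((\<lambda>t. \<Sum>w\<in>W. L w powr t) \<longlongrightarrow> (\<Sum>w\<in>W. L w powr s)) (at_left s)"
    using Lp by (intro tendsto_intros) force+
  then have "eventually (\<lambda>t. (\<Sum>w\<in>W. L w powr t) < 1) (at_left s)"
    using small by (rule order_tendstoD(2))
  then have "eventually (\<lambda>t. t < s \<and> 0 < t \<and> (\<Sum>w\<in>W. L w powr t) < 1) (at_left s)"
    using eventually_at_left_real[OF dim_pos] by eventually_elim auto
  from eventually_happens'[OF trivial_limit_at_left_real this] obtain t where t: "t < s" "0 < t" and small_t: "(\<Sum>w\<in>W. L w powr t) < 1"
    by blast
  define q where "q = (\<Sum>w\<in>W. L w powr t)"
  have q: "0 \<le> q" "q < 1" using small_t by (auto simp: q_def sum_nonneg)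
  have iter: "\<exists>\<U>. finite_cover F \<U> \<and> (\<forall>U\<in>\<U>. U \<subseteq> F) \<and> cover_cost t \<U> \<le> q ^ n * D powr t" for n
  proof (induction n)
    case 0
    show ?case by (intro exI[of _ "{F}"]) (auto simp: finite_cover_def cover_cost_def bounded_F)
  next
    case (Suc n)
    then obtain \<U> where U: "finite_cover F \<U>" "\<forall>U\<in>\<U>. U \<subseteq> F" "cover_cost t \<U> \<le> q ^ n * D powr t"
      by blast
    then have fin: "finite \<U>" and sub: "F \<subseteq> \<Union>\<U>" by (auto simp: finite_cover_def)
    define \<V> where "\<V> = (\<lambda>(w, U). f w ` U) ` (W \<times> \<U>)"
    have "finite_cover F \<V>"
      unfolding finite_cover_def
    proof (intro conjI ballI subsetI)
      show "finite \<V>" using W fin by (auto simp: \<V>_def)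
    next
      fix x assume "x \<in> F"
      then obtain w y where "w \<in> W" "y \<in> F" "x = f w y"
        using W by blast
      moreover then obtain U where "U \<in> \<U>" "y \<in> U"
        using sub by blast
      ultimately show "x \<in> \<Union>\<V>" by (auto simp: \<V>_def)
    next
      fix V assume "V \<in> \<V>"
      then obtain w U where "w \<in> W" "U \<in> \<U>" "V = f w ` U"
        by (auto simp: \<V>_def)
      then have "V \<subseteq> f w ` F" "w \<in> words N" using U(2) W(2) by blast+
      then show "bounded V" using bounded_f_image bounded_subset by blast
    qed
    moreover have "\<forall>V\<in>\<V>. V \<subseteq> F" using W U(2) f_in_F by (auto simp: \<V>_def) blast
    moreover have "cover_cost t \<V> \<le> q ^ Suc n * D powr t"
    proof -
      have "cover_cost t \<V> \<le> (\<Sum>(w, U)\<in>W \<times> \<U>. diameter (f w ` U) powr t)"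
        unfolding cover_cost_def \<V>_def using W fin
        by (intro order_trans[OF sum_image_le[where g="\<lambda>U. diameter U powr t"]]) (auto simp: comp_def case_prod_unfold)
      also have "\<dots> \<le> (\<Sum>(w, U)\<in>W \<times> \<U>. L w powr t * diameter U powr t)"
      proof (intro sum_mono, clarify)
        fix w U assume wU: "w \<in> W" "U \<in> \<U>"
        then have "bounded U" "w \<in> words N" "U \<subseteq> F" using U W by (auto simp: finite_cover_def)
        then have "diameter (f w ` U) powr t \<le> (L w * diameter U) powr t"
          using diameter_f_image_le t bounded_f_image[of w]
          by (intro powr_mono2 diameter_ge_0) (auto intro: bounded_subset)
        then show "diameter (f w ` U) powr t \<le> L w powr t * diameter U powr t"
          using Lp[OF wU(1)] diameter_ge_0[OF \<open>bounded U\<close>] by (simp add: powr_mult)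
      qed
      also have "\<dots> = q * cover_cost t \<U>"
        by (simp add: q_def cover_cost_def sum_product sum.cartesian_product)
      also have "\<dots> \<le> q * (q ^ n * D powr t)" using U(3) q by (intro mult_left_mono) auto
      finally show ?thesis by (simp add: mult_ac)
    qed
    ultimately show ?case by blast
  qed
  have "hausdorff_measure t F = 0"
  proof (rule hausdorff_measure_eq_0I[OF t(2)])
    fix \<epsilon> :: real assume "0 < \<epsilon>"
    have "(\<lambda>n. q ^ n * D powr t) \<longlonglongrightarrow> 0 * D powr t"
      using q by (intro tendsto_intros LIMSEQ_power_zero) auto
    then have "eventually (\<lambda>n. q ^ n * D powr t < \<epsilon>) sequentially"
      using \<open>0 < \<epsilon>\<close> by (intro order_tendstoD(2)) auto
    then obtain n where "q ^ n * D powr t < \<epsilon>"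
      using eventually_happens trivial_limit_sequentially by blast
    then show "\<exists>\<U>. finite_cover F \<U> \<and> cover_cost t \<U> < \<epsilon>"
      using iter[of n] by (meson order_le_less_trans)
  qed
  then show False
    using hausdorff_measure_neq_0_below_dim[OF dim] t by simp
qed

end

section \<open>Assouad dimension\<close>

definition covering_exponent :: "real set \<Rightarrow> real \<Rightarrow> bool" where
  "covering_exponent A t \<longleftrightarrow> (\<exists>C\<ge>1. \<forall>x\<in>A. \<forall>r R. 0 < r \<and> r < R \<longrightarrow>
     (\<exists>S. S \<subseteq> A \<and> finite S \<and> real (card S) \<le> C * (R / r) powr t \<and>
       A \<inter> cball x R \<subseteq> (\<Union>y\<in>S. cball y r)))"

lemma assouad_dim_eq: "assouad_dim A = (INF t\<in>{t. covering_exponent A t}. ereal t)" for A :: "real set"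
  by (simp add: assouad_dim_def covering_exponent_def)

lemma ex_covering_exponent_less:
  assumes "assouad_dim A = ereal s" "s < t"
  shows "\<exists>u<t. covering_exponent A u"
proof -
  have "(INF t\<in>{t. covering_exponent A t}. ereal t) < ereal t"
    using assms by (simp add: assouad_dim_eq[symmetric])
  then show ?thesis unfolding INF_less_iff by auto
qed

text \<open>A maximal separated subset of the ball is itself the set of centres of a cover, so it
  suffices to bound separated sets.\<close>

lemma covering_exponentI:
  fixes A :: "real set"
  assumes "1 \<le> C" "\<And>x r R S. x \<in> A \<Longrightarrow> 0 < r \<Longrightarrow> r < R \<Longrightarrow> S \<subseteq> A \<inter> cball x R \<Longrightarrow> finite S \<Longrightarrow>
    separated_set r S \<Longrightarrow> real (card S) \<le> C * (R / r) powr t"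
  shows "covering_exponent A t"
  unfolding covering_exponent_def
proof (intro exI[of _ C] conjI ballI allI impI)
  fix x r R :: real assume *: "x \<in> A" "0 < r \<and> r < R"
  have "bounded (A \<inter> cball x R)" using bounded_subset bounded_cball by blast
  then obtain S where "S \<subseteq> A \<inter> cball x R" "finite S" "separated_set r S" "A \<inter> cball x R \<subseteq> (\<Union>y\<in>S. cball y r)"
    using ex_maximal_separated_set[of "A \<inter> cball x R" r] * by blast
  then show "\<exists>S. S \<subseteq> A \<and> finite S \<and> real (card S) \<le> C * (R / r) powr t \<and> A \<inter> cball x R \<subseteq> (\<Union>y\<in>S. cball y r)"
    using assms(2)[of x r R S] * by blast
qed fact

text \<open>All of \<open>A\<close> lies in one ball, so an exponent \<open>t\<close> below
  \<open>s\<close> gives covers whose \<open>u\<close>-cost is of order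
  \<open>r powr (u - t)\<close> for some positive \<open>u\<close> between \<open>t\<close> and
  \<open>s\<close>, which would make the \<open>u\<close>-measure vanish.\<close>

lemma hausdorff_dim_le_covering_exponent:
  fixes A :: "real set"
  assumes A: "compact A" "A \<noteq> {}" and dim: "hausdorff_dim A = ereal s" and s: "0 < s"
    and t: "covering_exponent A t"
  shows "s \<le> t"
proof (rule ccontr)
  assume "\<not> s \<le> t"
  then obtain u where u: "t < u" "0 < u" "u < s"
    using dense[of "max t 0" s] s by auto
  obtain C where C: "1 \<le> C" "\<forall>x\<in>A. \<forall>r R. 0 < r \<and> r < R \<longrightarrow>
     (\<exists>S. S \<subseteq> A \<and> finite S \<and> real (card S) \<le> C * (R / r) powr t \<and> A \<inter> cball x R \<subseteq> (\<Union>y\<in>S. cball y r))"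
    using t unfolding covering_exponent_def by (elim exE conjE)
  obtain x where "x \<in> A"
    using A(2) by blast
  obtain R where R: "0 < R" "A \<subseteq> cball x R"
    using bounded_subset_ballD[OF compact_imp_bounded[OF A(1)], of x] ball_subset_cball by blast
  have "hausdorff_measure u A = 0"
  proof (rule hausdorff_measure_eq_0I[OF u(2)])
    fix \<epsilon> :: real assume "0 < \<epsilon>"
    have "((\<lambda>r. C * R powr t * 2 powr u * r powr (u - t)) \<longlongrightarrow> C * R powr t * 2 powr u * 0 powr (u - t)) (at_right 0)"
      using u(1) by (intro tendsto_mult tendsto_const tendsto_powr' tendsto_ident_at)
        (auto intro!: eventually_mono[OF eventually_at_right_less])
    then have "eventually (\<lambda>r. C * R powr t * 2 powr u * r powr (u - t) < \<epsilon>) (at_right 0)"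
      using u(1) \<open>0 < \<epsilon>\<close> by (intro order_tendstoD(2)) auto
    then have "eventually (\<lambda>r. 0 < r \<and> r < R \<and> C * R powr t * 2 powr u * r powr (u - t) < \<epsilon>) (at_right 0)"
      using eventually_at_right_real[OF R(1)] by eventually_elim auto
    from eventually_happens'[OF trivial_limit_at_right_real this] obtain r
      where r: "0 < r" "r < R" "C * R powr t * 2 powr u * r powr (u - t) < \<epsilon>"
      by (elim exE conjE)
    obtain S where S: "finite S" "real (card S) \<le> C * (R / r) powr t" "A \<inter> cball x R \<subseteq> (\<Union>y\<in>S. cball y r)"
      using C(2)[rule_format, OF \<open>x \<in> A\<close> conjI[OF r(1,2)]] by (elim exE conjE)
    have "finite_cover A ((\<lambda>y. cball y r) ` S)" using S R(2) by (auto simp: finite_cover_def)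
    moreover have "cover_cost u ((\<lambda>y. cball y r) ` S) < \<epsilon>"
    proof -
      have "cover_cost u ((\<lambda>y. cball y r) ` S) \<le> (\<Sum>y\<in>S. diameter (cball y r) powr u)"
        by (rule cover_cost_image_le[OF S(1)])
      also have "\<dots> = real (card S) * (2 * r) powr u" using r(1) by simp
      also have "\<dots> \<le> C * (R / r) powr t * (2 * r) powr u" using S(2) by (intro mult_right_mono) auto
      also have "\<dots> = C * R powr t * 2 powr u * r powr (u - t)"
        using r(1) R(1) by (simp add: powr_divide powr_mult powr_diff)
      also note r(3)
      finally show ?thesis .
    qed
    ultimately show "\<exists>\<U>. finite_cover A \<U> \<and> cover_cost u \<U> < \<epsilon>" by blast
  qed
  then show False
    using hausdorff_measure_neq_0_below_dim[OF dim, of u] u by simp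
qed

text \<open>A maximiser need not exist; a near-maximiser already excludes any admissible competitor
  that gains \<open>e\<close>, which is all the tiling argument uses.\<close>

lemma ex_near_Sup:
  fixes \<sigma> :: "'a \<Rightarrow> real"
  assumes "P a0" "\<And>a. P a \<Longrightarrow> \<sigma> a \<le> B" "0 < e"
  obtains a where "P a" "\<And>b. P b \<Longrightarrow> \<sigma> b < \<sigma> a + e"
proof -
  have bdd: "bdd_above (\<sigma> ` Collect P)" and ne: "\<sigma> ` Collect P \<noteq> {}"
    using assms by (auto intro!: bdd_aboveI[of _ B])
  then obtain a where "P a" "Sup (\<sigma> ` Collect P) - e < \<sigma> a"
    using less_cSupD[OF ne, of "Sup (\<sigma> ` Collect P) - e"] assms(3) by auto
  moreover have "\<sigma> b \<le> Sup (\<sigma> ` Collect P)" if "P b" for b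
    using that bdd by (auto intro: cSup_upper)
  ultimately show thesis using that[of a] by fastforce
qed

section \<open>Disjoint cylinders around separated points\<close>

context quasi_conformal_ifs
begin

text \<open>Cylinders of diameter at most \<open>r / 3\<close> around \<open>r\<close>-separated
  points lie in disjoint balls; the 3 comes from there and the rest from
  \<open>cylinder_L_bounds\<close>.\<close>

definition cell_ratio :: real where
  "cell_ratio = step_ratio / (3 * D)"

lemma cell_ratio_pos: "0 < cell_ratio"
  using step_ratio_pos D_pos by (simp add: cell_ratio_def)

lemma separated_cylinders:
  assumes "S \<subseteq> F" "separated_set r S" "0 < r" "r < D"
  obtains \<omega> where "\<And>y. y \<in> S \<Longrightarrow> \<omega> y \<in> words N" "\<And>y. y \<in> S \<Longrightarrow> f (\<omega> y) ` F \<subseteq> cball y (r / 3)"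
    "\<And>y. y \<in> S \<Longrightarrow> cell_ratio * r \<le> L (\<omega> y)" "disjoint_family_on (\<lambda>y. f (\<omega> y) ` F) S"
proof -
  have "\<exists>w. w \<in> words N \<and> f w ` F \<subseteq> cball y (r / 3) \<and> cell_ratio * r \<le> L w" if "y \<in> S" for y
  proof -
    have "y \<in> F" "0 < r / 3" "r / 3 < D" using assms that by auto
    then obtain w where w: "w \<in> words N" "w \<noteq> []" "y \<in> f w ` F" "diameter (f w ` F) \<le> r / 3"
        "r / 3 < diameter (f (butlast w) ` F)"
      by (rule ex_cylinder)
    have "f w ` F \<subseteq> cball y (r / 3)"
    proof
      fix z assume "z \<in> f w ` F"
      then have "dist y z \<le> diameter (f w ` F)"
        using diameter_bounded_bound[OF bounded_f_image[OF w(1)] w(3)] by blast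
      then show "z \<in> cball y (r / 3)" using w(4) by simp
    qed
    moreover have "cell_ratio * r \<le> L w"
      using cylinder_L_bounds(1)[OF w(1,2,4,5)] by (simp add: cell_ratio_def)
    ultimately show ?thesis using w(1) by blast
  qed
  then obtain \<omega> where \<omega>: "\<And>y. y \<in> S \<Longrightarrow> \<omega> y \<in> words N" "\<And>y. y \<in> S \<Longrightarrow> f (\<omega> y) ` F \<subseteq> cball y (r / 3)"
    "\<And>y. y \<in> S \<Longrightarrow> cell_ratio * r \<le> L (\<omega> y)"
    by metis
  have "disjoint_family_on (\<lambda>y. f (\<omega> y) ` F) S"
    unfolding disjoint_family_on_def
  proof (intro ballI impI)
    fix y z assume yz: "y \<in> S" "z \<in> S" "y \<noteq> z"
    then have "r < dist y z" using assms(2) by (simp add: separated_set_def)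
    then have "cball y (r / 3) \<inter> cball z (r / 3) = {}"
      using assms(3) by (intro disjoint_cballI) simp
    then show "f (\<omega> y) ` F \<inter> f (\<omega> z) ` F = {}" using \<omega>(2) yz by blast
  qed
  then show thesis using that[of \<omega>] \<omega> by blast
qed

lemma card_separated_le_1:
  assumes "S \<subseteq> F" "separated_set r S" "D \<le> r"
  shows "finite S" "card S \<le> 1"
proof -
  have "dist x y \<le> r" if "U \<in> {F}" "x \<in> U" "y \<in> U" for U x y
    using that dist_le_D[of x y] assms(3) by (simp add: dist_real_def)
  then show "finite S" "card S \<le> 1" using card_separated_le[OF assms(2), of "{F}"] assms(1) by auto
qed

end

context quasi_conformal_ifs_dim
begin

lemma card_separated_F_le:
  assumes S: "S \<subseteq> F" "finite S" "separated_set r S" and r: "0 < r" "r < D"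
  shows "real (card S) * (cell_ratio * r) powr s \<le> (1 / c) powr s"
proof -
  obtain \<omega> where \<omega>: "\<And>y. y \<in> S \<Longrightarrow> \<omega> y \<in> words N" "\<And>y. y \<in> S \<Longrightarrow> cell_ratio * r \<le> L (\<omega> y)"
    "disjoint_family_on (\<lambda>y. f (\<omega> y) ` F) S"
    using separated_cylinders[OF S(1,3) r] by metis
  have "real (card S) * (cell_ratio * r) powr s = (\<Sum>y\<in>S. (cell_ratio * r) powr s)" by simp
  also have "\<dots> \<le> (\<Sum>y\<in>S. L (\<omega> y) powr s)"
    using \<omega>(2) cell_ratio_pos r(1) dim_pos by (intro sum_mono powr_mono2) auto
  also have "\<dots> \<le> (1 / c) powr s" using packing[OF S(2) _ \<omega>(3)] \<omega>(1) by blast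
  finally show ?thesis .
qed

section \<open>Positive Hausdorff measure bounds the Assouad dimension\<close>

text \<open>
  If a ball of radius \<open>R\<close> contains disjoint cylinders of total mass \<open>M * R powr s\<close>, tile \<open>F\<close> with
  copies of it. A tile is covered at a cost that is \<open>1 / M\<close> times the mass of its subcylinders,
  and the total mass is bounded by the packing lemma. Near the supremum of the tiled mass no
  substantial extension is possible, hence what remains of \<open>F\<close> is covered cheaply.
\<close>

lemma cover_by_copies:
  assumes I: "finite I" "\<And>i. i \<in> I \<Longrightarrow> \<omega> i \<in> words N" "disjoint_family_on (\<lambda>i. f (\<omega> i) ` F) I"
    and sub: "\<And>i. i \<in> I \<Longrightarrow> f (\<omega> i) ` F \<subseteq> cball x (2 * R)"
    and pos: "0 < R" "0 < M" "0 < \<epsilon>"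
    and mass: "M * R powr s \<le> (\<Sum>i\<in>I. L (\<omega> i) powr s)"
  shows "\<exists>\<U>. finite_cover F \<U> \<and> cover_cost s \<U> \<le> (6 / c ^ 3) powr s / M + \<epsilon>"
proof -
  \<comment> \<open>The prototype tile; its copies under the maps \<open>f w\<close> are what
    \<open>adm\<close> keeps disjoint.\<close>
  define A where "A = (\<Union>i\<in>I. f (\<omega> i) ` F)"
  have A_F: "A \<subseteq> F" using I(2) f_in_F by (auto simp: A_def)
  have compact_A: "compact A"
    unfolding A_def using I compact_f_image compact_F by (intro compact_UN) auto
  have bounded_A: "bounded A" using compact_A by (rule compact_imp_bounded)
  have A_ball: "A \<subseteq> cball x (2 * R)" using sub by (auto simp: A_def)
  have diam_A: "diameter A \<le> 4 * R" using diameter_subset[OF A_ball bounded_cball] pos by simp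
  have "0 < M * R powr s" using pos by simp
  then have "I \<noteq> {}" using mass by auto
  then have A_ne: "A \<noteq> {}" using F_nonempty by (auto simp: A_def)
  define adm where "adm T \<longleftrightarrow> finite T \<and> T \<subseteq> words N \<and> disjoint_family_on (\<lambda>w. f w ` A) T" for T
  define \<sigma> where "\<sigma> T = (\<Sum>w\<in>T. L w powr s)" for T
  \<comment> \<open>The words \<open>w @ \<omega> i\<close> with \<open>w\<close> in
    \<open>T\<close> and \<open>i\<close> in \<open>I\<close> have disjoint cylinders, so packing
    bounds their mass by \<open>(1 / c) powr s\<close>. Up to \<open>c\<^sup>2\<close> from
    \<open>L_append_ge\<close> this mass dominates the product of \<open>\<sigma> T\<close> and the
    mass of \<open>I\<close>, which explains \<open>c ^ 3\<close>.\<close>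
  have bound: "\<sigma> T \<le> (1 / c ^ 3) powr s / (M * R powr s)" if "adm T" for T
  proof -
    have T: "finite T" "T \<subseteq> words N" "disjoint_family_on (\<lambda>w. f w ` A) T"
      using that by (auto simp: adm_def)
    have wN: "fst p \<in> words N" "\<omega> (snd p) \<in> words N" if "p \<in> T \<times> I" for p
      using that T(2) I(2)[of "snd p"] unfolding mem_Times_iff by blast+
    have "disjoint_family_on (\<lambda>p. f (fst p @ \<omega> (snd p)) ` F) (T \<times> I)"
      unfolding disjoint_family_on_def
    proof (intro ballI impI)
      fix p q assume pq: "p \<in> T \<times> I" "q \<in> T \<times> I" "p \<noteq> q"
      have in_A: "f (fst p @ \<omega> (snd p)) ` F \<subseteq> f (fst p) ` A" if "p \<in> T \<times> I" for p
        using that unfolding f_append_image A_def by (intro image_mono) auto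
      show "f (fst p @ \<omega> (snd p)) ` F \<inter> f (fst q @ \<omega> (snd q)) ` F = {}"
      proof (cases "fst p = fst q")
        case False
        moreover have "fst p \<in> T" "fst q \<in> T" using pq by auto
        ultimately have "f (fst p) ` A \<inter> f (fst q) ` A = {}"
          using T(3) unfolding disjoint_family_on_def by blast
        then show ?thesis using in_A[OF pq(1)] in_A[OF pq(2)] by blast
      next
        case True
        then have "snd p \<noteq> snd q" using pq(3) by (simp add: prod_eq_iff)
        moreover have in_I: "snd p \<in> I" "snd q \<in> I" using pq by auto
        ultimately have "f (\<omega> (snd p)) ` F \<inter> f (\<omega> (snd q)) ` F = {}"
          using I(3) unfolding disjoint_family_on_def by blast
        moreover have "fst q \<in> words N" using pq T(2) by auto
        moreover note f_image_subset[OF I(2)[OF in_I(1)]] f_image_subset[OF I(2)[OF in_I(2)]]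
        ultimately have "f (fst q) ` f (\<omega> (snd p)) ` F \<inter> f (fst q) ` f (\<omega> (snd q)) ` F = {}"
          using inj_on_image_Int[OF inj_on_f, of "fst q" "f (\<omega> (snd p)) ` F" "f (\<omega> (snd q)) ` F"] by simp
        then show ?thesis using True by (simp add: f_append_image)
      qed
    qed
    then have "(\<Sum>p\<in>T \<times> I. L (fst p @ \<omega> (snd p)) powr s) \<le> (1 / c) powr s"
      using T(1) I(1) wN by (intro packing) (simp_all only: finite_cartesian_product append_in_lists_conv)
    moreover have "(\<Sum>p\<in>T \<times> I. (c\<^sup>2) powr s * (L (fst p) powr s * L (\<omega> (snd p)) powr s))
        \<le> (\<Sum>p\<in>T \<times> I. L (fst p @ \<omega> (snd p)) powr s)"
    proof (intro sum_mono)
      fix p assume p: "p \<in> T \<times> I"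
      note w = wN[OF p]
      have "(c\<^sup>2) powr s * (L (fst p) powr s * L (\<omega> (snd p)) powr s) = (c\<^sup>2 * L (fst p) * L (\<omega> (snd p))) powr s"
        by (simp add: powr_mult)
      also have "\<dots> \<le> L (fst p @ \<omega> (snd p)) powr s"
        using L_append_ge[OF w] L_pos[OF w(1)] L_pos[OF w(2)] dim_pos by (intro powr_mono2) auto
      finally show "(c\<^sup>2) powr s * (L (fst p) powr s * L (\<omega> (snd p)) powr s) \<le> L (fst p @ \<omega> (snd p)) powr s" .
    qed
    moreover have "(\<Sum>p\<in>T \<times> I. (c\<^sup>2) powr s * (L (fst p) powr s * L (\<omega> (snd p)) powr s))
        = (c\<^sup>2) powr s * (\<sigma> T * (\<Sum>i\<in>I. L (\<omega> i) powr s))"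
      unfolding \<sigma>_def sum_product sum.cartesian_product case_prod_unfold by (rule sum_distrib_left[symmetric])
    moreover have "(c\<^sup>2) powr s * (\<sigma> T * (M * R powr s)) \<le> (c\<^sup>2) powr s * (\<sigma> T * (\<Sum>i\<in>I. L (\<omega> i) powr s))"
      using mass by (intro mult_left_mono) (auto simp: \<sigma>_def sum_nonneg)
    ultimately have "(c\<^sup>2) powr s * (\<sigma> T * (M * R powr s)) \<le> (1 / c) powr s" by linarith
    moreover have "(1 / c) powr s = (c\<^sup>2) powr s * (1 / c ^ 3) powr s"
      using c_pos by (simp add: powr_mult[symmetric] power2_eq_square power3_eq_cube)
    ultimately have "\<sigma> T * (M * R powr s) \<le> (1 / c ^ 3) powr s" using c_pos by simp
    then show ?thesis using pos by (simp add: pos_le_divide_eq)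
  qed
  \<comment> \<open>Scaled so that the balls of radius \<open>\<delta>\<close> around
    \<open>S\<close> cost at most \<open>\<epsilon>\<close> once the cylinders inside them have
    total mass at most \<open>\<epsilon>'\<close>.\<close>
  define \<epsilon>' where "\<epsilon>' = \<epsilon> / (2 / cell_ratio) powr s"
  have "0 < \<epsilon>'" using pos cell_ratio_pos by (simp add: \<epsilon>'_def)
  moreover have "adm {}" by (simp add: adm_def disjoint_family_on_def)
  ultimately obtain T where "adm T" and max: "\<And>T'. adm T' \<Longrightarrow> \<sigma> T' < \<sigma> T + \<epsilon>'"
    using ex_near_Sup[of adm "{}" \<sigma> "(1 / c ^ 3) powr s / (M * R powr s)" \<epsilon>'] bound by blast
  then have T: "finite T" "T \<subseteq> words N" "disjoint_family_on (\<lambda>w. f w ` A) T" by (auto simp: adm_def)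
  define K where "K = (\<Union>w\<in>T. f w ` A)"
  have Lp: "0 < L w" if "w \<in> T" for w
    using that T(2) L_pos by blast
  \<comment> \<open>So small that fattening a copy by \<open>\<delta>\<close> leaves its diameter of
    order \<open>R * L w\<close>, and below \<open>D\<close> so that cylinders of this scale
    exist.\<close>
  define \<delta> where "\<delta> = Min (insert (D / 2) ((\<lambda>w. R * L w) ` T))"
  have fin: "finite (insert (D / 2) ((\<lambda>w. R * L w) ` T))" using T by simp
  have \<delta>: "0 < \<delta>" "\<delta> < D" "\<And>w. w \<in> T \<Longrightarrow> \<delta> \<le> R * L w"
  proof -
    have "\<delta> \<le> D / 2" unfolding \<delta>_def by (rule Min_le[OF fin]) simp
    then show "\<delta> < D" using D_pos by simp
    show "0 < \<delta>" unfolding \<delta>_def using fin D_pos pos Lp by (subst Min_gr_iff) auto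
    show "\<delta> \<le> R * L w" if "w \<in> T" for w
      unfolding \<delta>_def by (rule Min_le[OF fin]) (use that in blast)
  qed
  \<comment> \<open>The part of \<open>F\<close> at distance at least \<open>\<delta>\<close> from
    all copies; the rest of \<open>F\<close> is covered by the fattened copies.\<close>
  define G where "G = {y\<in>F. \<forall>k\<in>K. \<delta> \<le> dist k y}"
  have "bounded G" by (rule bounded_subset[OF bounded_F]) (auto simp: G_def)
  then obtain S where S: "S \<subseteq> G" "finite S" "separated_set \<delta> S" "G \<subseteq> (\<Union>y\<in>S. cball y \<delta>)"
    using ex_maximal_separated_set \<delta>(1) by blast
  have S_F: "S \<subseteq> F" using S(1) by (auto simp: G_def)
  obtain \<psi> where \<psi>: "\<And>y. y \<in> S \<Longrightarrow> \<psi> y \<in> words N" "\<And>y. y \<in> S \<Longrightarrow> f (\<psi> y) ` F \<subseteq> cball y (\<delta> / 3)"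
    "\<And>y. y \<in> S \<Longrightarrow> cell_ratio * \<delta> \<le> L (\<psi> y)" "disjoint_family_on (\<lambda>y. f (\<psi> y) ` F) S"
    by (rule separated_cylinders[OF S_F S(3) \<delta>(1,2)]) blast
  have \<psi>_disj: "f (\<psi> y) ` A \<inter> f (\<psi> z) ` A = {}" if "y \<in> S" "z \<in> S" "y \<noteq> z" for y z
  proof -
    have "f (\<psi> y) ` F \<inter> f (\<psi> z) ` F = {}" using \<psi>(4) that unfolding disjoint_family_on_def by blast
    then show ?thesis using A_F by blast
  qed
  have inj: "inj_on \<psi> S" using \<psi>_disj A_ne by (force intro: inj_onI)
  have new: "f (\<psi> y) ` A \<inter> f w ` A = {}" if "y \<in> S" "w \<in> T" for y w
  proof (rule ccontr)
    assume "f (\<psi> y) ` A \<inter> f w ` A \<noteq> {}"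
    then obtain z where z: "z \<in> f (\<psi> y) ` A" "z \<in> f w ` A"
      by blast
    then have "z \<in> cball y (\<delta> / 3)" using \<psi>(2)[OF that(1)] A_F by blast
    then have "dist y z \<le> \<delta> / 3" by simp
    moreover have "\<delta> \<le> dist z y" using S(1) that z(2) by (auto simp: G_def K_def)
    ultimately show False
      using \<delta>(1) by (simp add: dist_commute)
  qed
  have "\<psi> y \<notin> T" if "y \<in> S" for y
    using new[OF that, of "\<psi> y"] A_ne by auto
  then have disj_T: "T \<inter> \<psi> ` S = {}" by blast
  \<comment> \<open>Copies placed in cylinders within \<open>\<delta> / 3\<close> of the net points
    miss the old copies, so they extend \<open>T\<close>; near-maximality then limits their mass to
    \<open>\<epsilon>'\<close>.\<close>
  have "adm (T \<union> \<psi> ` S)"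
    unfolding adm_def disjoint_family_on_def
  proof (intro conjI ballI impI)
    fix v w assume vw: "v \<in> T \<union> \<psi> ` S" "w \<in> T \<union> \<psi> ` S" "v \<noteq> w"
    then consider "v \<in> T" "w \<in> T" | y where "y \<in> S" "v = \<psi> y" "w \<in> T" | y where "y \<in> S" "w = \<psi> y" "v \<in> T"
      | y z where "y \<in> S" "z \<in> S" "v = \<psi> y" "w = \<psi> z"
      by blast
    then show "f v ` A \<inter> f w ` A = {}"
    proof cases
      case 1
      then show ?thesis using T(3) vw(3) unfolding disjoint_family_on_def by blast
    next
      case 2
      then show ?thesis using new by blast
    next
      case 3
      then show ?thesis using new[of y v] by (simp add: Int_commute)
    next
      case 4
      then show ?thesis using \<psi>_disj[of y z] vw(3) by blast
    qed
  next
    show "finite (T \<union> \<psi> ` S)" using T(1) S(2) by simp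
    show "T \<union> \<psi> ` S \<subseteq> words N" using T(2) \<psi>(1) by blast
  qed
  from max[OF this] have "\<sigma> T + (\<Sum>y\<in>S. L (\<psi> y) powr s) < \<sigma> T + \<epsilon>'"
    using T S disj_T inj by (simp add: \<sigma>_def sum.union_disjoint sum.reindex)
  moreover have "real (card S) * (cell_ratio * \<delta>) powr s \<le> (\<Sum>y\<in>S. L (\<psi> y) powr s)"
  proof -
    have "(\<Sum>y\<in>S. (cell_ratio * \<delta>) powr s) \<le> (\<Sum>y\<in>S. L (\<psi> y) powr s)"
      using \<psi>(3) cell_ratio_pos \<delta>(1) dim_pos by (intro sum_mono powr_mono2) auto
    then show ?thesis by simp
  qed
  ultimately have few: "real (card S) * (cell_ratio * \<delta>) powr s \<le> \<epsilon>'" by linarith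
  define nbhd where "nbhd w = (\<Union>k\<in>f w ` A. ball k \<delta>)" for w
  have bounded_fA: "bounded (f w ` A)" if "w \<in> T" for w
    using that T(2) by (intro compact_imp_bounded compact_f_image[OF _ A_F compact_A]) blast
  define \<U> where "\<U> = nbhd ` T \<union> (\<lambda>y. cball y \<delta>) ` S"
  have "finite_cover F \<U>"
    unfolding finite_cover_def
  proof (intro conjI ballI subsetI)
    show "finite \<U>" using T S by (simp add: \<U>_def)
  next
    fix y assume "y \<in> F"
    show "y \<in> \<Union>\<U>"
    proof (cases "y \<in> G")
      case True
      then show ?thesis using S(4) by (auto simp: \<U>_def)
    next
      case False
      then obtain w k where "w \<in> T" "k \<in> f w ` A" "dist k y < \<delta>"
        using \<open>y \<in> F\<close> by (auto simp: G_def K_def not_le)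
      then have "y \<in> nbhd w" by (auto simp: nbhd_def)
      then show ?thesis using \<open>w \<in> T\<close> by (auto simp: \<U>_def)
    qed
  next
    fix U assume "U \<in> \<U>"
    then consider w where "w \<in> T" "U = nbhd w" | y where "U = cball y \<delta>"
      by (auto simp: \<U>_def)
    then show "bounded U"
      using bounded_fA by cases (simp_all only: nbhd_def bounded_nbhd bounded_cball)
  qed
  moreover have "cover_cost s \<U> \<le> (6 / c ^ 3) powr s / M + \<epsilon>"
  proof -
    have "cover_cost s \<U> \<le> (\<Sum>w\<in>T. diameter (nbhd w) powr s) + (\<Sum>y\<in>S. diameter (cball y \<delta>) powr s)"
      unfolding \<U>_def using T(1) S(2)
      by (intro order_trans[OF cover_cost_Un_le] add_mono cover_cost_image_le) auto
    also have "(\<Sum>w\<in>T. diameter (nbhd w) powr s) \<le> (\<Sum>w\<in>T. (6 * R) powr s * L w powr s)"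
    proof (intro sum_mono)
      fix w assume w: "w \<in> T"
      then have wN: "w \<in> words N" using T(2) by blast
      \<comment> \<open>The factor 6 is 4 for the copy of a tile of diameter at most
        \<open>4 * R\<close> plus 2 for the fattening.\<close>
      have "diameter (nbhd w) \<le> diameter (f w ` A) + 2 * \<delta>"
        unfolding nbhd_def using \<delta>(1) by (intro diameter_nbhd_le[OF bounded_fA[OF w]]) simp
      also have "\<dots> \<le> L w * (4 * R) + 2 * (R * L w)"
        using diameter_f_image_le[OF wN A_F] \<delta>(3)[OF w] mult_left_mono[OF diam_A, of "L w"] Lp[OF w] by linarith
      finally have "diameter (nbhd w) \<le> 6 * R * L w" by (simp add: algebra_simps)
      moreover have "0 \<le> diameter (nbhd w)"
        unfolding nbhd_def by (rule diameter_ge_0[OF bounded_nbhd[OF bounded_fA[OF w]]])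
      ultimately have "diameter (nbhd w) powr s \<le> (6 * R * L w) powr s"
        using dim_pos by (intro powr_mono2) auto
      then show "diameter (nbhd w) powr s \<le> (6 * R) powr s * L w powr s" by (simp add: powr_mult)
    qed
    also have "(\<Sum>w\<in>T. (6 * R) powr s * L w powr s) = (6 * R) powr s * \<sigma> T"
      by (simp add: \<sigma>_def sum_distrib_left)
    also have "\<dots> \<le> (6 * R) powr s * ((1 / c ^ 3) powr s / (M * R powr s))"
      using bound[OF \<open>adm T\<close>] by (intro mult_left_mono) auto
    also have "\<dots> = (6 / c ^ 3) powr s / M" using pos c_pos by (simp add: powr_mult powr_divide)
    also have "(\<Sum>y\<in>S. diameter (cball y \<delta>) powr s) = real (card S) * (2 * \<delta>) powr s"
      using \<delta>(1) by simp
    also have "(2 * \<delta>) powr s = (2 / cell_ratio) powr s * (cell_ratio * \<delta>) powr s"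
      using cell_ratio_pos by (simp add: powr_mult[symmetric])
    also have "real (card S) * ((2 / cell_ratio) powr s * (cell_ratio * \<delta>) powr s) \<le> (2 / cell_ratio) powr s * \<epsilon>'"
      using mult_left_mono[OF few, of "(2 / cell_ratio) powr s"] by (simp add: mult_ac)
    also have "\<dots> = \<epsilon>" using cell_ratio_pos by (simp add: \<epsilon>'_def)
    finally show ?thesis by simp
  qed
  ultimately show ?thesis by blast
qed

text \<open>Positive measure keeps the cost of finite covers above some \<open>\<eta>\<close>, while
  \<open>cover_by_copies\<close> produces covers of cost about a constant over \<open>M\<close>.
  Hence the normalised mass \<open>M\<close> of the cylinders in a ball is bounded, and with it the
  number of separated points.\<close>

lemma covering_exponent_of_pos_measure:
  assumes "hausdorff_measure s F \<noteq> 0"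
  shows "covering_exponent F s"
proof -
  obtain \<eta> where \<eta>: "0 < \<eta>" "\<And>\<U>. finite_cover F \<U> \<Longrightarrow> \<eta> \<le> cover_cost s \<U>"
    using hausdorff_measure_eq_0I[OF dim_pos, of F] assms by (meson linorder_not_le)
  define C where "C = (6 / c ^ 3) powr s / \<eta> * (1 / cell_ratio) powr s"
  show ?thesis
  proof (rule covering_exponentI)
    show "1 \<le> max C 1" by simp
  next
    fix x r R S assume x: "x \<in> F" and r: "0 < r" "r < R" and S: "S \<subseteq> F \<inter> cball x R" "finite S" "separated_set r S"
    have one: "1 \<le> (R / r) powr s" using r dim_pos by (simp add: ge_one_powr_ge_zero)
    show "real (card S) \<le> max C 1 * (R / r) powr s"
    proof (cases "r < D \<and> S \<noteq> {}")
      case False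
      then have "real (card S) \<le> 1" using card_separated_le_1[of S r] S by auto
      also have "(1::real) \<le> max C 1 * (R / r) powr s"
        using one mult_mono[of 1 "max C 1" 1 "(R / r) powr s"] by simp
      finally show ?thesis .
    next
      case True
      then have "r < D" and S_F: "S \<subseteq> F" and "S \<noteq> {}" using S by auto
      obtain \<psi> where \<psi>: "\<And>y. y \<in> S \<Longrightarrow> \<psi> y \<in> words N" "\<And>y. y \<in> S \<Longrightarrow> f (\<psi> y) ` F \<subseteq> cball y (r / 3)"
        "\<And>y. y \<in> S \<Longrightarrow> cell_ratio * r \<le> L (\<psi> y)" "disjoint_family_on (\<lambda>y. f (\<psi> y) ` F) S"
        by (rule separated_cylinders[OF S_F S(3) r(1) \<open>r < D\<close>]) blast
      define M where "M = real (card S) * (cell_ratio * r / R) powr s"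
      have M: "0 < M" using \<open>S \<noteq> {}\<close> S(2) r cell_ratio_pos by (simp add: M_def card_gt_0_iff)
      have sub: "f (\<psi> y) ` F \<subseteq> cball x (2 * R)" if "y \<in> S" for y
      proof -
        have "dist x y + r / 3 \<le> 2 * R" using S(1) that r by auto
        then have "cball y (r / 3) \<subseteq> cball x (2 * R)"
          using r by (intro iffD2[OF cball_subset_cball_iff]) (simp add: dist_commute)
        then show ?thesis using \<psi>(2)[OF that] by blast
      qed
      have "M * R powr s = (\<Sum>y\<in>S. (cell_ratio * r) powr s)" using r by (simp add: M_def powr_divide)
      also have "\<dots> \<le> (\<Sum>y\<in>S. L (\<psi> y) powr s)"
        using \<psi>(3) cell_ratio_pos r(1) dim_pos by (intro sum_mono powr_mono2) auto
      finally have mass: "M * R powr s \<le> (\<Sum>y\<in>S. L (\<psi> y) powr s)" .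
      have "\<eta> \<le> (6 / c ^ 3) powr s / M"
      proof (rule field_le_epsilon)
        fix e :: real assume "0 < e"
        then have "\<exists>\<U>. finite_cover F \<U> \<and> cover_cost s \<U> \<le> (6 / c ^ 3) powr s / M + e"
          using cover_by_copies[of S \<psi> x R M e] S(2) \<psi>(1,4) sub r M mass by auto
        then show "\<eta> \<le> (6 / c ^ 3) powr s / M + e" using \<eta>(2) by (meson order_trans)
      qed
      then have "M \<le> (6 / c ^ 3) powr s / \<eta>" using M \<eta>(1) by (simp add: field_simps)
      then have "M * (1 / cell_ratio) powr s * (R / r) powr s \<le> C * (R / r) powr s"
        unfolding C_def by (intro mult_right_mono) auto
      moreover have "M * (1 / cell_ratio) powr s * (R / r) powr s = real (card S)"
        using r cell_ratio_pos by (simp add: M_def powr_mult powr_divide)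
      moreover have "C * (R / r) powr s \<le> max C 1 * (R / r) powr s" by (intro mult_right_mono) auto
      ultimately show ?thesis by linarith
    qed
  qed
qed

lemma assouad_dim_eq_dimI:
  assumes "covering_exponent F s"
  shows "assouad_dim F = ereal s"
  unfolding assouad_dim_eq
proof (rule antisym)
  show "(INF t\<in>{t. covering_exponent F t}. ereal t) \<le> ereal s" using assms by (intro INF_lower) simp
  show "ereal s \<le> (INF t\<in>{t. covering_exponent F t}. ereal t)"
    using hausdorff_dim_le_covering_exponent[OF compact_F F_nonempty dim dim_pos] by (intro INF_greatest) simp
qed

end

section \<open>The identity limit criterion\<close>

context quasi_conformal_ifs
begin

text \<open>The identity limit criterion with the infimum unfolded into a uniform constant and the
  norm of the derivative replaced by \<open>L\<close>.\<close>

definition identity_gap :: bool where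
  "identity_gap \<longleftrightarrow> (\<exists>k>0. \<forall>v\<in>words N. \<forall>w\<in>words N. restrict (f v) F \<noteq> restrict (f w) F \<longrightarrow>
     k * L v \<le> (SUP x\<in>F. \<bar>f v x - f w x\<bar>))"

text \<open>At scale \<open>r\<close> all maps in question have Lipschitz constants of order
  \<open>r\<close> and values within \<open>2 * r\<close> of \<open>x\<close>. Rounding these values
  on one fixed net in units of \<open>q * r / 4\<close> gives boundedly many codes, uniformly in
  \<open>x\<close> and \<open>r\<close>, and maps sharing a code are closer than the gap
  allows.\<close>

lemma weak_separation_of_identity_gap:
  assumes identity_gap
  shows "weak_separation N \<phi> F"
proof -
  obtain k where k: "0 < k" "\<And>v w. v \<in> words N \<Longrightarrow> w \<in> words N \<Longrightarrow>
      restrict (f v) F \<noteq> restrict (f w) F \<Longrightarrow> k * L v \<le> (SUP x\<in>F. \<bar>f v x - f w x\<bar>)"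
    using assms unfolding identity_gap_def by blast
  \<comment> \<open>With this choice \<open>q * r\<close> is a lower bound for the gap
    \<open>k * L v\<close> of every word of scale \<open>r\<close>.\<close>
  define q where "q = k * (step_ratio / D)"
  have q: "0 < q" using k(1) step_ratio_pos D_pos by (simp add: q_def)
  \<comment> \<open>A move of length \<open>\<zeta>\<close> in \<open>F\<close> changes the value of
    a map of scale \<open>r\<close> by at most \<open>q * r / 8\<close>; two such errors and one
    rounding error \<open>q * r / 4\<close> stay below \<open>q * r\<close>.\<close>
  define \<zeta> where "\<zeta> = q * c * D / 8"
  have "0 < \<zeta>" using q c_pos D_pos by (simp add: \<zeta>_def)
  then obtain E where E: "E \<subseteq> F" "finite E" "F \<subseteq> (\<Union>e\<in>E. cball e \<zeta>)"
    using ex_maximal_separated_set[OF bounded_F] by metis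
  \<comment> \<open>The bound \<open>8 / q\<close> is the radius \<open>2 * r\<close> measured in
    units of \<open>q * r / 4\<close>.\<close>
  define Z where "Z = {- \<lceil>8 / q\<rceil> - 1 .. \<lceil>8 / q\<rceil>}"
  define M where "M = card (E \<rightarrow>\<^sub>E Z)"
  have fin: "finite (E \<rightarrow>\<^sub>E Z)" using E(2) by (intro finite_PiE) (auto simp: Z_def)
  have floor_in: "\<lfloor>a\<rfloor> \<in> {- \<lceil>b\<rceil> - 1 .. \<lceil>b\<rceil>}" if "\<bar>a\<bar> \<le> b" for a b :: real
  proof -
    have "- \<lceil>b\<rceil> - 1 \<le> \<lfloor>a\<rfloor>" "\<lfloor>a\<rfloor> \<le> \<lceil>b\<rceil>" using that by linarith+
    then show ?thesis by simp
  qed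
  have "finite (scale_maps N \<phi> F x r) \<and> card (scale_maps N \<phi> F x r) \<le> M" if x: "x \<in> F" and r: "0 < r" for x r
  proof -
    define code where "code g = restrict (\<lambda>e. \<lfloor>(g e - x) / (q * r / 4)\<rfloor>) E" for g :: "real \<Rightarrow> real"
    have qr: "0 < q * r / 4" using q r by simp
    have scale: "\<exists>w. w \<in> words N \<and> g = restrict (f w) F \<and> step_ratio / D * r \<le> L w \<and> L w \<le> r / (c * D) \<and>
        f w ` F \<subseteq> cball x (2 * r)" if g: "g \<in> scale_maps N \<phi> F x r" for g
    proof -
      obtain w where w: "g = restrict (f w) F" "w \<in> words N" "w \<noteq> []" "diameter (f w ` F) \<le> r"
          "r < diameter (f (butlast w) ` F)" "f w ` F \<inter> cball x r \<noteq> {}"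
        using g unfolding scale_maps_def by blast
      obtain y where y: "y \<in> f w ` F" "dist x y \<le> r"
        using w(6) by (meson disjoint_iff mem_cball)
      have "f w ` F \<subseteq> cball x (2 * r)"
      proof
        fix z assume "z \<in> f w ` F"
        then have "dist y z \<le> r"
          using diameter_bounded_bound[OF bounded_f_image[OF w(2)] y(1)] w(4) by force
        then show "z \<in> cball x (2 * r)" using y(2) dist_triangle[of x z y] by simp
      qed
      then show ?thesis using w cylinder_L_bounds[OF w(2-5)] by blast
    qed
    have inj: "inj_on code (scale_maps N \<phi> F x r)"
    proof (rule inj_onI)
      fix g h assume gh: "g \<in> scale_maps N \<phi> F x r" "h \<in> scale_maps N \<phi> F x r" "code g = code h"
      obtain v where v: "v \<in> words N" "g = restrict (f v) F" "step_ratio / D * r \<le> L v" "L v \<le> r / (c * D)"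
        using scale[OF gh(1)] by blast
      obtain w where w: "w \<in> words N" "h = restrict (f w) F" "L w \<le> r / (c * D)"
        using scale[OF gh(2)] by blast
      have close: "\<bar>f v y - f w y\<bar> \<le> q * r / 2" if yF: "y \<in> F" for y
      proof -
        obtain e where e: "e \<in> E" "\<bar>y - e\<bar> \<le> \<zeta>"
        proof -
          have "y \<in> (\<Union>e\<in>E. cball e \<zeta>)" using E(3) yF by (rule subsetD)
          then show thesis by (elim UN_E) (auto intro!: that simp: dist_real_def abs_minus_commute)
        qed
        then have eF: "e \<in> F" using E(1) by blast
        have \<zeta>r: "r / (c * D) * \<zeta> = q * r / 8" using c_pos D_pos by (simp add: \<zeta>_def)
        have "\<bar>f v y - f v e\<bar> \<le> L v * \<bar>y - e\<bar>" by (rule upper[OF v(1) yF eF])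
        also have "\<dots> \<le> r / (c * D) * \<zeta>"
          using v(4) e(2) L_pos[OF v(1)] r c_pos D_pos by (intro mult_mono) auto
        finally have 1: "\<bar>f v y - f v e\<bar> \<le> q * r / 8"
          unfolding \<zeta>r .
        have "\<bar>f w y - f w e\<bar> \<le> L w * \<bar>y - e\<bar>" by (rule upper[OF w(1) yF eF])
        also have "\<dots> \<le> r / (c * D) * \<zeta>"
          using w(3) e(2) L_pos[OF w(1)] r c_pos D_pos by (intro mult_mono) auto
        finally have 2: "\<bar>f w y - f w e\<bar> \<le> q * r / 8"
          unfolding \<zeta>r .
        have "code g e = code h e" using gh(3) by simp
        then have "\<lfloor>(f v e - x) / (q * r / 4)\<rfloor> = \<lfloor>(f w e - x) / (q * r / 4)\<rfloor>"
          using e(1) eF v(2) w(2) by (simp add: code_def)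
        then have "\<bar>(f v e - x) / (q * r / 4) - (f w e - x) / (q * r / 4)\<bar> < 1" by linarith
        moreover have "(f v e - x) / (q * r / 4) - (f w e - x) / (q * r / 4) = (f v e - f w e) / (q * r / 4)"
          by (simp only: diff_divide_distrib[symmetric]) simp
        ultimately have "\<bar>f v e - f w e\<bar> < q * r / 4"
          using abs_divide[of "f v e - f w e" "q * r / 4"] abs_of_pos[OF qr] divide_less_eq_1_pos[OF qr] by metis
        then show ?thesis using 1 2 by linarith
      qed
      show "g = h"
      proof (rule ccontr)
        assume "g \<noteq> h"
        then have "k * L v \<le> (SUP x\<in>F. \<bar>f v x - f w x\<bar>)" using k(2) v w by blast
        also have "\<dots> \<le> q * r / 2" using F_nonempty close by (rule cSUP_least)
        also have "\<dots> < q * r" using q r by simp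
        also have "\<dots> \<le> k * L v" using mult_left_mono[OF v(3), of k] k(1) by (simp add: q_def)
        finally show False
          by simp
      qed
    qed
    have "code ` scale_maps N \<phi> F x r \<subseteq> E \<rightarrow>\<^sub>E Z"
    proof (clarify)
      fix g assume "g \<in> scale_maps N \<phi> F x r"
      then obtain w where w: "w \<in> words N" "g = restrict (f w) F" "f w ` F \<subseteq> cball x (2 * r)"
        using scale by blast
      show "code g \<in> E \<rightarrow>\<^sub>E Z"
        unfolding code_def
      proof (rule restrict_PiE_iff[THEN iffD2], rule ballI)
        fix e assume "e \<in> E"
        then have "e \<in> F" using E(1) by blast
        then have "\<bar>f w e - x\<bar> \<le> 2 * r" using w(3) by (force simp: dist_real_def abs_minus_commute)
        then have "\<bar>(f w e - x) / (q * r / 4)\<bar> \<le> 8 / q"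
          using qr q r by (simp add: abs_divide field_simps)
        then have "\<lfloor>(f w e - x) / (q * r / 4)\<rfloor> \<in> Z" unfolding Z_def by (rule floor_in)
        then show "\<lfloor>(g e - x) / (q * r / 4)\<rfloor> \<in> Z" using \<open>e \<in> F\<close> w(2) by simp
      qed
    qed
    then show ?thesis using inj fin by (auto simp: M_def intro: inj_on_finite card_inj_on_le)
  qed
  then show ?thesis unfolding weak_separation_def by blast
qed

text \<open>The stopping cylinder of \<open>z\<close> has diameter of order \<open>h\<close>, and
  one end of a diametral pair in it is at least half that diameter away from \<open>z\<close>. Such
  a point serves as a reference at which a difference quotient can be estimated from a bound on the
  values.\<close>

lemma uniformly_perfect:
  assumes "z \<in> F" "0 < h" "h < D"
  obtains y where "y \<in> F" "c * step_ratio / 2 * h \<le> \<bar>y - z\<bar>" "\<bar>y - z\<bar> \<le> h"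
proof -
  obtain w where w: "w \<in> words N" "w \<noteq> []" "z \<in> f w ` F" "diameter (f w ` F) \<le> h"
      "h < diameter (f (butlast w) ` F)"
    using ex_cylinder[OF assms] by metis
  have "c * (step_ratio * h) \<le> c * (L w * D)"
    using cylinder_L_bounds(1)[OF w(1,2,4,5)] c_pos D_pos by (intro mult_left_mono) (auto simp: field_simps)
  also have "\<dots> \<le> diameter (f w ` F)" using diameter_f_image_ge[OF w(1)] by (simp add: mult_ac)
  finally have diam: "c * step_ratio * h \<le> diameter (f w ` F)" by (simp add: mult_ac)
  obtain a b where ab: "a \<in> f w ` F" "b \<in> f w ` F" "dist a b = diameter (f w ` F)"
    using diameter_compact_attained[OF compact_f_image[OF w(1) order_refl compact_F]] F_nonempty by auto
  have "\<exists>y\<in>f w ` F. diameter (f w ` F) / 2 \<le> \<bar>y - z\<bar>"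
  proof (rule ccontr)
    assume "\<not> ?thesis"
    then have "\<bar>a - z\<bar> < diameter (f w ` F) / 2" "\<bar>b - z\<bar> < diameter (f w ` F) / 2"
      using ab by (auto simp: not_le)
    then show False
      using ab(3) unfolding dist_real_def by argo
  qed
  then obtain y where y: "y \<in> f w ` F" "diameter (f w ` F) / 2 \<le> \<bar>y - z\<bar>"
    by blast
  moreover have "\<bar>y - z\<bar> \<le> h"
    using diameter_bounded_bound[OF bounded_f_image[OF w(1)] y(1) w(3)] w(4) by (simp add: dist_real_def)
  ultimately show thesis using that[of y] diam f_image_subset[OF w(1)] by auto
qed

text \<open>
  If \<open>f v\<close> and \<open>f w\<close> nearly agree, then by Hoelder continuity so do their derivatives. Hence
  \<open>f v - f w\<close> hardly varies on a cylinder \<open>u\<close> around a point where it is largest, even if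
  \<open>u\<close> is so short that relative to \<open>L (v @ u)\<close> the difference has any prescribed small size \<open>\<tau>\<close>.
\<close>

lemma near_identity_pair:
  assumes "\<not> identity_gap" "0 < \<tau>"
  obtains v w where "v \<in> words N" "w \<in> words N"
    "\<And>x. x \<in> F \<Longrightarrow> c\<^sup>2 * D / 2 * \<tau> * L v \<le> \<bar>f v x - f w x\<bar>"
    "\<And>x. x \<in> F \<Longrightarrow> \<bar>f v x - f w x\<bar> \<le> D / (c\<^sup>2 * step_ratio) * \<tau> * L v"
proof -
  \<comment> \<open>Two Hoelder errors are added: \<open>H\<close> for \<open>v\<close>, and
    \<open>H * 3 / c\<close> for \<open>w\<close> because \<open>L w\<close> will be at most
    \<open>3 / c * L v\<close>.\<close>
  define B where "B = H * (1 + 3 / c)"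
  define p where "p = c * step_ratio / 2"
  have B: "0 < B" and p: "0 < p"
    using H_pos c_pos step_ratio_pos by (auto simp: B_def p_def add_pos_pos)
  have "((\<lambda>h. B * (2 * h) powr \<alpha>) \<longlongrightarrow> B * (2 * 0) powr \<alpha>) (at_right 0)"
    using \<alpha>_pos by (intro tendsto_mult tendsto_const tendsto_powr' tendsto_ident_at)
      (auto intro!: eventually_mono[OF eventually_at_right_less])
  then have "eventually (\<lambda>h. B * (2 * h) powr \<alpha> < \<tau> / 4) (at_right 0)"
    using assms(2) by (intro order_tendstoD(2)) auto
  then have "eventually (\<lambda>h. 0 < h \<and> h < D \<and> B * (2 * h) powr \<alpha> < \<tau> / 4) (at_right 0)"
    using eventually_at_right_real[OF D_pos] by eventually_elim auto
  from eventually_happens'[OF trivial_limit_at_right_real this]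
  obtain h where h: "0 < h" "h < D" "B * (2 * h) powr \<alpha> < \<tau> / 4"
    by (elim exE conjE)
  \<comment> \<open>The three bounds serve the comparison of \<open>L w\<close> with
    \<open>L v\<close>, the difference quotient at the reference point \<open>y'\<close>, and the
    inequality \<open>\<rho> \<le> h\<close>.\<close>
  define e0 where "e0 = min D (min (\<tau> * p * h / 8) (\<tau> * h))"
  have "0 < e0" using D_pos assms(2) p h(1) by (simp add: e0_def)
  then obtain v w where vw: "v \<in> words N" "w \<in> words N" "restrict (f v) F \<noteq> restrict (f w) F"
      and close: "(SUP x\<in>F. \<bar>f v x - f w x\<bar>) < e0 * L v"
    using assms(1) unfolding identity_gap_def by (metis linorder_not_le)
  define g where "g x = f v x - f w x" for x
  have Lv: "0 < L v" and Lw: "0 < L w" using vw L_pos by auto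
  have "continuous_on F (\<lambda>x. \<bar>g x\<bar>)"
    unfolding g_def using vw continuous_on_f by (intro continuous_intros) auto
  then obtain z where z: "z \<in> F" "\<And>x. x \<in> F \<Longrightarrow> \<bar>g x\<bar> \<le> \<bar>g z\<bar>"
    using continuous_attains_sup[OF compact_F F_nonempty] by metis
  define \<epsilon> where "\<epsilon> = \<bar>g z\<bar> / L v"
  have gz: "\<bar>g z\<bar> = \<epsilon> * L v" using Lv by (simp add: \<epsilon>_def)
  have "\<epsilon> < e0"
  proof -
    have "\<bar>g z\<bar> \<le> (SUP x\<in>F. \<bar>g x\<bar>)" using z by (intro cSUP_upper bdd_aboveI2[of _ _ "\<bar>g z\<bar>"]) auto
    then show ?thesis using close Lv by (simp add: \<epsilon>_def pos_divide_less_eq g_def)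
  qed
  then have \<epsilon>_small: "\<epsilon> \<le> D" "\<epsilon> \<le> \<tau> * p * h / 8" "\<epsilon> \<le> \<tau> * h" by (auto simp: e0_def)
  have "0 < \<epsilon>"
  proof -
    obtain x where "x \<in> F" "f v x \<noteq> f w x"
      using vw(3) by (meson restrict_ext)
    then have "0 < \<bar>g z\<bar>" using z(2)[of x] by (simp add: g_def)
    then show ?thesis using Lv by (simp add: \<epsilon>_def)
  qed
  have Lw_le: "L w \<le> 3 / c * L v"
  proof -
    obtain a b where ab: "a \<in> F" "b \<in> F" "\<bar>a - b\<bar> = D"
      by (rule obtain_diametral)
    have "c * L w * D \<le> \<bar>f w a - f w b\<bar>" using lower[OF vw(2) ab(1,2)] ab(3) by simp
    also have "\<dots> \<le> \<bar>f v a - f v b\<bar> + \<bar>g a\<bar> + \<bar>g b\<bar>" by (simp add: g_def)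
    also have "\<dots> \<le> L v * D + \<epsilon> * L v + \<epsilon> * L v"
      using upper[OF vw(1) ab(1,2)] ab(3) z(2)[OF ab(1)] z(2)[OF ab(2)] gz by simp
    also have "\<dots> \<le> L v * D + D * L v + D * L v"
      using mult_right_mono[OF \<epsilon>_small(1), of "L v"] Lv by simp
    finally have "(c * L w) * D \<le> (3 * L v) * D" by (simp add: mult_ac)
    then have "c * L w \<le> 3 * L v" using D_pos by simp
    then show ?thesis using c_pos by (simp add: field_simps)
  qed
  \<comment> \<open>For a cylinder \<open>u\<close> of this scale \<open>L u\<close> is of order
    \<open>\<rho>\<close>, so the maximal difference
    \<open>\<epsilon> * L v = \<tau> * \<rho> * L v\<close> is of order
    \<open>\<tau> * L (v @ u)\<close>.\<close>
  define \<rho> where "\<rho> = \<epsilon> / \<tau>"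
  have \<rho>: "0 < \<rho>" "\<rho> \<le> h" "\<epsilon> = \<tau> * \<rho>"
    using \<open>0 < \<epsilon>\<close> \<epsilon>_small(3) assms(2) by (auto simp: \<rho>_def field_simps)
  obtain u where u: "u \<in> words N" "u \<noteq> []" "z \<in> f u ` F" "diameter (f u ` F) \<le> \<rho>"
      "\<rho> < diameter (f (butlast u) ` F)"
    using ex_cylinder[OF z(1), of \<rho>] \<rho> h by (metis order_le_less_trans)
  have Lu: "0 < L u" using L_pos u by blast
  obtain y' where y': "y' \<in> F" "p * h \<le> \<bar>y' - z\<bar>" "\<bar>y' - z\<bar> \<le> h"
    using uniformly_perfect[OF z(1) h(1,2)] unfolding p_def by metis
  have y'z: "0 < \<bar>y' - z\<bar>" using y'(2) p h(1) by (smt (verit) mult_pos_pos)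
  \<comment> \<open>The quotient of \<open>g\<close> at the distant point \<open>y'\<close> is small
    because \<open>g\<close> itself is. Hoelder continuity transports this to the quotient at
    \<open>y\<close>, which lies within \<open>\<rho>\<close> of \<open>z\<close>, so
    \<open>g\<close> loses at most half of its maximum on the cylinder.\<close>
  have near: "\<bar>g y - g z\<bar> \<le> \<epsilon> * L v / 2" if y: "y \<in> f u ` F" for y
  proof (cases "y = z")
    case False
    have yF: "y \<in> F" using y f_image_subset[OF u(1)] by blast
    have yz: "\<bar>y - z\<bar> \<le> \<rho>"
      using diameter_bounded_bound[OF bounded_f_image[OF u(1)] y u(3)] u(4) by (simp add: dist_real_def)
    have ball: "{y, z, y', z} \<subseteq> cball z h"
      using yz y'(3) \<rho>(2) h(1) by (auto simp: dist_real_def abs_minus_commute)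
    define dv where "dv x = (f v x - f v z) / (x - z)" for x
    define dw where "dw x = (f w x - f w z) / (x - z)" for x
    have 1: "\<bar>dv y - dv y'\<bar> \<le> H * L v * (2 * h) powr \<alpha>"
      unfolding dv_def using holder[OF vw(1) yF z(1) y'(1) z(1) False _ ball] y'z by auto
    have "\<bar>dw y - dw y'\<bar> \<le> H * L w * (2 * h) powr \<alpha>"
      unfolding dw_def using holder[OF vw(2) yF z(1) y'(1) z(1) False _ ball] y'z by auto
    also have "\<dots> \<le> H * (3 / c * L v) * (2 * h) powr \<alpha>"
      using Lw_le H_pos by (intro mult_right_mono mult_left_mono) auto
    finally have 2: "\<bar>dw y - dw y'\<bar> \<le> H * (3 / c * L v) * (2 * h) powr \<alpha>" .
    have "dv y' - dw y' = (g y' - g z) / (y' - z)"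
      by (simp add: dv_def dw_def g_def diff_divide_distrib)
    then have "\<bar>dv y' - dw y'\<bar> = \<bar>g y' - g z\<bar> / \<bar>y' - z\<bar>" by (simp only: abs_divide)
    also have "\<dots> \<le> (2 * \<epsilon> * L v) / (p * h)"
      using z(2)[OF y'(1)] gz y'(2) p h(1) \<open>0 < \<epsilon>\<close> Lv by (intro frac_le) auto
    also have "\<dots> \<le> (2 * (\<tau> * p * h / 8) * L v) / (p * h)"
      using \<epsilon>_small(2) Lv p h(1) by (intro divide_right_mono mult_right_mono mult_left_mono) auto
    also have "\<dots> = \<tau> / 4 * L v" using p h(1) by simp
    finally have 3: "\<bar>dv y' - dw y'\<bar> \<le> \<tau> / 4 * L v" .
    have "\<bar>dv y - dw y\<bar> \<le> H * L v * (2 * h) powr \<alpha> + H * (3 / c * L v) * (2 * h) powr \<alpha> + \<tau> / 4 * L v"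
      using 1 2 3 by linarith
    also have "\<dots> = B * (2 * h) powr \<alpha> * L v + \<tau> / 4 * L v" by (simp add: B_def algebra_simps)
    also have "\<dots> \<le> \<tau> / 4 * L v + \<tau> / 4 * L v"
      using h(3) Lv by (intro add_right_mono mult_right_mono) auto
    finally have d: "\<bar>dv y - dw y\<bar> \<le> \<tau> / 2 * L v" by simp
    have "g y - g z = (dv y - dw y) * (y - z)"
    proof -
      have "dv y * (y - z) = f v y - f v z" "dw y * (y - z) = f w y - f w z"
        using False by (auto simp: dv_def dw_def)
      then show ?thesis by (simp add: g_def left_diff_distrib)
    qed
    then have "\<bar>g y - g z\<bar> = \<bar>dv y - dw y\<bar> * \<bar>y - z\<bar>" by (simp only: abs_mult)
    also have "\<dots> \<le> (\<tau> / 2 * L v) * \<rho>" by (rule mult_mono[OF d yz]) (use assms(2) Lv in auto)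
    finally show ?thesis using \<rho>(3) by (simp add: mult_ac)
  qed (use \<open>0 < \<epsilon>\<close> Lv in simp)
  have bounds: "c\<^sup>2 * D / 2 * \<tau> * L (v @ u) \<le> \<bar>f (v @ u) x - f (w @ u) x\<bar> \<and>
      \<bar>f (v @ u) x - f (w @ u) x\<bar> \<le> D / (c\<^sup>2 * step_ratio) * \<tau> * L (v @ u)" if "x \<in> F" for x
  proof -
    have y: "f u x \<in> f u ` F" "f u x \<in> F" using that f_in_F[OF u(1)] by auto
    have eq: "f (v @ u) x - f (w @ u) x = g (f u x)" by (simp add: word_map_append g_def)
    have lo: "\<epsilon> * L v / 2 \<le> \<bar>g (f u x)\<bar>" using near[OF y(1)] gz by linarith
    have up: "\<bar>g (f u x)\<bar> \<le> \<epsilon> * L v" using z(2)[OF y(2)] gz by simp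
    have Lu_le: "L u \<le> \<rho> / (c * D)" and Lu_ge: "step_ratio / D * \<rho> \<le> L u"
      using cylinder_L_bounds[OF u(1,2,4,5)] by auto
    have "c * L (v @ u) \<le> L v * (\<rho> / (c * D))"
      using L_append_le[OF vw(1) u(1)] mult_left_mono[OF Lu_le, of "L v"] Lv by linarith
    then have "c * D / 2 * \<tau> * (c * L (v @ u)) \<le> c * D / 2 * \<tau> * (L v * (\<rho> / (c * D)))"
      using c_pos D_pos assms(2) by (intro mult_left_mono) auto
    also have "\<dots> = \<epsilon> * L v / 2" using c_pos D_pos \<rho>(3) by simp
    also note lo
    finally have 1: "c\<^sup>2 * D / 2 * \<tau> * L (v @ u) \<le> \<bar>g (f u x)\<bar>"
      by (simp add: power2_eq_square mult_ac)
    have "c\<^sup>2 * L v * (step_ratio / D * \<rho>) \<le> L (v @ u)"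
      using L_append_ge[OF vw(1) u(1)] mult_left_mono[OF Lu_ge, of "c\<^sup>2 * L v"] Lv by simp
    then have "D / (c\<^sup>2 * step_ratio) * \<tau> * (c\<^sup>2 * L v * (step_ratio / D * \<rho>)) \<le> D / (c\<^sup>2 * step_ratio) * \<tau> * L (v @ u)"
      using c_pos D_pos step_ratio_pos assms(2) by (intro mult_left_mono) auto
    moreover have "D / (c\<^sup>2 * step_ratio) * \<tau> * (c\<^sup>2 * L v * (step_ratio / D * \<rho>)) = \<epsilon> * L v"
      using c_pos D_pos step_ratio_pos \<rho>(3) by (simp add: field_simps)
    ultimately show ?thesis using 1 up eq by simp
  qed
  show thesis by (rule that[of "v @ u" "w @ u"]) (use vw u bounds in auto)
qed

section \<open>Monotone chains of almost equally spaced points\<close>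

definition oriented :: "real \<Rightarrow> nat list \<Rightarrow> bool" where
  "oriented \<sigma> w \<longleftrightarrow> (\<forall>x\<in>F. \<forall>y\<in>F. x < y \<longrightarrow> 0 < \<sigma> * (f w y - f w x))"

text \<open>Across a diametral pair the increments of the two maps differ by at most half of
  \<open>c * L v * D\<close>, a lower bound for the increment of \<open>f v\<close>. Hence they have
  the same sign and comparable size.\<close>

lemma close_maps:
  assumes vw: "v \<in> words N" "w \<in> words N"
    and close: "\<And>x. x \<in> F \<Longrightarrow> \<bar>f v x - f w x\<bar> \<le> c * D / 4 * L v"
  shows "L v \<le> 2 / c * L w" "L w \<le> 2 / c * L v" "\<exists>\<sigma>\<in>{1,-1}. oriented \<sigma> v \<and> oriented \<sigma> w"
proof -
  obtain a b where ab: "a \<in> F" "b \<in> F" "\<bar>a - b\<bar> = D" "a < b"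
  proof -
    obtain x y where "x \<in> F" "y \<in> F" "\<bar>x - y\<bar> = D"
      by (rule obtain_diametral)
    then show thesis using that[of x y] that[of y x] D_pos by (cases "x < y") auto
  qed
  have Lv: "0 < L v" and Lw: "0 < L w" using vw L_pos by auto
  have v_ab: "c * L v * D \<le> \<bar>f v a - f v b\<bar>" "\<bar>f v a - f v b\<bar> \<le> L v * D"
    using lower[OF vw(1) ab(1,2)] upper[OF vw(1) ab(1,2)] ab(3) by auto
  have w_ab: "c * L w * D \<le> \<bar>f w a - f w b\<bar>" "\<bar>f w a - f w b\<bar> \<le> L w * D"
    using lower[OF vw(2) ab(1,2)] upper[OF vw(2) ab(1,2)] ab(3) by auto
  have diff: "\<bar>(f v a - f v b) - (f w a - f w b)\<bar> \<le> c * L v * D / 2"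
  proof -
    have "c * D / 4 * L v = c * L v * D / 4" by simp
    then show ?thesis using close[OF ab(1)] close[OF ab(2)] by linarith
  qed
  have pos: "0 < c * L v * D" using c_pos Lv D_pos by simp
  have "(c * L v / 2) * D \<le> L w * D"
    using v_ab(1) w_ab(2) diff abs_triangle_ineq2[of "f v a - f v b" "f w a - f w b"] by (simp add: mult_ac)
  then show "L v \<le> 2 / c * L w" using c_pos D_pos by (simp add: field_simps)
  have "c * L v * D \<le> L v * D" using c_le Lv D_pos by simp
  then have "(c * L w) * D \<le> (2 * L v) * D"
    using v_ab(2) w_ab(1) diff abs_triangle_ineq3[of "f v a - f v b" "f w a - f w b"] by linarith
  then show "L w \<le> 2 / c * L v" using c_pos D_pos by (simp add: field_simps)
  obtain \<sigma> where \<sigma>: "\<sigma> \<in> {1,-1}" "oriented \<sigma> v"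
    using monotone[OF vw(1)] unfolding oriented_def by blast
  obtain \<sigma>' where \<sigma>': "\<sigma>' \<in> {1,-1}" "oriented \<sigma>' w"
    using monotone[OF vw(2)] unfolding oriented_def by blast
  have "0 < \<sigma> * (f v b - f v a)" "0 < \<sigma>' * (f w b - f w a)"
    using \<sigma> \<sigma>' ab by (auto simp: oriented_def)
  then have "\<sigma> = \<sigma>'" using \<sigma>(1) \<sigma>'(1) pos diff v_ab(1) by (auto simp: abs_if split: if_splits)
  then show "\<exists>\<sigma>\<in>{1,-1}. oriented \<sigma> v \<and> oriented \<sigma> w" using \<sigma> \<sigma>' by blast
qed

text \<open>There are \<open>n\<close> steps, hence \<open>n + 1\<close> points. The direction
  \<open>\<sigma>\<close> is left free because orientation-reversing maps flip it during the
  construction.\<close>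

definition monotone_chain :: "real \<Rightarrow> real \<Rightarrow> nat \<Rightarrow> nat list \<Rightarrow> (nat \<Rightarrow> real) \<Rightarrow> real \<Rightarrow> bool" where
  "monotone_chain c3 c4 n a P \<sigma> \<longleftrightarrow> a \<in> words N \<and> \<sigma> \<in> {1,-1} \<and> (\<forall>i\<le>n. P i \<in> F) \<and>
     (\<forall>i<n. 0 < \<sigma> * (P (Suc i) - P i)) \<and>
     (\<forall>u\<in>words N. \<forall>i<n. c3 * L (u @ a) \<le> \<bar>f u (P (Suc i)) - f u (P i)\<bar> \<and>
        \<bar>f u (P (Suc i)) - f u (P i)\<bar> \<le> c4 * L (u @ a))"

lemma monotone_chainD:
  assumes "monotone_chain c3 c4 n a P \<sigma>"
  shows "a \<in> words N" "\<sigma> \<in> {1,-1}" "i \<le> n \<Longrightarrow> P i \<in> F" "i < n \<Longrightarrow> 0 < \<sigma> * (P (Suc i) - P i)"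
    "u \<in> words N \<Longrightarrow> i < n \<Longrightarrow> c3 * L (u @ a) \<le> \<bar>f u (P (Suc i)) - f u (P i)\<bar>"
    "u \<in> words N \<Longrightarrow> i < n \<Longrightarrow> \<bar>f u (P (Suc i)) - f u (P i)\<bar> \<le> c4 * L (u @ a)"
  using assms unfolding monotone_chain_def by blast+

text \<open>
  The points are built from the inside out: given \<open>n\<close> of them for the word \<open>a\<close>, take a pair
  \<open>v\<close>, \<open>w\<close> at relative distance comparable to \<open>L a\<close>, map all points by \<open>f v\<close>, and append the image of the last
  one under \<open>f w\<close>. Quantifying over all further prefixes \<open>u\<close> keeps the distortion constants
  independent of \<open>n\<close>. The order in which \<open>v\<close> and \<open>w\<close> are used decides on which side the new point lies.
\<close>

lemma monotone_chains:
  assumes "\<not> identity_gap"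
  obtains c3 c4 where "0 < c3" "0 < c4"
    "\<And>n. \<exists>a P \<sigma>. monotone_chain c3 c4 n a P \<sigma>"
proof -
  define c1 c2 where "c1 = c\<^sup>2 * D / 2" and "c2 = D / (c\<^sup>2 * step_ratio)"
  have c12: "0 < c1" "0 < c2" using c_pos D_pos step_ratio_pos by (auto simp: c1_def c2_def)
  \<comment> \<open>Chosen with \<open>c2 * t0 = c * D / 4\<close>, the closeness required by
    \<open>close_maps\<close>.\<close>
  define t0 where "t0 = c * D / (4 * c2)"
  have t0: "0 < t0" using c_pos D_pos c12 by (simp add: t0_def)
  \<comment> \<open>In \<open>c3\<close>, exchanging \<open>v\<close> and \<open>w\<close> costs
    \<open>c / 2\<close>, the lower bound for the prefix \<open>u\<close> another \<open>c\<close>,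
    and two uses of \<open>L_append_le\<close> cost \<open>c\<^sup>2\<close>. In \<open>c4\<close>,
    the exchange costs \<open>2 / c\<close> and two uses of \<open>L_append_ge\<close> cost
    \<open>1 / c ^ 4\<close>.\<close>
  define c3 c4 where "c3 = c ^ 4 * c1 * t0 / 2" and "c4 = 2 * c2 * t0 / c ^ 5"
  have c34: "0 < c3" "0 < c4" using c_pos c12 t0 by (auto simp: c3_def c4_def)
  have "\<exists>a P \<sigma>. monotone_chain c3 c4 n a P \<sigma>" for n
  proof (induction n)
    case 0
    obtain x where "x \<in> F"
      using F_nonempty by blast
    then show ?case
      by (intro exI[of _ "[]"] exI[of _ "\<lambda>_. x"] exI[of _ 1]) (auto simp: monotone_chain_def)
  next
    case (Suc n)
    then obtain a P \<sigma> where chain: "monotone_chain c3 c4 n a P \<sigma>"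
      by blast
    note a = monotone_chainD(1)[OF chain] and \<sigma> = monotone_chainD(2)[OF chain]
      and PF = monotone_chainD(3)[OF chain] and inc = monotone_chainD(4)[OF chain]
      and bd = monotone_chainD(5,6)[OF chain]
    \<comment> \<open>The new gap has length of order \<open>\<tau> * L v\<close>, so this choice
      makes it of order \<open>L (v @ a)\<close>, like the gaps already present.\<close>
    define \<tau> where "\<tau> = t0 * L a"
    have La: "0 < L a" "L a \<le> 1" using L_pos L_le_1 a by auto
    have \<tau>: "0 < \<tau>" "\<tau> \<le> t0" using t0 La by (auto simp: \<tau>_def mult_left_le)
    define z where "z = P n"
    have zF: "z \<in> F" using PF by (simp add: z_def)
    obtain v w where vw: "v \<in> words N" "w \<in> words N"
      and lo: "\<And>x. x \<in> F \<Longrightarrow> c1 * \<tau> * L v \<le> \<bar>f v x - f w x\<bar>"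
      and up: "\<And>x. x \<in> F \<Longrightarrow> \<bar>f v x - f w x\<bar> \<le> c2 * \<tau> * L v"
      unfolding c1_def c2_def by (rule near_identity_pair[OF assms \<tau>(1)]) blast
    have Lv: "0 < L v" and Lw: "0 < L w" using vw L_pos by auto
    have "c2 * \<tau> * L v \<le> c * D / 4 * L v"
      using mult_left_mono[OF \<tau>(2), of c2] c12 Lv by (intro mult_right_mono) (auto simp: t0_def)
    then have close: "\<bar>f v x - f w x\<bar> \<le> c * D / 4 * L v" if "x \<in> F" for x
      using up[OF that] by linarith
    have L_vw: "L v \<le> 2 / c * L w" "L w \<le> 2 / c * L v" using close_maps[OF vw close] by auto
    obtain \<sigma>' where \<sigma>': "\<sigma>' \<in> {1,-1}" "oriented \<sigma>' v" "oriented \<sigma>' w"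
      using close_maps(3)[OF vw close] by blast
    \<comment> \<open>Exchanging the pair reverses the sign of the difference; \<open>L_vw\<close>
      bounds the cost of measuring it against the other word.\<close>
    have "\<exists>v'\<in>words N. \<exists>w'\<in>words N. oriented \<sigma>' v' \<and> 0 < \<sigma> * \<sigma>' * (f w' z - f v' z) \<and>
        c * c1 / 2 * \<tau> * L v' \<le> \<bar>f w' z - f v' z\<bar> \<and> \<bar>f w' z - f v' z\<bar> \<le> 2 * c2 / c * \<tau> * L v'"
    proof (cases "0 < \<sigma> * \<sigma>' * (f w z - f v z)")
      case True
      have "c * c1 / 2 * (\<tau> * L v) \<le> c1 * (\<tau> * L v)" "c2 * (\<tau> * L v) \<le> 2 * c2 / c * (\<tau> * L v)"
        using c_pos c_le c12 \<tau> Lv by (intro mult_right_mono; simp add: field_simps)+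
      then have "c * c1 / 2 * \<tau> * L v \<le> \<bar>f w z - f v z\<bar>" "\<bar>f w z - f v z\<bar> \<le> 2 * c2 / c * \<tau> * L v"
        using lo[OF zF] up[OF zF] by (auto simp: mult.assoc abs_minus_commute)
      then show ?thesis using True vw \<sigma>' by blast
    next
      case False
      have "0 < c1 * \<tau> * L v" using c12 \<tau> Lv by simp
      then have "f w z - f v z \<noteq> 0" using lo[OF zF] by auto
      then have pos: "0 < \<sigma> * \<sigma>' * (f v z - f w z)" using False \<sigma> \<sigma>'(1) by auto
      have "c * c1 / 2 * \<tau> * L w \<le> c * c1 / 2 * \<tau> * (2 / c * L v)"
        using L_vw c_pos c12 \<tau> by (intro mult_left_mono) auto
      also have "\<dots> = c1 * \<tau> * L v" using c_pos by simp
      finally have 1: "c * c1 / 2 * \<tau> * L w \<le> \<bar>f v z - f w z\<bar>" using lo[OF zF] by simp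
      have "c2 * \<tau> * L v \<le> c2 * \<tau> * (2 / c * L w)" using L_vw c12 \<tau> by (intro mult_left_mono) auto
      then have "\<bar>f v z - f w z\<bar> \<le> 2 * c2 / c * \<tau> * L w" using up[OF zF] by (simp add: mult_ac)
      then show ?thesis using 1 pos vw \<sigma>' by blast
    qed
    then obtain v' w' where v': "v' \<in> words N" "oriented \<sigma>' v'" and w': "w' \<in> words N"
      and new: "0 < \<sigma> * \<sigma>' * (f w' z - f v' z)"
        "c * c1 / 2 * \<tau> * L v' \<le> \<bar>f w' z - f v' z\<bar>" "\<bar>f w' z - f v' z\<bar> \<le> 2 * c2 / c * \<tau> * L v'"
      by blast
    have Lv': "0 < L v'" using v' L_pos by blast
    define Q where "Q i = (if i \<le> n then f v' (P i) else f w' z)" for i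
    have Q_le: "Q i = f v' (P i)" if "i \<le> n" for i
      using that by (simp add: Q_def)
    have Q_Suc: "Q (Suc n) = f w' z" "Q n = f v' z" by (auto simp: Q_def z_def)
    have va: "v' @ a \<in> words N" using v' a by simp
    have "\<sigma> * \<sigma>' \<in> {1,-1}" using \<sigma> \<sigma>' by auto
    moreover have "\<forall>i\<le>Suc n. Q i \<in> F" using PF zF v' w' f_in_F by (auto simp: Q_def)
    moreover have "\<forall>i<Suc n. 0 < \<sigma> * \<sigma>' * (Q (Suc i) - Q i)"
    proof (intro allI impI)
      fix i assume "i < Suc n"
      then consider "i < n" | "i = n"
        by linarith
      then show "0 < \<sigma> * \<sigma>' * (Q (Suc i) - Q i)"
      proof cases
        case 1
        then have PF': "P i \<in> F" "P (Suc i) \<in> F" using PF by auto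
        show ?thesis
        proof (cases "\<sigma> = 1")
          case True
          then have "P i < P (Suc i)" using inc[OF 1] by simp
          then show ?thesis using v'(2) PF' True 1 by (simp add: oriented_def Q_le)
        next
          case False
          then have "\<sigma> = -1" "P (Suc i) < P i" using inc[OF 1] \<sigma> by auto
          then have "0 < \<sigma>' * (f v' (P i) - f v' (P (Suc i)))"
            using v'(2) PF' by (simp add: oriented_def)
          then show ?thesis using \<open>\<sigma> = -1\<close> 1 by (simp add: Q_le algebra_simps)
        qed
      next
        case 2
        then show ?thesis using new(1) Q_Suc by simp
      qed
    qed
    moreover have "\<forall>u\<in>words N. \<forall>i<Suc n. c3 * L (u @ (v' @ a)) \<le> \<bar>f u (Q (Suc i)) - f u (Q i)\<bar> \<and>
         \<bar>f u (Q (Suc i)) - f u (Q i)\<bar> \<le> c4 * L (u @ (v' @ a))"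
    proof (intro ballI allI impI)
      fix u i assume u: "u \<in> words N" and "i < Suc n"
      then consider "i < n" | "i = n"
        by linarith
      then show "c3 * L (u @ (v' @ a)) \<le> \<bar>f u (Q (Suc i)) - f u (Q i)\<bar> \<and>
         \<bar>f u (Q (Suc i)) - f u (Q i)\<bar> \<le> c4 * L (u @ (v' @ a))"
      proof cases
        case 1
        \<comment> \<open>For an old gap \<open>u @ v'\<close> is just another prefix in the
          induction hypothesis, so no constant is lost.\<close>
        then show ?thesis using bd[of "u @ v'" i, OF _ 1] u v'(1) by (simp add: Q_le word_map_append)
      next
        case 2
        have Lu: "0 < L u" using u L_pos by blast
        have mem: "f w' z \<in> F" "f v' z \<in> F" using zF v' w' f_in_F by auto
        have "c * L (u @ (v' @ a)) \<le> L u * L (v' @ a)" "c * L (v' @ a) \<le> L v' * L a"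
          using L_append_le[OF u va] L_append_le[OF v'(1) a] by auto
        then have "c * (c * L (u @ (v' @ a))) \<le> c * (L u * L (v' @ a))" "L u * (c * L (v' @ a)) \<le> L u * (L v' * L a)"
          using c_pos Lu by (simp_all add: mult_left_mono)
        then have L1: "c\<^sup>2 * L (u @ (v' @ a)) \<le> L u * L v' * L a"
          by (simp add: power2_eq_square mult_ac)
        have "c\<^sup>2 * L u * L (v' @ a) \<le> L (u @ (v' @ a))" "c\<^sup>2 * L v' * L a \<le> L (v' @ a)"
          using L_append_ge[OF u va] L_append_ge[OF v'(1) a] by auto
        then have "c\<^sup>2 * L u * L (v' @ a) \<le> L (u @ (v' @ a))" "c\<^sup>2 * L u * (c\<^sup>2 * L v' * L a) \<le> c\<^sup>2 * L u * L (v' @ a)"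
          using c_pos Lu by (simp_all add: mult_left_mono)
        then have L2: "c ^ 4 * (L u * L v' * L a) \<le> L (u @ (v' @ a))"
          by (simp add: power2_eq_square power4_eq_xxxx mult_ac)
        have "c3 * L (u @ (v' @ a)) = c\<^sup>2 * c1 * t0 / 2 * (c\<^sup>2 * L (u @ (v' @ a)))"
          by (simp add: c3_def power2_eq_square power4_eq_xxxx)
        also have "\<dots> \<le> c\<^sup>2 * c1 * t0 / 2 * (L u * L v' * L a)"
          using L1 c12 t0 by (intro mult_left_mono) auto
        also have "\<dots> = c * L u * (c * c1 / 2 * \<tau> * L v')"
          by (simp add: \<tau>_def power2_eq_square mult_ac)
        also have "\<dots> \<le> c * L u * \<bar>f w' z - f v' z\<bar>"
          using new(2) c_pos Lu by (intro mult_left_mono) auto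
        also have "\<dots> \<le> \<bar>f u (f w' z) - f u (f v' z)\<bar>" by (rule lower[OF u mem])
        finally have lo': "c3 * L (u @ (v' @ a)) \<le> \<bar>f u (f w' z) - f u (f v' z)\<bar>" .
        have "\<bar>f u (f w' z) - f u (f v' z)\<bar> \<le> L u * \<bar>f w' z - f v' z\<bar>" by (rule upper[OF u mem])
        also have "\<dots> \<le> L u * (2 * c2 / c * \<tau> * L v')" using new(3) Lu by (intro mult_left_mono) auto
        also have "\<dots> = 2 * c2 * t0 / c * (L u * L v' * L a)" by (simp add: \<tau>_def)
        also have "\<dots> = c4 * (c ^ 4 * (L u * L v' * L a))"
        proof -
          have "c4 * c ^ 4 = 2 * c2 * t0 / c"
            using c_pos by (simp add: c4_def power_Suc eval_nat_numeral)
          then show ?thesis by (simp add: mult.assoc[symmetric])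
        qed
        also have "\<dots> \<le> c4 * L (u @ (v' @ a))" using L2 c34 by (intro mult_left_mono) auto
        finally show ?thesis using lo' 2 Q_Suc by simp
      qed
    qed
    ultimately have "monotone_chain c3 c4 (Suc n) (v' @ a) Q (\<sigma> * \<sigma>')"
      using va unfolding monotone_chain_def by blast
    then show ?case by blast
  qed
  then show thesis using that c34 by blast
qed

text \<open>A chain with \<open>n\<close> steps puts \<open>n + 1\<close> separated points into a
  ball whose radius is \<open>n\<close> times a length comparable to the separation. The covering
  bound becomes \<open>n + 1 \<le> K * n powr t\<close>, which fails for large \<open>n\<close> if
  \<open>t < 1\<close>.\<close>

lemma covering_exponent_ge_1:
  assumes "\<not> identity_gap" and t: "covering_exponent F t"
  shows "1 \<le> t"
proof (rule ccontr)
  assume "\<not> 1 \<le> t"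
  then have "t < 1" by simp
  obtain c3 c4 where c34: "0 < c3" "0 < c4" and chains:
    "\<And>n. \<exists>a P \<sigma>. monotone_chain c3 c4 n a P \<sigma>"
    using monotone_chains[OF assms(1)] by blast
  obtain C where C: "1 \<le> C" "\<forall>x\<in>F. \<forall>r R. 0 < r \<and> r < R \<longrightarrow>
     (\<exists>S. S \<subseteq> F \<and> finite S \<and> real (card S) \<le> C * (R / r) powr t \<and> F \<inter> cball x R \<subseteq> (\<Union>y\<in>S. cball y r))"
    using t unfolding covering_exponent_def by (elim exE conjE)
  have bound: "real n + 1 \<le> C * (3 * c4 / c3) powr t * real n powr t" if "1 \<le> n" for n
  proof -
    obtain a P \<sigma> where chain: "monotone_chain c3 c4 n a P \<sigma>"
      using chains[of n] by blast
    note a = monotone_chainD(1)[OF chain] and \<sigma> = monotone_chainD(2)[OF chain]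
      and PF = monotone_chainD(3)[OF chain] and inc = monotone_chainD(4)[OF chain]
      and bd = monotone_chainD(5,6)[OF chain]
    have La: "0 < L a" using L_pos a by blast
    have abs_eq: "\<bar>P (Suc i) - P i\<bar> = \<sigma> * (P (Suc i) - P i)" if "i < n" for i
      using inc[OF that] \<sigma> by auto
    have step: "c3 * L a \<le> \<sigma> * (P (Suc i) - P i)" "\<sigma> * (P (Suc i) - P i) \<le> c4 * L a" if "i < n" for i
      using bd[OF _ that, of "[]"] abs_eq[OF that] by auto
    \<comment> \<open>Multiplication by the direction \<open>\<sigma>\<close> makes all gaps
      positive, so they add up without cancellation.\<close>
    have gaps: "real (j - i) * (c3 * L a) \<le> \<sigma> * (P j - P i) \<and> \<sigma> * (P j - P i) \<le> real (j - i) * (c4 * L a)"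
      if "i \<le> j" "j \<le> n" for i j
      using that
    proof (induction j rule: dec_induct)
      case (step k)
      then show ?case
        using \<open>\<And>i. i < n \<Longrightarrow> c3 * L a \<le> \<sigma> * (P (Suc i) - P i)\<close>[of k]
          \<open>\<And>i. i < n \<Longrightarrow> \<sigma> * (P (Suc i) - P i) \<le> c4 * L a\<close>[of k]
        by (simp add: Suc_diff_le algebra_simps)
    qed simp
    \<comment> \<open>A third of the lower bound for the gaps, so that no ball of radius
      \<open>r\<close> contains two points of the chain.\<close>
    define r where "r = c3 * L a / 3"
    define R where "R = real n * (c4 * L a)"
    have r: "0 < r" using c34 La by (simp add: r_def)
    have "c3 * L a \<le> c4 * L a" using step[of 0] that by linarith
    also have "\<dots> \<le> R" using that c34 La by (simp add: R_def)
    finally have rR: "r < R" using r by (simp add: r_def)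
    obtain S where S: "S \<subseteq> F" "finite S" "real (card S) \<le> C * (R / r) powr t" "F \<inter> cball (P 0) R \<subseteq> (\<Union>y\<in>S. cball y r)"
      using C(2)[rule_format, OF PF[of 0] conjI[OF r rR]] by auto
    have far: "c3 * L a \<le> dist (P i) (P j)" if "i < j" "j \<le> n" for i j
    proof -
      have "1 * (c3 * L a) \<le> real (j - i) * (c3 * L a)"
        using that c34 La by (intro mult_right_mono) auto
      also have "\<dots> \<le> \<sigma> * (P j - P i)" using gaps[of i j] that by simp
      also have "\<dots> \<le> dist (P i) (P j)" using \<sigma> by (auto simp: dist_real_def)
      finally show ?thesis by simp
    qed
    have far': "2 * r < dist (P i) (P j)" if "i \<le> n" "j \<le> n" "i \<noteq> j" for i j
      using far[of i j] far[of j i] that r by (cases "i < j") (auto simp: r_def dist_commute)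
    have inj: "inj_on P {..n}" using far' r by (fastforce intro: inj_onI)
    have sep: "separated_set (2 * r) (P ` {..n})"
      unfolding separated_set_def using far' by (metis atMost_iff imageE)
    have "P ` {..n} \<subseteq> \<Union> ((\<lambda>y. cball y r) ` S)"
    proof
      fix x assume "x \<in> P ` {..n}"
      then obtain i where i: "i \<le> n" "x = P i"
        by auto
      have "dist (P 0) (P i) = \<sigma> * (P i - P 0)"
      proof -
        have "0 \<le> real i * (c3 * L a)" using c34 La by simp
        then have "0 \<le> \<sigma> * (P i - P 0)" using gaps[of 0 i] i(1) by simp
        then show ?thesis using \<sigma> by (auto simp: dist_real_def)
      qed
      also have "\<dots> \<le> R"
      proof -
        have "real (i - 0) * (c4 * L a) \<le> R"
          unfolding R_def using i(1) c34 La by (intro mult_right_mono) auto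
        then show ?thesis using gaps[OF le0 i(1)] by linarith
      qed
      finally show "x \<in> \<Union> ((\<lambda>y. cball y r) ` S)"
        using PF[OF i(1)] i(2) by (intro subsetD[OF S(4)]) simp
    qed
    moreover have "dist x y \<le> 2 * r" if xy: "U \<in> (\<lambda>y. cball y r) ` S" "x \<in> U" "y \<in> U" for U x y
    proof -
      obtain e where "dist e x \<le> r" "dist e y \<le> r"
        using xy by auto
      then show ?thesis using dist_triangle3[of x y e] by linarith
    qed
    ultimately have "card (P ` {..n}) \<le> card ((\<lambda>y. cball y r) ` S)"
      using card_separated_le(2)[OF sep, of "(\<lambda>y. cball y r) ` S"] S(2) by blast
    also have "\<dots> \<le> card S" using S(2) by (rule card_image_le)
    finally have "real n + 1 \<le> real (card S)" using card_image[OF inj] by simp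
    also have "\<dots> \<le> C * (R / r) powr t" by (rule S(3))
    also have "R / r = (3 * c4 / c3) * real n" using La by (simp add: R_def r_def)
    also have "C * ((3 * c4 / c3) * real n) powr t = C * (3 * c4 / c3) powr t * real n powr t"
      by (simp only: powr_mult mult.assoc)
    finally show ?thesis .
  qed
  define K where "K = C * (3 * c4 / c3) powr t"
  have "filterlim (\<lambda>n. real n powr (1 - t)) at_top sequentially" using \<open>t < 1\<close> by real_asymp
  then have "eventually (\<lambda>n. K < real n powr (1 - t)) sequentially"
    by (simp add: filterlim_at_top_dense)
  then have "eventually (\<lambda>n. 1 \<le> n \<and> K < real n powr (1 - t)) sequentially"
    using eventually_ge_at_top[of 1] by eventually_elim auto
  from eventually_happens'[OF trivial_limit_sequentially this] obtain n
    where n: "1 \<le> n" "K < real n powr (1 - t)"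
    by blast
  have "K * real n powr t < real n powr (1 - t) * real n powr t"
    using n by (intro mult_strict_right_mono) auto
  also have "\<dots> = real n" using n(1) by (simp add: powr_add[symmetric])
  finally show False
    using bound[OF n(1)] by (simp add: K_def)
qed

end

section \<open>Ahlfors regularity\<close>

text \<open>Mass distribution principle: the sets of a cover are replaced by balls centred in
  \<open>A\<close>, whose total mass is at most \<open>C\<close> times the cost, so the cost cannot
  fall below a fixed mass divided by \<open>C\<close>.\<close>

lemma hausdorff_measure_pos_of_ahlfors_regular:
  fixes A :: "'a::heine_borel set"
  assumes A: "compact A" "0 < diameter A" and s: "0 < s" and reg: "ahlfors_regular s A"
  shows "hausdorff_measure s A \<noteq> 0"
proof
  assume zero: "hausdorff_measure s A = 0"
  obtain \<mu> C where \<mu>: "radon_measure \<mu>" "AE x in \<mu>. x \<in> A" and C: "1 \<le> C" and all: "\<forall>x\<in>A. \<forall>r>0. (bounded A \<longrightarrow> r < diameter A) \<longrightarrow>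
          ennreal (inverse C * r powr s) \<le> emeasure \<mu> (cball x r) \<and>
          emeasure \<mu> (cball x r) \<le> ennreal (C * r powr s)"
    using reg unfolding ahlfors_regular_def by (elim exE conjE)
  have lo: "ennreal (inverse C * r powr s) \<le> emeasure \<mu> (cball x r)"
    and up: "emeasure \<mu> (cball x r) \<le> ennreal (C * r powr s)"
    if "x \<in> A" "0 < r" "r < diameter A" for x r
    using all that by auto
  have [measurable]: "cball x r \<in> sets \<mu>" for x r
    using \<mu>(1) by (simp add: radon_measure_def)
  \<comment> \<open>Covering sets may have diameter 0, while regularity speaks of positive radii;
    letting the radius tend to 0 shows that points of \<open>A\<close> carry no mass.\<close>
  have up0: "emeasure \<mu> (cball x r) \<le> ennreal (C * r powr s)" if x: "x \<in> A" and r: "0 \<le> r" "r < diameter A" for x r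
  proof (cases "r = 0")
    case True
    have lim: "((\<lambda>t. ennreal (C * t powr s)) \<longlongrightarrow> ennreal (C * 0 powr s)) (at_right 0)"
      using s by (intro tendsto_ennrealI tendsto_mult tendsto_const tendsto_powr' tendsto_ident_at)
        (auto intro!: eventually_mono[OF eventually_at_right_less])
    have "eventually (\<lambda>t. emeasure \<mu> (cball x r) \<le> ennreal (C * t powr s)) (at_right 0)"
      using eventually_at_right_real[OF A(2)]
    proof eventually_elim
      case (elim t)
      then have "emeasure \<mu> (cball x r) \<le> emeasure \<mu> (cball x t)"
        using True by (intro emeasure_mono) auto
      also have "\<dots> \<le> ennreal (C * t powr s)" using elim x by (intro up) auto
      finally show ?case .
    qed
    then show ?thesis using tendsto_lowerbound[OF lim] True by simp
  qed (use up x r in simp)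
  obtain x0 where "x0 \<in> A"
    using A(2) by (metis diameter_empty equals0I less_irrefl)
  define m where "m = inverse C * (diameter A / 2) powr s"
  have "0 < m" using C A(2) by (simp add: m_def)
  \<comment> \<open>The second bound forces all covering sets to be shorter than \<open>A\<close>,
    where regularity applies; the first yields the final contradiction.\<close>
  define \<epsilon> where "\<epsilon> = min (m / C) (diameter A powr s)"
  have "0 < \<epsilon>" using \<open>0 < m\<close> C A(2) by (simp add: \<epsilon>_def)
  then obtain \<U> where U: "finite_cover A \<U>" "cover_cost s \<U> < \<epsilon>"
    using hausdorff_measure_eq_0_obtain_cover[OF s A(1) zero] by blast
  then have fin: "finite \<U>" and sub: "A \<subseteq> \<Union>\<U>" and bdd: "\<And>U. U \<in> \<U> \<Longrightarrow> bounded U"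
    by (auto simp: finite_cover_def)
  define \<V> where "\<V> = {U\<in>\<U>. U \<inter> A \<noteq> {}}"
  have "\<forall>U\<in>\<V>. \<exists>x. x \<in> U \<inter> A" by (auto simp: \<V>_def)
  then obtain p where p: "\<And>U. U \<in> \<V> \<Longrightarrow> p U \<in> U \<inter> A"
    by metis
  define B where "B U = cball (p U) (diameter U)" for U
  have "A \<subseteq> (\<Union>U\<in>\<V>. B U)"
  proof
    fix x assume x: "x \<in> A"
    then obtain U where U: "U \<in> \<U>" "x \<in> U"
      using sub by blast
    then have "U \<in> \<V>" using x by (auto simp: \<V>_def)
    moreover have "dist (p U) x \<le> diameter U"
      using p[OF \<open>U \<in> \<V>\<close>] U by (intro diameter_bounded_bound bdd) auto
    ultimately show "x \<in> (\<Union>U\<in>\<V>. B U)" by (auto simp: B_def)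
  qed
  have small: "diameter U < diameter A" if "U \<in> \<U>" for U
  proof -
    have "diameter U powr s \<le> cover_cost s \<U>"
      unfolding cover_cost_def using fin that by (intro member_le_sum) auto
    also have "\<dots> < diameter A powr s" using U(2) by (simp add: \<epsilon>_def)
    finally show ?thesis using powr_mono2[of s "diameter A" "diameter U"] s A(2) by linarith
  qed
  have "ennreal m \<le> emeasure \<mu> (cball x0 (diameter A / 2))"
    unfolding m_def using \<open>x0 \<in> A\<close> A(2) by (intro lo) auto
  also have "\<dots> \<le> emeasure \<mu> (\<Union>U\<in>\<V>. B U)"
  proof (rule emeasure_mono_AE)
    show "AE x in \<mu>. x \<in> cball x0 (diameter A / 2) \<longrightarrow> x \<in> (\<Union>U\<in>\<V>. B U)"
      using \<mu>(2) by eventually_elim (use \<open>A \<subseteq> (\<Union>U\<in>\<V>. B U)\<close> in blast)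
    show "(\<Union>U\<in>\<V>. B U) \<in> sets \<mu>" using fin by (intro sets.finite_UN) (auto simp: B_def \<V>_def)
  qed
  also have "\<dots> \<le> (\<Sum>U\<in>\<V>. emeasure \<mu> (B U))"
    using fin by (intro emeasure_subadditive_finite) (auto simp: B_def \<V>_def)
  also have "\<dots> \<le> (\<Sum>U\<in>\<V>. ennreal (C * diameter U powr s))"
  proof (intro sum_mono)
    fix U assume "U \<in> \<V>"
    then show "emeasure \<mu> (B U) \<le> ennreal (C * diameter U powr s)"
      unfolding B_def using p[of U] small[of U] bdd[of U] diameter_ge_0[of U]
      by (intro up0) (auto simp: \<V>_def)
  qed
  also have "\<dots> = ennreal (\<Sum>U\<in>\<V>. C * diameter U powr s)" using C by (intro sum_ennreal) auto
  also have "(\<Sum>U\<in>\<V>. C * diameter U powr s) = C * (\<Sum>U\<in>\<V>. diameter U powr s)"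
    by (simp add: sum_distrib_left)
  also have "\<dots> \<le> C * cover_cost s \<U>"
    unfolding cover_cost_def using fin C by (intro mult_left_mono sum_mono2) (auto simp: \<V>_def)
  finally have "ennreal m \<le> ennreal (C * cover_cost s \<U>)" by (simp add: ennreal_leI)
  then have "m \<le> C * cover_cost s \<U>" using C cover_cost_nonneg[of s \<U>] by (simp add: ennreal_le_iff)
  also have "\<dots> < C * (m / C)" using U(2) C by (intro mult_strict_left_mono) (auto simp: \<epsilon>_def)
  finally show False
    using C by simp
qed

section \<open>Finite Borel measures and weak limits\<close>

lemma radon_measure_finite_borel:
  fixes \<nu> :: "real measure"
  assumes "finite_measure \<nu>" "sets \<nu> = sets borel"
  shows "radon_measure \<nu>"
proof -
  interpret finite_measure \<nu> by fact
  have fin: "emeasure \<nu> (space \<nu>) \<noteq> \<infinity>" by simp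
  have "emeasure \<nu> V = (SUP K \<in> {K. compact K \<and> K \<subseteq> V}. emeasure \<nu> K)" if "open V" for V
    using inner_regular[OF assms(2) fin, of V] that by (simp add: conj_commute)
  moreover have "emeasure \<nu> B = (INF V \<in> {V. open V \<and> B \<subseteq> V}. emeasure \<nu> V)" if "B \<in> sets borel" for B
    using outer_regular[OF assms(2) fin that] by (simp add: conj_commute)
  moreover have "emeasure \<nu> K < \<infinity>" for K
    by (metis emeasure_finite infinity_ennreal_def top.not_eq_extremum)
  ultimately show ?thesis unfolding radon_measure_def using assms(2) by blast
qed

text \<open>Weak convergence gives the limit of the mass of a ball when its sphere is null. A finite
  measure has countably many atoms, so all but countably many radii qualify.\<close>

lemma ex_null_sphere:
  fixes \<nu> :: "real measure"
  assumes "finite_measure \<nu>" "sets \<nu> = sets borel" "a < b" "0 \<le> a"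
  obtains R where "a < R" "R < b" "emeasure \<nu> (sphere x R) = 0"
proof -
  interpret finite_measure \<nu> by fact
  define Z where "Z = (\<lambda>y. \<bar>y - x\<bar>) ` {y. measure \<nu> {y} \<noteq> 0}"
  have "countable Z" unfolding Z_def by (intro countable_image countable_support)
  moreover have "uncountable {a<..<b}" using assms(3) by (simp add: uncountable_open_interval)
  ultimately have "\<not> {a<..<b} \<subseteq> Z" using countable_subset by blast
  then obtain R where R: "R \<in> {a<..<b}" "R \<notin> Z"
    by blast
  have "0 < R" using R assms(4) by simp
  have null: "emeasure \<nu> {y} = 0" if "\<bar>y - x\<bar> = R" for y
    using R(2) that by (auto simp: Z_def emeasure_eq_measure)
  have "sphere x R = {x - R} \<union> {x + R}"
    using \<open>0 < R\<close> by (auto simp: dist_real_def abs_if split: if_splits)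
  moreover have "emeasure \<nu> ({x - R} \<union> {x + R}) \<le> emeasure \<nu> {x - R} + emeasure \<nu> {x + R}"
    by (rule emeasure_subadditive) (auto simp: assms(2))
  ultimately have "emeasure \<nu> (sphere x R) \<le> 0"
    using null[of "x - R"] null[of "x + R"] \<open>0 < R\<close> by simp
  then show thesis using that[of R] R(1) by simp
qed

text \<open>The regular measure is a weak limit of uniform distributions on finite sets.\<close>

lemma ahlfors_regularI_nets:
  fixes A :: "real set" and E :: "nat \<Rightarrow> real set"
  assumes A: "compact A" "A \<noteq> {}" and E: "\<And>n. finite (E n)" "\<And>n. E n \<noteq> {}" "\<And>n. E n \<subseteq> A"
    and c: "0 < cl" "0 < cu" "0 < s"
    and up: "\<And>x R. x \<in> A \<Longrightarrow> 0 < R \<Longrightarrow> R < diameter A \<Longrightarrow>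
      eventually (\<lambda>n. real (card (E n \<inter> cball x R)) / real (card (E n)) \<le> cu * R powr s) sequentially"
    and lo: "\<And>x R. x \<in> A \<Longrightarrow> 0 < R \<Longrightarrow> R < diameter A \<Longrightarrow>
      eventually (\<lambda>n. cl * R powr s \<le> real (card (E n \<inter> cball x R)) / real (card (E n))) sequentially"
  shows "ahlfors_regular s A"
proof -
  define \<mu> where "\<mu> n = distr (measure_pmf (pmf_of_set (E n))) borel id" for n
  have id_meas: "id \<in> measurable (measure_pmf (pmf_of_set (E n))) borel" for n
    by simp
  have measure_\<mu>: "measure (\<mu> n) B = real (card (E n \<inter> B)) / real (card (E n))" if "B \<in> sets borel" for n B
    using that E(1,2) by (simp add: \<mu>_def measure_distr[OF id_meas] measure_pmf_of_set)
  have dist: "real_distribution (\<mu> n)" for n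
    unfolding real_distribution_def real_distribution_axioms_def
    using measure_pmf.prob_space_distr[OF id_meas] by (simp add: \<mu>_def)
  obtain b where b: "0 < b" "A \<subseteq> ball 0 b"
    using bounded_subset_ballD[OF compact_imp_bounded[OF A(1)]] by blast
  have "tight \<mu>"
    unfolding tight_def
  proof (intro conjI allI impI dist)
    fix e :: real assume "0 < e"
    have "measure (\<mu> n) {-b<..b} = 1" for n
    proof -
      have "E n \<inter> {-b<..b} = E n" using E(3)[of n] b(2) by (force simp: dist_real_def)
      then show ?thesis using E(1,2) by (simp add: measure_\<mu>)
    qed
    then show "\<exists>a b. a < b \<and> (\<forall>n. 1 - e < measure (\<mu> n) {a<..b})"
      using \<open>0 < e\<close> b(1) by (intro exI[of _ "-b"] exI[of _ b]) auto
  qed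
  \<comment> \<open>All distributions live in one bounded interval, so a subsequence converges
    weakly.\<close>
  then obtain k \<nu> where k: "strict_mono k" and \<nu>: "real_distribution \<nu>" and conv: "weak_conv_m (\<mu> \<circ> id \<circ> k) \<nu>"
    using tight_imp_convergent_subsubsequence[OF \<open>tight \<mu>\<close> strict_mono_id] by blast
  interpret \<nu>: real_distribution \<nu> by fact
  have dist': "real_distribution ((\<mu> \<circ> id \<circ> k) n)" for n
    using dist by simp
  have sets_\<nu>: "sets \<nu> = sets borel" by simp
  have fin_\<nu>: "finite_measure \<nu>" by unfold_locales
  have set_conv: "(\<lambda>n. real (card (E (k n) \<inter> cball x R)) / real (card (E (k n)))) \<longlonglongrightarrow> measure \<nu> (cball x R)"
    if "emeasure \<nu> (sphere x R) = 0" for x R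
    using weak_conv_imp_continuity_set_conv[OF dist' \<nu> conv, of "cball x R"] that by (simp add: measure_\<mu>)
  have lim: "eventually (\<lambda>n. P (k n)) sequentially" if "eventually P sequentially" for P
    using filterlim_subseq[OF k] that by (simp add: filterlim_iff)
  have upper: "measure \<nu> (cball x R) \<le> cu * 2 powr s * R powr s" if x: "x \<in> A" and R: "0 < R" "R < diameter A" for x R
  proof -
    \<comment> \<open>The sphere of radius \<open>R\<close> may carry mass. A null radius between
      \<open>R\<close> and \<open>2 * R\<close> costs only the factor \<open>2 powr s\<close>, and
      keeping it below the diameter makes \<open>up\<close> applicable.\<close>
    obtain R' where R': "R < R'" "R' < min (2 * R) (diameter A)" "emeasure \<nu> (sphere x R') = 0"
      by (rule ex_null_sphere[OF fin_\<nu> sets_\<nu>, of R "min (2 * R) (diameter A)" x]) (use R in auto)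
    have "measure \<nu> (cball x R) \<le> measure \<nu> (cball x R')"
      using R' by (intro \<nu>.finite_measure_mono) auto
    also have "\<dots> \<le> cu * R' powr s"
    proof (rule tendsto_upperbound[OF set_conv[OF R'(3)]])
      show "eventually (\<lambda>n. real (card (E (k n) \<inter> cball x R')) / real (card (E (k n))) \<le> cu * R' powr s) sequentially"
        using R R' x by (intro lim[OF up]) auto
    qed simp
    also have "\<dots> \<le> cu * (2 * R) powr s" using R R' c by (intro mult_left_mono powr_mono2) auto
    finally show ?thesis by (simp add: powr_mult)
  qed
  have lower: "cl * (1/2) powr s * R powr s \<le> measure \<nu> (cball x R)" if x: "x \<in> A" and R: "0 < R" "R < diameter A" for x R
  proof -
    obtain R' where R': "R / 2 < R'" "R' < R" "emeasure \<nu> (sphere x R') = 0"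
      by (rule ex_null_sphere[OF fin_\<nu> sets_\<nu>, of "R / 2" R x]) (use R in auto)
    have "cl * (1/2) powr s * R powr s = cl * (R / 2) powr s"
      using R by (simp add: powr_mult[symmetric])
    also have "\<dots> \<le> cl * R' powr s" using R R' c by (intro mult_left_mono powr_mono2) auto
    also have "\<dots> \<le> measure \<nu> (cball x R')"
    proof (rule tendsto_lowerbound[OF set_conv[OF R'(3)]])
      show "eventually (\<lambda>n. cl * R' powr s \<le> real (card (E (k n) \<inter> cball x R')) / real (card (E (k n)))) sequentially"
        using R R' x by (intro lim[OF lo]) auto
    qed simp
    also have "\<dots> \<le> measure \<nu> (cball x R)" using R' by (intro \<nu>.finite_measure_mono) auto
    finally show ?thesis .
  qed
  \<comment> \<open>A bounded continuous function vanishing exactly on \<open>A\<close>: its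
    integrals are 0 along the sequence, hence in the limit, so the limit measure lives on
    \<open>A\<close>.\<close>
  define h where "h y = min 1 (infdist y A)" for y
  have h: "0 \<le> h y" "h y \<le> 1" for y
    by (auto simp: h_def infdist_nonneg)
  have cont_h: "continuous_on UNIV h" unfolding h_def by (intro continuous_intros)
  have "AE y in \<nu>. y \<in> A"
  proof -
    have "(\<lambda>n. integral\<^sup>L ((\<mu> \<circ> id \<circ> k) n) h) \<longlonglongrightarrow> integral\<^sup>L \<nu> h"
      by (rule weak_conv_imp_integral_bdd_continuous_conv[OF dist' \<nu> conv, where B = 1])
        (use cont_h h in \<open>auto simp: continuous_on_eq_continuous_at\<close>)
    moreover have "integral\<^sup>L (\<mu> n) h = 0" for n
    proof -
      have "integral\<^sup>L (\<mu> n) h = (\<integral>y. h y \<partial>measure_pmf (pmf_of_set (E n)))"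
        unfolding \<mu>_def using borel_measurable_continuous_onI[OF cont_h] by (subst integral_distr[OF id_meas]) auto
      also have "\<dots> = 0"
        using E by (intro integral_eq_zero_AE) (auto simp: AE_measure_pmf_iff h_def infdist_zero subsetD[OF E(3)])
      finally show ?thesis .
    qed
    ultimately have "integral\<^sup>L \<nu> h = 0" by (simp add: LIMSEQ_const_iff)
    moreover have "integrable \<nu> h"
      using h borel_measurable_continuous_onI[OF cont_h] by (intro \<nu>.integrable_const_bound[of _ 1]) auto
    ultimately have "AE y in \<nu>. h y = 0" using h by (subst (asm) integral_nonneg_eq_0_iff_AE) auto
    then show ?thesis
    proof eventually_elim
      case (elim y)
      then have "infdist y A = 0" by (auto simp: h_def min_def split: if_splits)
      then show ?case using in_closed_iff_infdist_zero[OF compact_imp_closed[OF A(1)] A(2)] by simp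
    qed
  qed
  moreover have "radon_measure \<nu>" using fin_\<nu> sets_\<nu> by (rule radon_measure_finite_borel)
  moreover define C where "C = max 1 (max (cu * 2 powr s) (1 / (cl * (1/2) powr s)))"
  have "1 \<le> C" "cu * 2 powr s \<le> C" "inverse C \<le> cl * (1/2) powr s"
  proof -
    show "1 \<le> C" "cu * 2 powr s \<le> C" by (auto simp: C_def)
    have "1 / (cl * (1/2) powr s) \<le> C" by (simp add: C_def)
    then have "inverse C \<le> inverse (1 / (cl * (1/2) powr s))"
      using c by (intro le_imp_inverse_le) auto
    then show "inverse C \<le> cl * (1/2) powr s" by simp
  qed
  moreover from this have "ennreal (inverse C * r powr s) \<le> emeasure \<nu> (cball x r) \<and>
      emeasure \<nu> (cball x r) \<le> ennreal (C * r powr s)" if "x \<in> A" "0 < r" "r < diameter A" for x r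
    using lower[OF that] upper[OF that] mult_right_mono[of "inverse C" "cl * (1/2) powr s" "r powr s"]
      mult_right_mono[of "cu * 2 powr s" C "r powr s"]
    by (auto simp: \<nu>.emeasure_eq_measure intro!: ennreal_leI)
  ultimately show ?thesis unfolding ahlfors_regular_def using compact_imp_bounded[OF A(1)] by blast
qed

section \<open>Counting net points under weak separation\<close>

context quasi_conformal_ifs_dim
begin

text \<open>Weak separation counts maps, not words: one word is chosen for each restricted map of
  scale \<open>r\<close>. Words with equal restrictions have equal cylinders, so the chosen ones
  still cover the ball.\<close>

lemma weak_separation_cylinders:
  assumes M: "\<forall>x\<in>F. \<forall>r>0. finite (scale_maps N \<phi> F x r) \<and> card (scale_maps N \<phi> F x r) \<le> M"
    and x: "x \<in> F" and r: "0 < r" "r < D"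
  shows "\<exists>W. finite W \<and> W \<subseteq> words N \<and> card W \<le> M \<and> (\<forall>w\<in>W. L w \<le> r / (c * D)) \<and>
    F \<inter> cball x r \<subseteq> (\<Union>w\<in>W. f w ` F)"
proof -
  have "\<forall>g\<in>scale_maps N \<phi> F x r. \<exists>w. g = restrict (f w) F \<and> w \<in> words N \<and> L w \<le> r / (c * D)"
  proof
    fix g assume "g \<in> scale_maps N \<phi> F x r"
    then obtain w where w: "g = restrict (f w) F" "w \<in> words N" "w \<noteq> []" "diameter (f w ` F) \<le> r"
          "r < diameter (f (butlast w) ` F)"
      unfolding scale_maps_def by blast
    then show "\<exists>w. g = restrict (f w) F \<and> w \<in> words N \<and> L w \<le> r / (c * D)"
      using cylinder_L_bounds(2)[OF w(2-5)] by blast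
  qed
  then obtain q where q: "\<And>g. g \<in> scale_maps N \<phi> F x r \<Longrightarrow>
      g = restrict (f (q g)) F \<and> q g \<in> words N \<and> L (q g) \<le> r / (c * D)"
    by metis
  define W where "W = q ` scale_maps N \<phi> F x r"
  have "F \<inter> cball x r \<subseteq> (\<Union>w\<in>W. f w ` F)"
  proof
    fix y assume y: "y \<in> F \<inter> cball x r"
    then have "y \<in> F" by blast
    obtain w where w: "w \<in> words N" "w \<noteq> []" "y \<in> f w ` F" "diameter (f w ` F) \<le> r"
        "r < diameter (f (butlast w) ` F)"
      by (rule ex_cylinder[OF \<open>y \<in> F\<close> r])
    then have g: "restrict (f w) F \<in> scale_maps N \<phi> F x r" using y unfolding scale_maps_def by blast
    then have "restrict (f w) F = restrict (f (q (restrict (f w) F))) F" using q by blast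
    then have "f w ` F = f (q (restrict (f w) F)) ` F" by (metis image_restrict_eq)
    then show "y \<in> (\<Union>w\<in>W. f w ` F)" using w(3) g by (auto simp: W_def)
  qed
  moreover have "finite W" "card W \<le> M"
    using bspec[OF M x] r(1) card_image_le[of "scale_maps N \<phi> F x r" q] by (auto simp: W_def)
  moreover have "W \<subseteq> words N" "\<forall>w\<in>W. L w \<le> r / (c * D)" using q unfolding W_def by blast+
  ultimately show ?thesis by blast
qed

text \<open>At most \<open>M\<close> cylinders of scale \<open>R\<close> cover the ball. Pulling the
  points in one of them back to \<open>F\<close> makes them separated at a scale of order
  \<open>r / R\<close>, where the global packing bound applies.\<close>

lemma card_separated_ball_le:
  assumes M: "\<forall>x\<in>F. \<forall>r>0. finite (scale_maps N \<phi> F x r) \<and> card (scale_maps N \<phi> F x r) \<le> M"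
    and x: "x \<in> F" and r: "0 < r" "r \<le> R" and R: "R < D"
    and S: "S \<subseteq> F \<inter> cball x R" "finite S" "separated_set r S"
  shows "real (card S) \<le> (real M + 1) * (2 / (c\<^sup>2 * cell_ratio * D)) powr s * (R / r) powr s"
proof -
  have "0 < R" using r by simp
  obtain W where W: "finite W" "W \<subseteq> words N" "card W \<le> M" "\<forall>w\<in>W. L w \<le> R / (c * D)"
    "F \<inter> cball x R \<subseteq> (\<Union>w\<in>W. f w ` F)"
    using weak_separation_cylinders[OF M x \<open>0 < R\<close> R] by (elim exE conjE)
  \<comment> \<open>The factor 2 leaves room for \<open>r' < D\<close> also when
    \<open>r = R\<close> and \<open>c = 1\<close>.\<close>
  define r' where "r' = r * c * D / (2 * R)"
  have "r * (c * D) < 2 * R * D"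
  proof -
    have "r * (c * D) \<le> R * (1 * D)" using r c_le D_pos c_pos \<open>0 < R\<close> by (intro mult_mono) auto
    then show ?thesis using mult_pos_pos[OF \<open>0 < R\<close> D_pos] by linarith
  qed
  then have r': "0 < r'" "r' < D"
    using r c_pos D_pos \<open>0 < R\<close> by (auto simp: r'_def pos_divide_less_eq mult_ac)
  define Q where "Q = (1 / c) powr s / (cell_ratio * r') powr s"
  have piece: "real (card (S \<inter> f w ` F)) \<le> Q" if w: "w \<in> W" for w
  proof -
    have wN: "w \<in> words N" using W(2) w by blast
    define T where "T = {y\<in>F. f w y \<in> S}"
    have img: "f w ` T = S \<inter> f w ` F" by (auto simp: T_def)
    have inj: "inj_on (f w) T" by (rule inj_on_subset[OF inj_on_f[OF wN]]) (auto simp: T_def)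
    have "finite (f w ` T)" using S(2) img by simp
    then have "finite T" using inj by (rule finite_imageD)
    have "separated_set r' T"
      unfolding separated_set_def
    proof (intro ballI impI)
      fix y z assume yz: "y \<in> T" "z \<in> T" "y \<noteq> z"
      then have yzF: "y \<in> F" "z \<in> F" by (auto simp: T_def)
      have "f w y \<noteq> f w z" using inj yz by (auto simp: inj_on_def)
      then have "r < dist (f w y) (f w z)" using S(3) yz by (auto simp: separated_set_def T_def)
      also have "\<dots> \<le> L w * dist y z" using upper[OF wN yzF] by (simp add: dist_real_def)
      also have "\<dots> \<le> R / (c * D) * dist y z" using bspec[OF W(4) w] by (intro mult_right_mono) auto
      finally have "r * c * D / R < dist y z" using \<open>0 < R\<close> c_pos D_pos by (simp add: field_simps)
      moreover have "r' \<le> r * c * D / R"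
        using r c_pos D_pos \<open>0 < R\<close> by (simp add: r'_def field_simps)
      ultimately show "r' < dist y z" by linarith
    qed
    then have "real (card T) * (cell_ratio * r') powr s \<le> (1 / c) powr s"
      using \<open>finite T\<close> r' by (intro card_separated_F_le) (auto simp: T_def)
    then have "real (card T) \<le> Q" using cell_ratio_pos r' by (simp add: Q_def pos_le_divide_eq)
    then show ?thesis using card_image[OF inj] img by simp
  qed
  have "S = (\<Union>w\<in>W. S \<inter> f w ` F)" using S(1) W(5) by blast
  then have "card S \<le> (\<Sum>w\<in>W. card (S \<inter> f w ` F))"
    using card_UN_le[OF W(1), of "\<lambda>w. S \<inter> f w ` F"] by simp
  then have "real (card S) \<le> (\<Sum>w\<in>W. real (card (S \<inter> f w ` F)))" by (metis of_nat_le_iff of_nat_sum)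
  also have "\<dots> \<le> (\<Sum>w\<in>W. Q)" by (intro sum_mono piece)
  also have "\<dots> = real (card W) * Q" by simp
  also have "\<dots> \<le> (real M + 1) * Q" using W(3) by (intro mult_right_mono) (auto simp: Q_def)
  also have "Q = (1 / (c * cell_ratio * r')) powr s"
    by (simp add: Q_def powr_divide[symmetric] mult.assoc)
  also have "1 / (c * cell_ratio * r') = 2 / (c\<^sup>2 * cell_ratio * D) * (R / r)"
    by (simp add: r'_def power2_eq_square)
  also have "(real M + 1) * (2 / (c\<^sup>2 * cell_ratio * D) * (R / r)) powr s =
      (real M + 1) * (2 / (c\<^sup>2 * cell_ratio * D)) powr s * (R / r) powr s"
    by (simp only: powr_mult mult.assoc)
  finally show ?thesis .
qed

text \<open>Replacing the part of \<open>F\<close> in each small set by at most \<open>M\<close>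
  cylinders of scale \<open>r\<close> turns the cover into one by cylinders, to which
  \<open>covering\<close> applies.\<close>

lemma card_cover_ge:
  assumes M: "\<forall>x\<in>F. \<forall>r>0. finite (scale_maps N \<phi> F x r) \<and> card (scale_maps N \<phi> F x r) \<le> M"
    and U: "finite I" "F \<subseteq> (\<Union>i\<in>I. U i)" and r: "0 < r" "r < D"
    and small: "\<And>i y z. i \<in> I \<Longrightarrow> y \<in> U i \<Longrightarrow> z \<in> U i \<Longrightarrow> dist y z \<le> r"
  shows "1 \<le> real (card I) * real M * (r / (c * D)) powr s"
proof -
  have "\<exists>W. finite W \<and> W \<subseteq> words N \<and> card W \<le> M \<and> (\<forall>w\<in>W. L w \<le> r / (c * D)) \<and>
      F \<inter> U i \<subseteq> (\<Union>w\<in>W. f w ` F)" if i: "i \<in> I" for i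
  proof (cases "F \<inter> U i = {}")
    case False
    then obtain x where x: "x \<in> F" "x \<in> U i"
      by blast
    obtain W where W: "finite W" "W \<subseteq> words N" "card W \<le> M" "\<forall>w\<in>W. L w \<le> r / (c * D)"
      "F \<inter> cball x r \<subseteq> (\<Union>w\<in>W. f w ` F)"
      using weak_separation_cylinders[OF M x(1) r] by (elim exE conjE)
    have "F \<inter> U i \<subseteq> F \<inter> cball x r" using small[OF i x(2)] by auto
    then have "F \<inter> U i \<subseteq> (\<Union>w\<in>W. f w ` F)" using W(5) by (rule order_trans)
    then show ?thesis by (intro exI[of _ W] conjI W)
  qed (intro exI[of _ "{}"], simp)
  then have "\<forall>i\<in>I. \<exists>W. finite W \<and> W \<subseteq> words N \<and> card W \<le> M \<and> (\<forall>w\<in>W. L w \<le> r / (c * D)) \<and>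
      F \<inter> U i \<subseteq> (\<Union>w\<in>W. f w ` F)"
    by (rule ballI)
  from bchoice[OF this] obtain W where W': "\<forall>i\<in>I. finite (W i) \<and> W i \<subseteq> words N \<and> card (W i) \<le> M \<and>
      (\<forall>w\<in>W i. L w \<le> r / (c * D)) \<and> F \<inter> U i \<subseteq> (\<Union>w\<in>W i. f w ` F)"
    by (elim exE)
  have W: "finite (W i)" "W i \<subseteq> words N" "card (W i) \<le> M" "\<forall>w\<in>W i. L w \<le> r / (c * D)"
    "F \<inter> U i \<subseteq> (\<Union>w\<in>W i. f w ` F)" if "i \<in> I" for i
    using bspec[OF W' that] by simp_all
  define V where "V = (\<Union>i\<in>I. W i)"
  have "F \<subseteq> (\<Union>w\<in>V. f w ` F)"
  proof
    fix y assume "y \<in> F"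
    then obtain i where "i \<in> I" "y \<in> F \<inter> U i"
      using U(2) by blast
    then have "y \<in> (\<Union>w\<in>W i. f w ` F)" using subsetD[OF W(5)] by blast
    then show "y \<in> (\<Union>w\<in>V. f w ` F)" using \<open>i \<in> I\<close> by (auto simp: V_def)
  qed
  moreover have "finite V" using U(1) W(1) by (simp add: V_def)
  moreover have "V \<subseteq> words N" unfolding V_def using W(2) by blast
  ultimately have "1 \<le> (\<Sum>w\<in>V. L w powr s)" by (intro covering)
  also have "\<dots> \<le> (\<Sum>w\<in>V. (r / (c * D)) powr s)"
  proof (intro sum_mono powr_mono2)
    fix w assume "w \<in> V"
    then show "0 \<le> L w" using L_pos[OF subsetD[OF \<open>V \<subseteq> words N\<close>]] by (simp add: less_imp_le)
    show "L w \<le> r / (c * D)" using \<open>w \<in> V\<close> W(4) unfolding V_def by blast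
  qed (use dim_pos in simp)
  also have "\<dots> = real (card V) * (r / (c * D)) powr s" by simp
  also have "\<dots> \<le> real (card I * M) * (r / (c * D)) powr s"
  proof -
    have "card V \<le> (\<Sum>i\<in>I. card (W i))" unfolding V_def by (rule card_UN_le[OF U(1)])
    also have "\<dots> \<le> (\<Sum>i\<in>I. M)" using W(3) by (intro sum_mono)
    finally have "card V \<le> card I * M" by simp
    then show ?thesis by (intro mult_right_mono) (simp_all only: of_nat_le_iff powr_ge_zero)
  qed
  finally show ?thesis by simp
qed

text \<open>A cylinder of diameter at most \<open>R / 2\<close> around \<open>x\<close> is a copy of
  \<open>F\<close> inside the ball. The net balls meeting it have their centres in
  \<open>cball x R\<close> since \<open>r \<le> R / 2\<close>; pulled back they cover all of
  \<open>F\<close> at a scale of order \<open>r / R\<close>, and \<open>card_cover_ge\<close> counts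
  them.\<close>

lemma card_net_ball_ge:
  assumes M: "\<forall>x\<in>F. \<forall>r>0. finite (scale_maps N \<phi> F x r) \<and> card (scale_maps N \<phi> F x r) \<le> M"
    and E: "finite E" "F \<subseteq> (\<Union>e\<in>E. cball e r)"
    and x: "x \<in> F" and R: "0 < R" "R < D" and r: "0 < r" "r \<le> R / 2" "r < c * step_ratio * R / 4"
  shows "1 \<le> real (card (E \<inter> cball x R)) * real M * (4 / (c\<^sup>2 * step_ratio) * (r / R)) powr s"
proof -
  have "0 < R / 2" "R / 2 < D" using R by auto
  then obtain u where u: "u \<in> words N" "u \<noteq> []" "x \<in> f u ` F" "diameter (f u ` F) \<le> R / 2"
      "R / 2 < diameter (f (butlast u) ` F)"
    by (rule ex_cylinder[OF x])
  have Lu: "0 < L u" using u(1) by (rule L_pos)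
  \<comment> \<open>An upper bound for \<open>2 * r / (c * L u)\<close>, which bounds the diameter
    of a pulled back net ball; it uses that \<open>L u\<close> is at least
    \<open>step_ratio * R / (2 * D)\<close>.\<close>
  define \<rho> where "\<rho> = 4 * D * r / (c * step_ratio * R)"
  have \<rho>: "0 < \<rho>" "\<rho> < D"
  proof -
    show "0 < \<rho>" using D_pos r c_pos step_ratio_pos R by (simp add: \<rho>_def)
    have "4 * D * r < D * (c * step_ratio * R)" using mult_strict_left_mono[OF r(3) D_pos] by simp
    then show "\<rho> < D" using c_pos step_ratio_pos R by (simp add: \<rho>_def pos_divide_less_eq)
  qed
  have L_ge: "2 * r / (c * L u) \<le> \<rho>"
  proof -
    have "step_ratio / D * (R / 2) \<le> L u" by (rule cylinder_L_bounds(1)[OF u(1,2,4,5)])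
    then have "2 * r / (c * L u) \<le> 2 * r / (c * (step_ratio / D * (R / 2)))"
      using c_pos step_ratio_pos R r D_pos by (intro divide_left_mono mult_left_mono mult_pos_pos Lu) auto
    also have "\<dots> = \<rho>" by (simp add: \<rho>_def mult_ac)
    finally show ?thesis .
  qed
  have "F \<subseteq> (\<Union>e\<in>E \<inter> cball x R. {y\<in>F. f u y \<in> cball e r})"
  proof
    fix y assume y: "y \<in> F"
    then have "f u y \<in> F" by (rule f_in_F[OF u(1)])
    then obtain e where e: "e \<in> E" "f u y \<in> cball e r"
      using E(2) by blast
    have "dist x (f u y) \<le> R / 2"
      using diameter_bounded_bound[OF bounded_f_image[OF u(1)] u(3), of "f u y"] y u(4) by simp
    then have "e \<in> cball x R" using e(2) r(2) dist_triangle2[of x e "f u y"] by simp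
    then show "y \<in> (\<Union>e\<in>E \<inter> cball x R. {y\<in>F. f u y \<in> cball e r})" using e y by blast
  qed
  moreover have "dist y z \<le> \<rho>" if "y \<in> {y\<in>F. f u y \<in> cball e r}" "z \<in> {y\<in>F. f u y \<in> cball e r}" for e y z
  proof -
    have "c * L u * dist y z \<le> dist (f u y) (f u z)"
      using lower[OF u(1), of y z] that by (simp add: dist_real_def)
    also have "\<dots> \<le> 2 * r" using that dist_triangle3[of "f u y" "f u z" e] by simp
    finally have "dist y z \<le> 2 * r / (c * L u)"
      using c_pos Lu by (simp add: pos_le_divide_eq mult_ac)
    then show ?thesis using L_ge by linarith
  qed
  ultimately have "1 \<le> real (card (E \<inter> cball x R)) * real M * (\<rho> / (c * D)) powr s"
    using E(1) \<rho> by (intro card_cover_ge[OF M]) auto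
  also have "\<rho> / (c * D) = 4 / (c\<^sup>2 * step_ratio) * (r / R)"
    using D_pos by (simp add: \<rho>_def power2_eq_square)
  finally show ?thesis .
qed

text \<open>The share of net points in a ball is a local count divided by the global one. These are
  of order \<open>(R / r n) powr s\<close> and \<open>r n powr (- s)\<close>, so the ratio is of
  order \<open>R powr s\<close> for all large \<open>n\<close>.\<close>

lemma ahlfors_regular_of_weak_separation:
  assumes "weak_separation N \<phi> F"
  shows "ahlfors_regular s F"
proof -
  obtain M where M: "\<forall>x\<in>F. \<forall>r>0. finite (scale_maps N \<phi> F x r) \<and> card (scale_maps N \<phi> F x r) \<le> M"
    using assms unfolding weak_separation_def by blast
  \<comment> \<open>Starting at \<open>D / 4\<close> gives \<open>2 * r n < D\<close> for all
    \<open>n\<close>, as required for net balls, whose diameter may reach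
    \<open>2 * r n\<close>.\<close>
  define r where "r n = D / 2 ^ Suc (Suc n)" for n
  have r: "0 < r n" "2 * r n < D" for n
  proof -
    show "0 < r n" using D_pos by (simp add: r_def)
    have "(1::real) \<le> 2 ^ n" by simp
    then have "(2::real) < 2 ^ Suc (Suc n)" unfolding power_Suc by linarith
    then have "D * 2 < D * (2 ^ Suc (Suc n))" using D_pos by (rule mult_strict_left_mono)
    then show "2 * r n < D" by (simp add: r_def pos_divide_less_eq)
  qed
  have "r \<longlonglongrightarrow> 0"
  proof -
    have "(\<lambda>n. D * (1/2) ^ Suc (Suc n)) \<longlonglongrightarrow> D * 0"
      by (intro tendsto_mult tendsto_const LIMSEQ_Suc LIMSEQ_power_zero) auto
    then show ?thesis by (simp add: r_def[abs_def] power_divide)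
  qed
  then have small: "eventually (\<lambda>n. r n < e) sequentially" if "0 < e" for e
    using that by (rule order_tendstoD(2))
  have "\<exists>S. S \<subseteq> F \<and> finite S \<and> separated_set (r n) S \<and> F \<subseteq> (\<Union>y\<in>S. cball y (r n))" for n
    using ex_maximal_separated_set[OF bounded_F r(1)[of n]] by metis
  then obtain E where E: "\<And>n. E n \<subseteq> F" "\<And>n. finite (E n)" "\<And>n. separated_set (r n) (E n)"
      "\<And>n. F \<subseteq> (\<Union>y\<in>E n. cball y (r n))"
    by metis
  have E_ne: "E n \<noteq> {}" for n
    using E(4)[of n] F_nonempty by auto
  have card_pos: "0 < real (card (E n))" for n
    using E(2) E_ne by (simp add: card_gt_0_iff)
  have card_ge: "1 \<le> real (card (E n)) * real M * (2 * r n / (c * D)) powr s" for n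
  proof (rule card_cover_ge[OF M E(2) E(4)])
    fix e y z assume "y \<in> cball e (r n)" "z \<in> cball e (r n)"
    then show "dist y z \<le> 2 * r n" using dist_triangle3[of y z e] by simp
  qed (use r in auto)
  have "M \<noteq> 0" using card_ge[of 0] by (cases "M = 0") auto
  then have M_pos: "0 < real M" by simp
  have card_le: "real (card (E n)) * (cell_ratio * r n) powr s \<le> (1 / c) powr s" for n
    using E r[of n] by (intro card_separated_F_le) auto
  \<comment> \<open>\<open>C1\<close> and \<open>C2\<close> govern the local counts from above and
    below; \<open>cu\<close> and \<open>cl\<close> combine them with the global bounds
    \<open>card_ge\<close> and \<open>card_le\<close>.\<close>
  define C1 where "C1 = (real M + 1) * (2 / (c\<^sup>2 * cell_ratio * D)) powr s"
  define cu where "cu = C1 * (real M * (2 / (c * D)) powr s)"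
  define C2 where "C2 = real M * (4 / (c\<^sup>2 * step_ratio)) powr s"
  define cl where "cl = (c * cell_ratio) powr s / C2"
  have C: "0 < C1" "0 < C2"
    using M_pos c_pos cell_ratio_pos step_ratio_pos D_pos by (auto simp: C1_def C2_def)
  show ?thesis
  proof (rule ahlfors_regularI_nets[OF compact_F F_nonempty E(2) E_ne E(1), where cl = cl and cu = cu])
    show "0 < cl" "0 < cu" "0 < s"
      using C M_pos c_pos D_pos cell_ratio_pos dim_pos by (auto simp: cl_def cu_def)
  next
    fix x R assume x: "x \<in> F" and R: "0 < R" "R < D"
    show "eventually (\<lambda>n. real (card (E n \<inter> cball x R)) / real (card (E n)) \<le> cu * R powr s) sequentially"
      using small[OF R(1)]
    proof eventually_elim
      case (elim n)
      have "real (card (E n \<inter> cball x R)) \<le> C1 * (R / r n) powr s"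
        unfolding C1_def using E[of n] elim r[of n] R
        by (intro card_separated_ball_le[OF M x]) (auto intro: separated_set_subset)
      also have "\<dots> \<le> C1 * (R / r n) powr s * (real (card (E n)) * real M * (2 * r n / (c * D)) powr s)"
        using mult_left_mono[OF card_ge[of n], of "C1 * (R / r n) powr s"] C by simp
      also have "\<dots> = cu * R powr s * real (card (E n))"
      proof -
        have "(R / r n) powr s * (2 * r n / (c * D)) powr s = (2 / (c * D)) powr s * R powr s"
          using r(1)[of n] by (simp add: powr_mult[symmetric] mult_ac)
        then show ?thesis by (simp add: cu_def mult_ac)
      qed
      finally show ?case using card_pos[of n] by (simp add: pos_divide_le_eq)
    qed
  next
    fix x R assume x: "x \<in> F" and R: "0 < R" "R < D"
    have "0 < R / 2" "0 < c * step_ratio * R / 4" using R c_pos step_ratio_pos by auto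
    from small[OF this(1)] small[OF this(2)]
    show "eventually (\<lambda>n. cl * R powr s \<le> real (card (E n \<inter> cball x R)) / real (card (E n))) sequentially"
    proof eventually_elim
      case (elim n)
      have "1 \<le> real (card (E n \<inter> cball x R)) * real M * (4 / (c\<^sup>2 * step_ratio) * (r n / R)) powr s"
        using elim r[of n] by (intro card_net_ball_ge[OF M E(2) E(4) x R]) auto
      also have "\<dots> = real (card (E n \<inter> cball x R)) * C2 * (r n / R) powr s"
        by (simp only: C2_def powr_mult mult_ac)
      finally have ge: "(R / r n) powr s / C2 \<le> real (card (E n \<inter> cball x R))"
      proof -
        assume 1: "1 \<le> real (card (E n \<inter> cball x R)) * C2 * (r n / R) powr s"
        have "(R / r n) powr s * 1 \<le> (R / r n) powr s * (real (card (E n \<inter> cball x R)) * C2 * (r n / R) powr s)"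
          using 1 by (intro mult_left_mono) auto
        also have "\<dots> = real (card (E n \<inter> cball x R)) * C2 * ((R / r n) powr s * (r n / R) powr s)"
          by (simp only: mult_ac)
        also have "(R / r n) powr s * (r n / R) powr s = 1"
          using R r(1)[of n] by (simp add: powr_mult[symmetric])
        finally show ?thesis using C by (simp add: pos_divide_le_eq)
      qed
      have "cl * R powr s * real (card (E n)) = (R / r n) powr s / C2 * (c powr s * (real (card (E n)) * (cell_ratio * r n) powr s))"
        using R r(1)[of n] c_pos cell_ratio_pos by (simp add: cl_def powr_mult powr_divide)
      also have "\<dots> \<le> (R / r n) powr s / C2 * (c powr s * (1 / c) powr s)"
        using card_le[of n] C by (intro mult_left_mono) auto
      also have "\<dots> = (R / r n) powr s / C2" using c_pos by (simp add: powr_mult[symmetric])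
      also note ge
      finally show ?case using card_pos[of n] by (simp add: pos_le_divide_eq)
    qed
  qed
qed

end

section \<open>Distortion of conformal iterated function systems\<close>

locale conformal_system =
  fixes N :: nat and \<phi> :: "nat \<Rightarrow> real \<Rightarrow> real" and \<Omega> F :: "real set"
  assumes self_conformal: "self_conformal_set N \<phi> \<Omega> F"
    and two_points: "\<exists>x\<in>F. \<exists>y\<in>F. x \<noteq> y"
begin

abbreviation "f \<equiv> word_map \<phi>"

abbreviation "L w \<equiv> deriv_norm \<Omega> (f w)"

abbreviation "f' w \<equiv> deriv (f w)"

lemma compact_F: "compact F" and F_\<Omega>: "F \<subseteq> \<Omega>" and invariant: "F = (\<Union>i\<in>{1..N}. \<phi> i ` F)"
  using self_conformal unfolding self_conformal_set_def by blast+

lemma conformal: "conformal_ifs N \<phi> \<Omega>"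
  using self_conformal unfolding self_conformal_set_def by blast

lemma \<Omega>: "\<Omega> \<noteq> {}" "bounded \<Omega>" "open \<Omega>" "convex \<Omega>"
  using conformal unfolding conformal_ifs_def by blast+

lemma N_pos: "finite {1..N}" "{1..N} \<noteq> {}"
  using conformal unfolding conformal_ifs_def by auto

lemma map_conformal:
  assumes "i \<in> {1..N}"
  shows "conformal_on (\<phi> i) \<Omega>" "closure (\<phi> i ` \<Omega>) \<subseteq> \<Omega>" "deriv_norm \<Omega> (\<phi> i) < 1"
proof -
  have "\<forall>i\<in>{1..N}. conformal_on (\<phi> i) \<Omega> \<and> inj_on (\<phi> i) \<Omega> \<and> closure (\<phi> i ` \<Omega>) \<subseteq> \<Omega> \<and> deriv_norm \<Omega> (\<phi> i) < 1"
    using conformal unfolding conformal_ifs_def by (elim conjE)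
  from bspec[OF this assms]
  show "conformal_on (\<phi> i) \<Omega>" "closure (\<phi> i ` \<Omega>) \<subseteq> \<Omega>" "deriv_norm \<Omega> (\<phi> i) < 1" by simp_all
qed

lemma map_in_\<Omega>: "i \<in> {1..N} \<Longrightarrow> x \<in> \<Omega> \<Longrightarrow> \<phi> i x \<in> \<Omega>"
  by (rule subsetD[OF map_conformal(2)], assumption, rule subsetD[OF closure_subset]) simp

lemma map_DERIV:
  assumes "i \<in> {1..N}" "x \<in> \<Omega>"
  shows "(\<phi> i has_real_derivative deriv (\<phi> i) x) (at x)" "deriv (\<phi> i) x \<noteq> 0"
proof -
  have "\<phi> i differentiable (at x)"
    using map_conformal(1)[OF assms(1)] assms(2) unfolding conformal_on_def C1_differentiable_on_eq by blast
  then show "(\<phi> i has_real_derivative deriv (\<phi> i) x) (at x)"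
    by (simp add: DERIV_deriv_iff_real_differentiable)
  show "deriv (\<phi> i) x \<noteq> 0"
    using map_conformal(1)[OF assms(1)] assms(2) unfolding conformal_on_def by blast
qed

text \<open>The maps come with different exponents. On the bounded \<open>\<Omega>\<close> the
  smallest one serves all of them, since the surplus power of \<open>\<bar>x - y\<bar>\<close> is
  bounded.\<close>

lemma ex_uniform_holder:
  "\<exists>\<alpha>>0. \<exists>C>0. \<forall>i\<in>{1..N}. \<forall>x\<in>\<Omega>. \<forall>y\<in>\<Omega>. \<bar>deriv (\<phi> i) x - deriv (\<phi> i) y\<bar> \<le> C * \<bar>x - y\<bar> powr \<alpha>"
proof -
  have "\<forall>i\<in>{1..N}. \<exists>p. 0 < fst p \<and> 0 < snd p \<and>
      (\<forall>x\<in>\<Omega>. \<forall>y\<in>\<Omega>. \<bar>deriv (\<phi> i) x - deriv (\<phi> i) y\<bar> \<le> snd p * \<bar>x - y\<bar> powr fst p)"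
    using map_conformal(1) unfolding conformal_on_def by (metis fst_conv snd_conv)
  from bchoice[OF this] obtain p where p: "\<forall>i\<in>{1..N}. 0 < fst (p i) \<and> 0 < snd (p i) \<and>
      (\<forall>x\<in>\<Omega>. \<forall>y\<in>\<Omega>. \<bar>deriv (\<phi> i) x - deriv (\<phi> i) y\<bar> \<le> snd (p i) * \<bar>x - y\<bar> powr fst (p i))"
    by (elim exE)
  define \<alpha> where "\<alpha> = Min ((\<lambda>i. fst (p i)) ` {1..N})"
  define d where "d = diameter \<Omega>"
  define C where "C = Max ((\<lambda>i. snd (p i) * (d + 1) powr (fst (p i) - \<alpha>)) ` {1..N})"
  have d: "0 \<le> d" unfolding d_def by (rule diameter_ge_0[OF \<Omega>(2)])
  have "\<alpha> \<in> (\<lambda>i. fst (p i)) ` {1..N}" unfolding \<alpha>_def using N_pos by (intro Min_in) auto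
  then have "0 < \<alpha>" using p by auto
  have "C \<in> (\<lambda>i. snd (p i) * (d + 1) powr (fst (p i) - \<alpha>)) ` {1..N}"
    unfolding C_def using N_pos by (intro Max_in) auto
  then have "0 < C" using p d by auto
  have "\<bar>deriv (\<phi> i) x - deriv (\<phi> i) y\<bar> \<le> C * \<bar>x - y\<bar> powr \<alpha>"
    if i: "i \<in> {1..N}" and xy: "x \<in> \<Omega>" "y \<in> \<Omega>" for i x y
  proof -
    have pi: "0 < snd (p i)" "\<bar>deriv (\<phi> i) x - deriv (\<phi> i) y\<bar> \<le> snd (p i) * \<bar>x - y\<bar> powr fst (p i)"
      using bspec[OF p i] xy by blast+
    have "\<alpha> \<le> fst (p i)" unfolding \<alpha>_def using N_pos(1) i by (intro Min_le) auto
    then have "\<bar>x - y\<bar> powr (fst (p i) - \<alpha>) \<le> (d + 1) powr (fst (p i) - \<alpha>)"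
      using diameter_bounded_bound[OF \<Omega>(2) xy] by (intro powr_mono2) (auto simp: d_def dist_real_def)
    then have "snd (p i) * \<bar>x - y\<bar> powr (fst (p i) - \<alpha>) \<le> snd (p i) * (d + 1) powr (fst (p i) - \<alpha>)"
      using pi(1) by (intro mult_left_mono) auto
    also have "\<dots> \<le> C" unfolding C_def using N_pos(1) i by (intro Max_ge) auto
    finally have "snd (p i) * \<bar>x - y\<bar> powr (fst (p i) - \<alpha>) * \<bar>x - y\<bar> powr \<alpha> \<le> C * \<bar>x - y\<bar> powr \<alpha>"
      by (intro mult_right_mono) auto
    then show ?thesis using pi(2) by (simp add: mult.assoc powr_add[symmetric])
  qed
  then show ?thesis using \<open>0 < \<alpha>\<close> \<open>0 < C\<close> by blast
qed

lemma continuous_on_deriv: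
  assumes "i \<in> {1..N}"
  shows "continuous_on \<Omega> (deriv (\<phi> i))"
  using map_conformal(1)[OF assms]
  by (simp add: conformal_on_def C1_differentiable_on_eq field_derivative_eq_vector_derivative[abs_def])

lemma abs_deriv_map_le:
  assumes "i \<in> {1..N}" "x \<in> \<Omega>"
  shows "\<bar>deriv (\<phi> i) x\<bar> \<le> deriv_norm \<Omega> (\<phi> i)"
proof -
  obtain \<alpha> C where \<alpha>: "0 < \<alpha>" "0 < C"
    "\<forall>i\<in>{1..N}. \<forall>x\<in>\<Omega>. \<forall>y\<in>\<Omega>. \<bar>deriv (\<phi> i) x - deriv (\<phi> i) y\<bar> \<le> C * \<bar>x - y\<bar> powr \<alpha>"
    using ex_uniform_holder by (elim exE conjE)
  have "\<bar>deriv (\<phi> i) y\<bar> \<le> \<bar>deriv (\<phi> i) x\<bar> + C * diameter \<Omega> powr \<alpha>" if y: "y \<in> \<Omega>" for y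
  proof -
    have "\<bar>deriv (\<phi> i) y - deriv (\<phi> i) x\<bar> \<le> C * \<bar>y - x\<bar> powr \<alpha>" using \<alpha>(3) assms y by blast
    also have "\<dots> \<le> C * diameter \<Omega> powr \<alpha>"
      using \<alpha> diameter_bounded_bound[OF \<Omega>(2) y assms(2)]
      by (intro mult_left_mono powr_mono2) (auto simp: dist_real_def)
    finally show ?thesis by linarith
  qed
  then show ?thesis unfolding deriv_norm_def using assms(2) by (intro cSUP_upper bdd_aboveI2)
qed

definition contraction :: real where
  "contraction = Max ((\<lambda>i. deriv_norm \<Omega> (\<phi> i)) ` {1..N})"

lemma contraction: "0 < contraction" "contraction < 1"
  "\<And>i x. i \<in> {1..N} \<Longrightarrow> x \<in> \<Omega> \<Longrightarrow> \<bar>deriv (\<phi> i) x\<bar> \<le> contraction"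
proof -
  show le: "\<bar>deriv (\<phi> i) x\<bar> \<le> contraction" if "i \<in> {1..N}" "x \<in> \<Omega>" for i x
  proof -
    have "deriv_norm \<Omega> (\<phi> i) \<le> contraction"
      unfolding contraction_def using N_pos(1) that by (intro Max_ge) auto
    then show ?thesis using abs_deriv_map_le[OF that] by linarith
  qed
  have "contraction \<in> (\<lambda>i. deriv_norm \<Omega> (\<phi> i)) ` {1..N}"
    unfolding contraction_def using N_pos by (intro Max_in) auto
  then show "contraction < 1" using map_conformal(3) by (elim imageE) simp
  obtain i x where "i \<in> {1..N}" "x \<in> \<Omega>"
    using N_pos(2) \<Omega>(1) by blast
  then show "0 < contraction" using le[of i x] map_DERIV(2)[of i x] by linarith
qed

text \<open>
  The derivatives may degenerate at the boundary of \<open>\<Omega>\<close>, so distortion is controlled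
  on a compact interval containing all first level images.
\<close>

definition core :: "real set" where
  "core = convex hull (\<Union>i\<in>{1..N}. closure (\<phi> i ` \<Omega>))"

lemma core: "compact core" "convex core" "core \<subseteq> \<Omega>" "core \<noteq> {}"
  "\<And>i x. i \<in> {1..N} \<Longrightarrow> x \<in> \<Omega> \<Longrightarrow> \<phi> i x \<in> core"
proof -
  have "compact (closure (\<phi> i ` \<Omega>))" if "i \<in> {1..N}" for i
    using bounded_subset[OF \<Omega>(2) map_conformal(2)[OF that]] by (simp add: compact_eq_bounded_closed)
  then show "compact core" unfolding core_def by (intro compact_convex_hull compact_UN) auto
  show "convex core" unfolding core_def by (rule convex_convex_hull)
  show "core \<subseteq> \<Omega>" unfolding core_def by (intro hull_minimal UN_least map_conformal(2) \<Omega>(4))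
  show mem: "\<phi> i x \<in> core" if "i \<in> {1..N}" "x \<in> \<Omega>" for i x
  proof -
    have "\<phi> i x \<in> closure (\<phi> i ` \<Omega>)" using that(2) by (intro subsetD[OF closure_subset] imageI)
    then show ?thesis unfolding core_def using that(1) by (intro hull_inc UN_I[of i])
  qed
  show "core \<noteq> {}"
  proof -
    obtain i x where "i \<in> {1..N}" "x \<in> \<Omega>"
      using N_pos(2) \<Omega>(1) by blast
    then show ?thesis using mem[of i x] by blast
  qed
qed

lemma F_core: "F \<subseteq> core"
proof
  fix x assume "x \<in> F"
  then have "x \<in> (\<Union>i\<in>{1..N}. \<phi> i ` F)" using invariant by simp
  then obtain i y where "i \<in> {1..N}" "y \<in> F" "x = \<phi> i y"
    by (elim UN_E imageE)
  then show "x \<in> core" using core(5)[of i y] subsetD[OF F_\<Omega>] by simp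
qed

lemma ex_deriv_lower_bound: "\<exists>m>0. \<forall>i\<in>{1..N}. \<forall>x\<in>core. m \<le> \<bar>deriv (\<phi> i) x\<bar>"
proof -
  have "\<forall>i\<in>{1..N}. \<exists>m>0. \<forall>x\<in>core. m \<le> \<bar>deriv (\<phi> i) x\<bar>"
  proof
    fix i assume i: "i \<in> {1..N}"
    have "continuous_on core (\<lambda>x. \<bar>deriv (\<phi> i) x\<bar>)"
      by (intro continuous_intros continuous_on_subset[OF continuous_on_deriv[OF i] core(3)])
    then obtain z where "z \<in> core" "\<forall>x\<in>core. \<bar>deriv (\<phi> i) z\<bar> \<le> \<bar>deriv (\<phi> i) x\<bar>"
      using continuous_attains_inf[OF core(1,4)] by blast
    moreover from this have "0 < \<bar>deriv (\<phi> i) z\<bar>"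
      using map_DERIV(2)[OF i] core(3) by auto
    ultimately show "\<exists>m>0. \<forall>x\<in>core. m \<le> \<bar>deriv (\<phi> i) x\<bar>" by blast
  qed
  from bchoice[OF this] obtain m where m: "\<forall>i\<in>{1..N}. 0 < m i \<and> (\<forall>x\<in>core. m i \<le> \<bar>deriv (\<phi> i) x\<bar>)"
    by (elim exE)
  have "Min (m ` {1..N}) \<in> m ` {1..N}" using N_pos by (intro Min_in) auto
  then obtain j where "j \<in> {1..N}" "Min (m ` {1..N}) = m j"
    by (elim imageE)
  then have "0 < Min (m ` {1..N})" using bspec[OF m, of j] by simp
  moreover have "Min (m ` {1..N}) \<le> \<bar>deriv (\<phi> i) x\<bar>" if "i \<in> {1..N}" "x \<in> core" for i x
  proof -
    have "Min (m ` {1..N}) \<le> m i" using N_pos(1) that(1) by (intro Min_le) simp_all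
    also have "m i \<le> \<bar>deriv (\<phi> i) x\<bar>" using bspec[OF m that(1)] that(2) by blast
    finally show ?thesis .
  qed
  ultimately show ?thesis by blast
qed

section \<open>Derivatives of word maps\<close>

lemma word_in_\<Omega>: "w \<in> words N \<Longrightarrow> x \<in> \<Omega> \<Longrightarrow> f w x \<in> \<Omega>"
  by (induction w) (auto intro: map_in_\<Omega>)

lemma word_in_core: "w \<in> words N \<Longrightarrow> x \<in> core \<Longrightarrow> f w x \<in> core"
  by (induction w) (simp_all add: core(5) subsetD[OF core(3)])

lemma word_DERIV: "w \<in> words N \<Longrightarrow> x \<in> \<Omega> \<Longrightarrow> (f w has_real_derivative f' w x) (at x)"
proof (induction w)
  case Nil
  have "((\<lambda>x. x) has_real_derivative 1) (at x)" by (rule DERIV_ident)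
  then have "(f [] has_real_derivative 1) (at x)" by (simp add: id_def)
  then show ?case by (simp only: DERIV_imp_deriv)
next
  case (Cons i w)
  then have iw: "i \<in> {1..N}" "w \<in> words N" by auto
  have "(\<phi> i \<circ> f w has_real_derivative deriv (\<phi> i) (f w x) * f' w x) (at x)"
    using Cons.IH[OF iw(2) Cons.prems(2)] map_DERIV(1)[OF iw(1) word_in_\<Omega>[OF iw(2) Cons.prems(2)]]
    by (rule DERIV_chain[rotated])
  then show ?case by (simp only: word_map.simps DERIV_imp_deriv)
qed

lemma deriv_word_append:
  assumes "u \<in> words N" "v \<in> words N" "x \<in> \<Omega>"
  shows "f' (u @ v) x = f' u (f v x) * f' v x"
  unfolding word_map_append
  by (rule DERIV_imp_deriv[OF DERIV_chain[OF word_DERIV[OF assms(1) word_in_\<Omega>[OF assms(2,3)]] word_DERIV[OF assms(2,3)]]])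

lemma deriv_word_Nil: "f' [] x = 1"
  by (simp add: id_def)

lemma deriv_word_Cons:
  assumes "i \<in> {1..N}" "w \<in> words N" "x \<in> \<Omega>"
  shows "f' (i # w) x = deriv (\<phi> i) (f w x) * f' w x"
  using deriv_word_append[of "[i]" w x] assms by simp

lemma deriv_word_bounds:
  "w \<in> words N \<Longrightarrow> x \<in> \<Omega> \<Longrightarrow> f' w x \<noteq> 0 \<and> \<bar>f' w x\<bar> \<le> contraction ^ length w"
proof (induction w)
  case Nil
  then show ?case by (simp add: deriv_word_Nil del: word_map.simps)
next
  case (Cons i w)
  then have iw: "i \<in> {1..N}" "w \<in> words N" by auto
  have y: "f w x \<in> \<Omega>" by (rule word_in_\<Omega>[OF iw(2) Cons.prems(2)])
  have "\<bar>deriv (\<phi> i) (f w x)\<bar> * \<bar>f' w x\<bar> \<le> contraction * contraction ^ length w"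
    using Cons.IH[OF iw(2) Cons.prems(2)] contraction(3)[OF iw(1) y] contraction(1) by (intro mult_mono) auto
  then show ?case
    using Cons.IH[OF iw(2) Cons.prems(2)] map_DERIV(2)[OF iw(1) y] deriv_word_Cons[OF iw Cons.prems(2)]
    by (simp add: abs_mult del: word_map.simps)
qed

lemma L_bounds:
  assumes w: "w \<in> words N"
  shows "x \<in> \<Omega> \<Longrightarrow> \<bar>f' w x\<bar> \<le> L w" "0 < L w" "L w \<le> contraction ^ length w"
proof -
  show le: "\<bar>f' w x\<bar> \<le> L w" if "x \<in> \<Omega>" for x
    unfolding deriv_norm_def using that deriv_word_bounds[OF w]
    by (intro cSUP_upper bdd_aboveI2[of _ _ "contraction ^ length w"]) blast+
  obtain x where x: "x \<in> \<Omega>"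
    using \<Omega>(1) by blast
  show "0 < L w" using le[OF x] deriv_word_bounds[OF w x] by linarith
  show "L w \<le> contraction ^ length w"
    unfolding deriv_norm_def using \<Omega>(1) deriv_word_bounds[OF w] by (intro cSUP_least) blast+
qed

lemma word_mean_value:
  assumes w: "w \<in> words N" and xy: "x \<in> \<Omega>" "y \<in> \<Omega>" "x \<noteq> y"
  obtains \<xi> where "\<xi> \<in> closed_segment x y"
    "f w x - f w y = f' w \<xi> * (x - y)"
proof -
  have *: "\<exists>\<xi>. \<xi> \<in> closed_segment a b \<and> f w b - f w a = (b - a) * f' w \<xi>"
    if ab: "a < b" "a \<in> \<Omega>" "b \<in> \<Omega>" for a b
  proof -
    have sub: "closed_segment a b \<subseteq> \<Omega>" using ab \<Omega>(4) by (simp add: closed_segment_subset)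
    obtain z where "a < z" "z < b" "f w b - f w a = (b - a) * f' w z"
    proof (rule MVT2[OF ab(1), THEN exE])
      fix z assume "a \<le> z" "z \<le> b"
      then have "z \<in> \<Omega>" using sub ab(1) by (auto simp: closed_segment_eq_real_ivl)
      then show "(f w has_real_derivative f' w z) (at z)" by (rule word_DERIV[OF w])
    qed blast
    then show ?thesis using ab(1) by (intro exI[of _ z]) (auto simp: closed_segment_eq_real_ivl)
  qed
  show thesis
  proof (cases "x < y")
    case True
    then obtain \<xi> where "\<xi> \<in> closed_segment x y" "f w y - f w x = (y - x) * f' w \<xi>"
      using * xy by blast
    then show thesis by (intro that[of \<xi>]) (auto simp: algebra_simps)
  next
    case False
    then have "y < x" using xy(3) by simp
    then obtain \<xi> where "\<xi> \<in> closed_segment y x" "f w x - f w y = (x - y) * f' w \<xi>"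
      using * xy by blast
    then show thesis by (intro that[of \<xi>]) (auto simp: closed_segment_commute mult.commute)
  qed
qed

lemma word_contracts:
  assumes "w \<in> words N" "x \<in> \<Omega>" "y \<in> \<Omega>"
  shows "\<bar>f w x - f w y\<bar> \<le> contraction ^ length w * \<bar>x - y\<bar>"
proof (cases "x = y")
  case False
  then obtain \<xi> where \<xi>: "\<xi> \<in> closed_segment x y"
    "f w x - f w y = f' w \<xi> * (x - y)"
    using word_mean_value[OF assms] by blast
  have "\<xi> \<in> \<Omega>" using \<xi>(1) closed_segment_subset[OF assms(2,3) \<Omega>(4)] by blast
  then show ?thesis
    unfolding \<xi>(2) abs_mult using deriv_word_bounds[OF assms(1)] by (intro mult_right_mono) auto
qed simp

text \<open>Bounded distortion in a quantitative form that vanishes as \<open>x\<close> approaches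
  \<open>y\<close>. The shape \<open>exp a - 1\<close> of relative errors is stable under products:
  the errors of successive letters add up in the exponent, and contraction makes them a geometric
  series.\<close>

lemma ex_distortion:
  "\<exists>\<alpha>>0. \<exists>Q>0. \<forall>w\<in>words N. \<forall>x\<in>core. \<forall>y\<in>core.
     \<bar>f' w x - f' w y\<bar> \<le> (exp (Q * \<bar>x - y\<bar> powr \<alpha>) - 1) * \<bar>f' w y\<bar>"
proof -
  obtain \<alpha> C where \<alpha>: "0 < \<alpha>" "0 < C" and hold:
    "\<forall>i\<in>{1..N}. \<forall>x\<in>\<Omega>. \<forall>y\<in>\<Omega>. \<bar>deriv (\<phi> i) x - deriv (\<phi> i) y\<bar> \<le> C * \<bar>x - y\<bar> powr \<alpha>"
    using ex_uniform_holder by (elim exE conjE)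
  obtain m where m: "0 < m" "\<forall>i\<in>{1..N}. \<forall>x\<in>core. m \<le> \<bar>deriv (\<phi> i) x\<bar>"
    using ex_deriv_lower_bound by (elim exE conjE)
  define q where "q = C / m"
  define k where "k = contraction powr \<alpha>"
  have q: "0 < q" using \<alpha> m by (simp add: q_def)
  have k: "0 < k" "k < 1"
    using contraction(1,2) \<alpha>(1) powr_less_mono2[of \<alpha> contraction 1] by (auto simp: k_def)
  \<comment> \<open>The exponent keeps the partial sum so that the induction closes: a new first
    letter acts on points already contracted by \<open>f w\<close> and contributes the term
    \<open>k ^ length w\<close>.\<close>
  have step: "\<bar>f' w x - f' w y\<bar>
      \<le> (exp (q * (\<Sum>j<length w. k ^ j) * \<bar>x - y\<bar> powr \<alpha>) - 1) * \<bar>f' w y\<bar>"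
    if "w \<in> words N" and xy: "x \<in> core" "y \<in> core" for w x y
    using that(1)
  proof (induction w)
    case Nil
    show ?case by (simp add: deriv_word_Nil del: word_map.simps)
  next
    case (Cons i w)
    then have iw: "i \<in> {1..N}" "w \<in> words N" by auto
    have xy\<Omega>: "x \<in> \<Omega>" "y \<in> \<Omega>" using xy core(3) by auto
    define x' y' where "x' = f w x" and "y' = f w y"
    have x'y': "x' \<in> core" "y' \<in> core" "x' \<in> \<Omega>" "y' \<in> \<Omega>"
      using word_in_core[OF iw(2)] xy core(3) by (auto simp: x'_def y'_def)
    define a where "a = q * k ^ length w * \<bar>x - y\<bar> powr \<alpha>"
    define b where "b = q * (\<Sum>j<length w. k ^ j) * \<bar>x - y\<bar> powr \<alpha>"
    define A A' B B' where "A = deriv (\<phi> i) x'" and "A' = deriv (\<phi> i) y'"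
      and "B = f' w x" and "B' = f' w y"
    have "0 \<le> a" "0 \<le> b" using q k by (auto simp: a_def b_def sum_nonneg)
    have B: "\<bar>B - B'\<bar> \<le> (exp b - 1) * \<bar>B'\<bar>" using Cons.IH by (simp add: B_def B'_def b_def)
    have "\<bar>x' - y'\<bar> powr \<alpha> \<le> (contraction ^ length w * \<bar>x - y\<bar>) powr \<alpha>"
      unfolding x'_def y'_def using word_contracts[OF iw(2) xy\<Omega>] \<alpha>(1) by (intro powr_mono2) auto
    also have "\<dots> = k ^ length w * \<bar>x - y\<bar> powr \<alpha>"
      using contraction(1) by (simp add: powr_mult k_def powr_power powr_realpow[symmetric] powr_powr mult.commute)
    finally have pw: "C * \<bar>x' - y'\<bar> powr \<alpha> \<le> C * (k ^ length w * \<bar>x - y\<bar> powr \<alpha>)"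
      using \<alpha>(2) by (intro mult_left_mono) auto
    have "\<bar>A - A'\<bar> \<le> C * \<bar>x' - y'\<bar> powr \<alpha>"
      using hold iw(1) x'y'(3,4) unfolding A_def A'_def by blast
    also have "\<dots> \<le> a * m" using pw m(1) by (simp add: a_def q_def)
    also have "\<dots> \<le> a * \<bar>A'\<bar>"
      using m(2) iw(1) x'y'(2) \<open>0 \<le> a\<close> by (intro mult_left_mono) (auto simp: A'_def)
    also have "\<dots> \<le> (exp a - 1) * \<bar>A'\<bar>"
      using exp_ge_add_one_self[of a] by (intro mult_right_mono) linarith+
    finally have A: "\<bar>A - A'\<bar> \<le> (exp a - 1) * \<bar>A'\<bar>" .
    \<comment> \<open>Expanding around \<open>A' * B'\<close>, the relative errors
      \<open>exp a - 1\<close> and \<open>exp b - 1\<close> combine exactly to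
      \<open>exp (a + b) - 1\<close>.\<close>
    have "A * B - A' * B' = (A - A') * (B - B') + (A - A') * B' + A' * (B - B')"
      by (simp add: algebra_simps)
    then have "\<bar>A * B - A' * B'\<bar> \<le> \<bar>A - A'\<bar> * \<bar>B - B'\<bar> + \<bar>A - A'\<bar> * \<bar>B'\<bar> + \<bar>A'\<bar> * \<bar>B - B'\<bar>"
      unfolding abs_mult[symmetric]
      using abs_triangle_ineq[of "(A - A') * (B - B') + (A - A') * B'" "A' * (B - B')"]
        abs_triangle_ineq[of "(A - A') * (B - B')" "(A - A') * B'"] by linarith
    also have "\<dots> \<le> ((exp a - 1) * \<bar>A'\<bar>) * ((exp b - 1) * \<bar>B'\<bar>) + ((exp a - 1) * \<bar>A'\<bar>) * \<bar>B'\<bar> + \<bar>A'\<bar> * ((exp b - 1) * \<bar>B'\<bar>)"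
      using A B \<open>0 \<le> a\<close> by (intro add_mono mult_mono) auto
    also have "\<dots> = (exp (a + b) - 1) * \<bar>A' * B'\<bar>" by (simp add: exp_add abs_mult algebra_simps)
    also have "a + b = q * (\<Sum>j<length (i # w). k ^ j) * \<bar>x - y\<bar> powr \<alpha>"
      by (simp add: a_def b_def algebra_simps)
    finally show ?case
      unfolding deriv_word_Cons[OF iw xy\<Omega>(1)] deriv_word_Cons[OF iw xy\<Omega>(2)]
      by (simp add: A_def A'_def B_def B'_def x'_def y'_def)
  qed
  define Q where "Q = q * (1 / (1 - k))"
  have "0 < Q" using q k by (simp add: Q_def)
  moreover have "\<bar>f' w x - f' w y\<bar> \<le> (exp (Q * \<bar>x - y\<bar> powr \<alpha>) - 1) * \<bar>f' w y\<bar>"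
    if "w \<in> words N" "x \<in> core" "y \<in> core" for w x y
  proof -
    have "(\<Sum>j<length w. k ^ j) \<le> (\<Sum>j. k ^ j)"
      using k by (intro sum_le_suminf) (auto simp: summable_geometric)
    also have "\<dots> = 1 / (1 - k)" using k by (simp add: suminf_geometric)
    finally have "q * (\<Sum>j<length w. k ^ j) * \<bar>x - y\<bar> powr \<alpha> \<le> Q * \<bar>x - y\<bar> powr \<alpha>"
      unfolding Q_def using q by (intro mult_right_mono mult_left_mono) auto
    then have "(exp (q * (\<Sum>j<length w. k ^ j) * \<bar>x - y\<bar> powr \<alpha>) - 1) * \<bar>f' w y\<bar>
        \<le> (exp (Q * \<bar>x - y\<bar> powr \<alpha>) - 1) * \<bar>f' w y\<bar>"
      by (intro mult_right_mono) auto
    then show ?thesis using step[OF that] by linarith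
  qed
  ultimately show ?thesis using \<alpha>(1) by blast
qed

text \<open>A continuous nonvanishing derivative has constant sign on the connected
  \<open>\<Omega>\<close>; the signs of the letters multiply.\<close>

lemma word_monotone:
  "w \<in> words N \<Longrightarrow> \<exists>\<sigma>\<in>{1,-1::real}. \<forall>x\<in>\<Omega>. \<forall>y\<in>\<Omega>. x < y \<longrightarrow> 0 < \<sigma> * (f w y - f w x)"
proof (induction w)
  case Nil
  show ?case by (rule bexI[of _ 1]) auto
next
  case (Cons i w)
  then have iw: "i \<in> {1..N}" "[i] \<in> words N" "w \<in> words N" by auto
  obtain \<sigma> where \<sigma>: "\<sigma> \<in> {1,-1::real}" "\<forall>x\<in>\<Omega>. \<forall>y\<in>\<Omega>. x < y \<longrightarrow> 0 < \<sigma> * (f w y - f w x)"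
    using Cons.IH[OF iw(3)] by blast
  have conn: "connected (deriv (\<phi> i) ` \<Omega>)"
    using continuous_on_deriv[OF iw(1)] convex_connected[OF \<Omega>(4)] by (rule connected_continuous_image)
  have "0 \<notin> deriv (\<phi> i) ` \<Omega>" using map_DERIV(2)[OF iw(1)] by auto
  have same: "\<not> (deriv (\<phi> i) x < 0 \<and> 0 < deriv (\<phi> i) y)" if "x \<in> \<Omega>" "y \<in> \<Omega>" for x y
  proof
    assume "deriv (\<phi> i) x < 0 \<and> 0 < deriv (\<phi> i) y"
    then have "0 \<in> {deriv (\<phi> i) x..deriv (\<phi> i) y}" by simp
    then show False
      using connected_contains_Icc[OF conn imageI[OF that(1)] imageI[OF that(2)]] \<open>0 \<notin> deriv (\<phi> i) ` \<Omega>\<close> by blast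
  qed
  obtain x0 where x0: "x0 \<in> \<Omega>"
    using \<Omega>(1) by blast
  define \<tau> where "\<tau> = sgn (deriv (\<phi> i) x0)"
  have \<tau>: "\<tau> \<in> {1,-1}" using map_DERIV(2)[OF iw(1) x0] by (auto simp: \<tau>_def sgn_if)
  have \<tau>_pos: "0 < \<tau> * deriv (\<phi> i) x" if "x \<in> \<Omega>" for x
    using same[OF x0 that] same[OF that x0] map_DERIV(2)[OF iw(1) x0] map_DERIV(2)[OF iw(1) that]
    by (auto simp: \<tau>_def sgn_if not_less less_le)
  have inc: "0 < \<tau> * (\<phi> i y - \<phi> i x)" if xy: "x \<in> \<Omega>" "y \<in> \<Omega>" "x < y" for x y
  proof -
    obtain \<xi> where \<xi>: "\<xi> \<in> closed_segment y x" "f [i] y - f [i] x = f' [i] \<xi> * (y - x)"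
      using word_mean_value[OF iw(2) xy(2,1)] xy(3) by auto
    have "\<xi> \<in> \<Omega>" using \<xi>(1) closed_segment_subset[OF xy(2,1) \<Omega>(4)] by blast
    then have "0 < (\<tau> * deriv (\<phi> i) \<xi>) * (y - x)" using \<tau>_pos xy(3) by simp
    then show ?thesis using \<xi>(2) by (simp add: mult.assoc)
  qed
  have "0 < \<tau> * \<sigma> * (f (i # w) y - f (i # w) x)" if xy: "x \<in> \<Omega>" "y \<in> \<Omega>" "x < y" for x y
  proof -
    have mem: "f w x \<in> \<Omega>" "f w y \<in> \<Omega>" using word_in_\<Omega>[OF iw(3)] xy by auto
    have pos: "0 < \<sigma> * (f w y - f w x)" using \<sigma>(2) xy by blast
    show ?thesis
    proof (cases "\<sigma> = 1")
      case True
      then show ?thesis using inc[OF mem] pos by simp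
    next
      case False
      then have "\<sigma> = -1" using \<sigma>(1) by simp
      then show ?thesis using inc[OF mem(2,1)] pos by (simp add: algebra_simps)
    qed
  qed
  moreover have "\<tau> * \<sigma> \<in> {1,-1}" using \<tau> \<sigma>(1) by auto
  ultimately show ?case by blast
qed

lemma ex_quasi_conformal: "\<exists>c \<alpha> H. quasi_conformal_ifs N \<phi> F L c contraction \<alpha> H"
proof -
  obtain \<alpha> Q where \<alpha>: "0 < \<alpha>" "0 < Q" and dist: "\<forall>w\<in>words N. \<forall>x\<in>core. \<forall>y\<in>core.
     \<bar>f' w x - f' w y\<bar> \<le> (exp (Q * \<bar>x - y\<bar> powr \<alpha>) - 1) * \<bar>f' w y\<bar>"
    using ex_distortion by (elim exE conjE)
  obtain m where m: "0 < m" "\<forall>i\<in>{1..N}. \<forall>x\<in>core. m \<le> \<bar>deriv (\<phi> i) x\<bar>"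
    using ex_deriv_lower_bound by (elim exE conjE)
  \<comment> \<open>\<open>Z\<close> bounds the distortion between points of \<open>core\<close>,
    and \<open>m\<close> pays for the one letter that moves points of \<open>\<Omega>\<close> into
    \<open>core\<close>. The form of \<open>H\<close> comes from
    \<open>exp t - 1 \<le> t * exp t\<close>.\<close>
  define Z where "Z = exp (Q * diameter core powr \<alpha>)"
  define c where "c = m / Z"
  define H where "H = Q * Z"
  have "1 \<le> Z" using \<alpha> by (simp add: Z_def)
  then have Z: "0 < Z" "1 \<le> Z" by auto
  have exp_le: "exp (Q * \<bar>x - y\<bar> powr \<alpha>) \<le> Z" if "x \<in> core" "y \<in> core" for x y
  proof -
    have "\<bar>x - y\<bar> powr \<alpha> \<le> diameter core powr \<alpha>"
      using diameter_bounded_bound[OF compact_imp_bounded[OF core(1)] that] \<alpha>(1)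
      by (intro powr_mono2) (auto simp: dist_real_def)
    then show ?thesis using \<alpha>(2) by (simp add: Z_def)
  qed
  have comparable: "\<bar>f' w x\<bar> \<le> Z * \<bar>f' w y\<bar>"
    if w: "w \<in> words N" and xy: "x \<in> core" "y \<in> core" for w x y
  proof -
    have "\<bar>f' w x\<bar> \<le> \<bar>f' w y\<bar> + (exp (Q * \<bar>x - y\<bar> powr \<alpha>) - 1) * \<bar>f' w y\<bar>"
      using dist[rule_format, OF w xy] by linarith
    also have "\<dots> = exp (Q * \<bar>x - y\<bar> powr \<alpha>) * \<bar>f' w y\<bar>" by (simp add: algebra_simps)
    also have "\<dots> \<le> Z * \<bar>f' w y\<bar>" using exp_le[OF xy] by (intro mult_right_mono) auto
    finally show ?thesis .
  qed
  obtain i0 y0 where "i0 \<in> {1..N}" "y0 \<in> core"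
    using N_pos(2) core(4) by blast
  then have "m \<le> \<bar>deriv (\<phi> i0) y0\<bar>" "\<bar>deriv (\<phi> i0) y0\<bar> \<le> contraction"
    using m(2) contraction(3) core(3) by blast+
  then have "m \<le> 1" using contraction(2) by linarith
  then have c: "0 < c" "c \<le> 1" using m Z by (auto simp: c_def field_simps)
  have lower: "c * L w \<le> \<bar>f' w y\<bar>" if w: "w \<in> words N" and y: "y \<in> core" for w y
  proof -
    have y\<Omega>: "y \<in> \<Omega>" using y core(3) by blast
    \<comment> \<open>The supremum \<open>L w\<close> runs over \<open>\<Omega>\<close>, but
      distortion is known on \<open>core\<close> only. The last letter of \<open>w\<close>, which is
      applied first, maps \<open>x\<close> and \<open>y\<close> into \<open>core\<close>, where the
      remaining word is compared.\<close>
    have "\<bar>f' w x\<bar> \<le> Z / m * \<bar>f' w y\<bar>" if x: "x \<in> \<Omega>" for x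
    proof (cases w rule: rev_cases)
      case Nil
      then show ?thesis
        using \<open>m \<le> 1\<close> m(1) Z by (simp add: deriv_word_Nil field_simps del: word_map.simps)
    next
      case (snoc u i)
      then have ui: "u \<in> words N" "i \<in> {1..N}" "[i] \<in> words N" using w by auto
      have wd: "f' w z = f' u (\<phi> i z) * deriv (\<phi> i) z" if "z \<in> \<Omega>" for z
        using deriv_word_append[OF ui(1,3) that] snoc by simp
      have "\<bar>f' u (\<phi> i x)\<bar> \<le> Z * \<bar>f' u (\<phi> i y)\<bar>"
        by (rule comparable[OF ui(1) core(5)[OF ui(2) x] core(5)[OF ui(2) y\<Omega>]])
      moreover have "\<bar>deriv (\<phi> i) x\<bar> \<le> 1"
        using contraction(3)[OF ui(2) x] contraction(2) by linarith
      ultimately have "\<bar>f' w x\<bar> \<le> Z * \<bar>f' u (\<phi> i y)\<bar> * 1"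
        unfolding wd[OF x] abs_mult using Z by (intro mult_mono) auto
      also have "\<dots> \<le> Z * \<bar>f' u (\<phi> i y)\<bar> * (\<bar>deriv (\<phi> i) y\<bar> / m)"
        using m(2)[rule_format, OF ui(2) y] m(1) Z by (intro mult_left_mono) auto
      finally show ?thesis unfolding wd[OF y\<Omega>] by (simp add: abs_mult)
    qed
    then have "L w \<le> Z / m * \<bar>f' w y\<bar>"
      unfolding deriv_norm_def using \<Omega>(1) by (intro cSUP_least) auto
    then show ?thesis using Z m(1) by (simp add: c_def field_simps)
  qed
  have "quasi_conformal_ifs N \<phi> F L c contraction \<alpha> H"
  proof
    show "L [] = 1"
      unfolding deriv_norm_def using \<Omega>(1) by (simp add: deriv_word_Nil del: word_map.simps)
    show "0 < H" using \<alpha> Z by (simp add: H_def)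
  next
    fix w x y assume w: "w \<in> words N" and xy: "x \<in> F" "y \<in> F"
    have xyc: "x \<in> core" "y \<in> core" "x \<in> \<Omega>" "y \<in> \<Omega>" using xy F_core core(3) by auto
    show "c * L w * \<bar>x - y\<bar> \<le> \<bar>f w x - f w y\<bar>"
      and "\<bar>f w x - f w y\<bar> \<le> L w * \<bar>x - y\<bar>"
    proof (atomize (full), cases "x = y")
      case False
      obtain \<xi> where \<xi>: "\<xi> \<in> closed_segment x y"
        "f w x - f w y = f' w \<xi> * (x - y)"
        by (rule word_mean_value[OF w xyc(3,4) False])
      have "\<xi> \<in> core" using \<xi>(1) closed_segment_subset[OF xyc(1,2) core(2)] by blast
      then have "c * L w \<le> \<bar>f' w \<xi>\<bar>" "\<bar>f' w \<xi>\<bar> \<le> L w"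
        using lower[OF w] L_bounds(1)[OF w] core(3) by auto
      then show "c * L w * \<bar>x - y\<bar> \<le> \<bar>f w x - f w y\<bar> \<and>
          \<bar>f w x - f w y\<bar> \<le> L w * \<bar>x - y\<bar>"
        unfolding \<xi>(2) abs_mult by (intro conjI mult_right_mono) auto
    qed simp
  next
    fix w x y x' y' z d
    assume w: "w \<in> words N" and F: "x \<in> F" "y \<in> F" "x' \<in> F" "y' \<in> F" and ne: "x \<noteq> y" "x' \<noteq> y'"
      and ball: "{x, y, x', y'} \<subseteq> cball z d"
    have mem: "x \<in> core" "y \<in> core" "x' \<in> core" "y' \<in> core" using F F_core by auto
    have mem\<Omega>: "x \<in> \<Omega>" "y \<in> \<Omega>" "x' \<in> \<Omega>" "y' \<in> \<Omega>" using mem core(3) by auto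
    obtain \<xi> where \<xi>: "\<xi> \<in> closed_segment x y"
      "f w x - f w y = f' w \<xi> * (x - y)"
      by (rule word_mean_value[OF w mem\<Omega>(1,2) ne(1)])
    obtain \<eta> where \<eta>: "\<eta> \<in> closed_segment x' y'"
      "f w x' - f w y' = f' w \<eta> * (x' - y')"
      by (rule word_mean_value[OF w mem\<Omega>(3,4) ne(2)])
    have core': "\<xi> \<in> core" "\<eta> \<in> core"
      using \<xi>(1) \<eta>(1) closed_segment_subset[OF mem(1,2) core(2)] closed_segment_subset[OF mem(3,4) core(2)] by auto
    \<comment> \<open>The intermediate points of both mean value identities stay in the convex ball,
      so they are at most \<open>2 * d\<close> apart.\<close>
    have "closed_segment x y \<subseteq> cball z d" "closed_segment x' y' \<subseteq> cball z d"
      using ball by (intro closed_segment_subset convex_cball; simp)+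
    then have "dist z \<xi> \<le> d" "dist z \<eta> \<le> d" using \<xi>(1) \<eta>(1) by auto
    then have "\<bar>\<xi> - \<eta>\<bar> \<le> 2 * d" unfolding dist_real_def by linarith
    then have pw: "\<bar>\<xi> - \<eta>\<bar> powr \<alpha> \<le> (2 * d) powr \<alpha>" using \<alpha>(1) by (intro powr_mono2) auto
    define t where "t = Q * \<bar>\<xi> - \<eta>\<bar> powr \<alpha>"
    have t: "0 \<le> t" "exp t \<le> Z" "t \<le> Q * (2 * d) powr \<alpha>"
      using \<alpha>(2) exp_le[OF core'] pw by (auto simp: t_def)
    have "1 - t \<le> exp (- t)" using exp_ge_add_one_self[of "- t"] by simp
    then have "exp t * (1 - t) \<le> exp t * exp (- t)" by (intro mult_left_mono) auto
    then have "exp t - 1 \<le> t * exp t" by (simp add: exp_minus field_simps)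
    also have "\<dots> \<le> (Q * (2 * d) powr \<alpha>) * Z" using t by (intro mult_mono) auto
    finally have e: "exp t - 1 \<le> H * (2 * d) powr \<alpha>" by (simp add: H_def mult_ac)
    have "\<bar>f' w \<xi> - f' w \<eta>\<bar> \<le> (exp t - 1) * \<bar>f' w \<eta>\<bar>"
      unfolding t_def by (rule dist[rule_format, OF w core'])
    also have "\<dots> \<le> (H * (2 * d) powr \<alpha>) * L w"
      using e L_bounds(1)[OF w, of \<eta>] core' core(3) H_def \<alpha>(2) Z(1) by (intro mult_mono) auto
    finally show "\<bar>(f w x - f w y) / (x - y) - (f w x' - f w y') / (x' - y')\<bar>
        \<le> H * L w * (2 * d) powr \<alpha>"
      using ne by (simp add: \<xi>(2) \<eta>(2) mult_ac)
  next
    fix w assume "w \<in> words N"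
    then show "\<exists>\<sigma>\<in>{1,-1}. \<forall>x\<in>F. \<forall>y\<in>F. x < y \<longrightarrow> 0 < \<sigma> * (f w y - f w x)"
      using word_monotone F_\<Omega> by (meson subsetD)
  qed (use compact_F two_points invariant c contraction \<alpha> L_bounds in blast)+
  then show ?thesis by blast
qed

end

text \<open>A positive extended real infimum exceeds some positive real, which serves as the uniform
  constant. Without pairs of distinct maps the infimum is infinite and any constant works, so both
  sides agree there too.\<close>

lemma identity_limit_criterion_iff:
  assumes pos: "\<And>w. w \<in> words N \<Longrightarrow> 0 < deriv_norm \<Omega> (word_map \<phi> w)"
  shows "identity_limit_criterion N \<phi> \<Omega> F \<longleftrightarrow>
    (\<exists>k>0. \<forall>v\<in>words N. \<forall>w\<in>words N. restrict (word_map \<phi> v) F \<noteq> restrict (word_map \<phi> w) F \<longrightarrow>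
       k * deriv_norm \<Omega> (word_map \<phi> v) \<le> (SUP x\<in>F. \<bar>word_map \<phi> v x - word_map \<phi> w x\<bar>))"
    (is "_ \<longleftrightarrow> (\<exists>k>0. \<forall>v\<in>words N. \<forall>w\<in>words N. ?ne v w \<longrightarrow> k * ?L v \<le> ?g v w)")
proof -
  define I where "I = (INF (v, w) \<in> {(v, w). v \<in> words N \<and> w \<in> words N \<and> ?ne v w}. ereal (inverse (?L v) * ?g v w))"
  have crit: "identity_limit_criterion N \<phi> \<Omega> F \<longleftrightarrow> 0 < I"
    by (simp only: identity_limit_criterion_def I_def)
  have div: "k \<le> inverse (?L v) * ?g v w \<longleftrightarrow> k * ?L v \<le> ?g v w" if "v \<in> words N" for k v w
    using pos[OF that] by (simp add: field_simps)
  show ?thesis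
    unfolding crit
  proof
    assume "0 < I"
    then obtain k :: real where k: "0 < ereal k" "ereal k < I"
      using ereal_dense2 by blast
    have "k * ?L v \<le> ?g v w" if vw: "v \<in> words N" "w \<in> words N" "?ne v w" for v w
    proof -
      have "I \<le> (case (v, w) of (v, w) \<Rightarrow> ereal (inverse (?L v) * ?g v w))"
        unfolding I_def by (rule INF_lower) (use vw in blast)
      then have "ereal k < ereal (inverse (?L v) * ?g v w)"
        using k(2) by (simp del: less_ereal.simps)
      then have "k \<le> inverse (?L v) * ?g v w" by simp
      then show ?thesis using div[OF vw(1)] by blast
    qed
    then show "\<exists>k>0. \<forall>v\<in>words N. \<forall>w\<in>words N. ?ne v w \<longrightarrow> k * ?L v \<le> ?g v w"
      using k(1) by (intro exI[of _ k]) simp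
  next
    assume "\<exists>k>0. \<forall>v\<in>words N. \<forall>w\<in>words N. ?ne v w \<longrightarrow> k * ?L v \<le> ?g v w"
    then obtain k where k: "0 < k" "\<forall>v\<in>words N. \<forall>w\<in>words N. ?ne v w \<longrightarrow> k * ?L v \<le> ?g v w"
      by (elim exE conjE)
    have "ereal k \<le> I"
      unfolding I_def
    proof (rule INF_greatest)
      fix p assume p: "p \<in> {(v, w). v \<in> words N \<and> w \<in> words N \<and> ?ne v w}"
      obtain v w where vw: "p = (v, w)"
        by (cases p)
      then have "v \<in> words N" "k * ?L v \<le> ?g v w" using p k(2) by blast+
      then have "k \<le> inverse (?L v) * ?g v w" using div by blast
      then show "ereal k \<le> (case p of (v, w) \<Rightarrow> ereal (inverse (?L v) * ?g v w))" by (simp add: vw)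
    qed
    then show "0 < I" using k(1) by (metis ereal_less(2) less_le_trans)
  qed
qed

theorem corollary4p2:
  fixes N :: nat and \<phi> :: "nat \<Rightarrow> real \<Rightarrow> real" and \<Omega> F :: "real set" and s :: real
  assumes "self_conformal_set N \<phi> \<Omega> F"
    and "\<exists>x\<in>F. \<exists>y\<in>F. x \<noteq> y"
    and "hausdorff_dim F = ereal s"
    and "s < 1"
  shows "(weak_separation N \<phi> F \<longleftrightarrow> hausdorff_measure s F > 0) \<and>
         (hausdorff_measure s F > 0 \<longleftrightarrow> ahlfors_regular s F) \<and>
         (ahlfors_regular s F \<longleftrightarrow> assouad_dim F = ereal s) \<and>
         (assouad_dim F = ereal s \<longleftrightarrow> identity_limit_criterion N \<phi> \<Omega> F)"
proof -
  interpret sys: conformal_system N \<phi> \<Omega> F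
    using assms(1,2) by unfold_locales
  obtain c \<alpha> H where "quasi_conformal_ifs N \<phi> F (\<lambda>w. deriv_norm \<Omega> (word_map \<phi> w)) c sys.contraction \<alpha> H"
    using sys.ex_quasi_conformal by (elim exE)
  then interpret quasi_conformal_ifs_dim N \<phi> F "\<lambda>w. deriv_norm \<Omega> (word_map \<phi> w)" c sys.contraction \<alpha> H s
    using assms(3) by (simp add: quasi_conformal_ifs_dim_def quasi_conformal_ifs_dim_axioms_def)
  have gap: "identity_limit_criterion N \<phi> \<Omega> F \<longleftrightarrow> identity_gap"
    unfolding identity_gap_def by (rule identity_limit_criterion_iff) (rule L_pos)
  have 1: "ahlfors_regular s F" if "weak_separation N \<phi> F"
    using that by (rule ahlfors_regular_of_weak_separation)
  have 2: "hausdorff_measure s F > 0" if "ahlfors_regular s F"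
    using hausdorff_measure_pos_of_ahlfors_regular[OF compact_F D_pos dim_pos that]
    by (simp add: zero_less_iff_neq_zero)
  have 3: "assouad_dim F = ereal s" if "hausdorff_measure s F > 0"
    using that by (intro assouad_dim_eq_dimI covering_exponent_of_pos_measure) auto
  have 4: "identity_limit_criterion N \<phi> \<Omega> F" if dimA: "assouad_dim F = ereal s"
  proof (rule ccontr)
    assume "\<not> ?thesis"
    then have "\<not> identity_gap" using gap by blast
    \<comment> \<open>Here \<open>s < 1\<close> enters: some covering exponent lies below 1, which
      the chains of points forbid.\<close>
    moreover obtain t where "t < 1" "covering_exponent F t"
      using ex_covering_exponent_less[OF dimA assms(4)] by blast
    ultimately show False
      using covering_exponent_ge_1[of t] by linarith
  qed
  have 5: "weak_separation N \<phi> F" if "identity_limit_criterion N \<phi> \<Omega> F"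
    using that gap weak_separation_of_identity_gap by blast
  show ?thesis using 1 2 3 4 5 by blast
qed

end
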